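(* Let $1\le l<l_0<\infty$ and let $X_0,X\in\mathcal H$ be such that $\sigma_X<\sigma_{X_0}$, $l_0'\sigma_{X_0'}=l'\sigma_{X'}$ and $X_0',X'\in\mathcal H$. Assume: (i) There exist Banach spaces $X_1,X_2\in\mathcal H$ such that $$\theta_1<\frac{l_0'}{l'}<\theta_2<\min\Big\{\frac{l_0'}{l'}+\frac{2l_0'}n,\,1\Big\},\qquad \theta_i=\frac{\sigma_{X_i'}}{\sigma_{X_0'}},\ i=1,2.$$ (ii) For $\theta\in(0,1)$ such that $\frac{l_0'}{l'}=\theta\theta_2+(1-\theta)\theta_1$, one has $X\hookrightarrow(X_1,X_2)_{\theta,1}$ and $(L^\infty,X_0')_{\theta_i,d_i}\hookrightarrow X_i'$ for some $1\le d_i\le\infty$, $i=1,2$. Assume also the Hölder-type inequality $\|fg\|_{X_0'}\le C\|f\|_{X'}\|g\|_{X'}$. If $n>4$, then there is a constant $K>0$ such that $$\sup_{t>0}\|B_1(u,v)(t)\|_{\mathcal M[X']^{n/2}}\le K\sup_{t>0}\|u(t)\|_{\mathcal M[X']^{n/2}}\sup_{t>0}\|v(t)\|_{\mathcal M[X']^{n/2}}$$ for all $u,v\in L^\infty((0,\infty);\mathcal M[X']^{n/2})$.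
   Context: All spaces are over $\mathbb R^n$. For $l\in[1,\infty]$, $l'$ is the Hölder conjugate; $X'$ is the dual of $X$ (via the integral pairing when it is a function space). $D(a,r)$ is the ball of center $a$ and radius $r$; $(\cdot,\cdot)_{\theta,d}$ is real interpolation. $B_1=(B_{1,1},\dots,B_{1,n})$ with $$B_{1,i}(u,v)(t)=\int_0^tU(t-s)\langle A_i\cdot u(s),v(s)\rangle\,ds,\qquad i=1,\dots,n,$$ where $A_i$ are constant $n\times n$ matrices, $u,v$ are $\mathbb R^n$-valued (norms componentwise), $U(t)f=\Phi(t,\cdot)*f$, $\Phi(t,x)=(4\pi t)^{-n/2}e^{-|x|^2/(4t)}$; the integral is understood weakly by duality with the predual $\mathcal{PD}[X]^{n/(n-2)}$ of $\mathcal M[X']^{n/2}$. $\mathcal G$: Banach spaces $F\subset\mathcal S'$ for which there are $\sigma_F\in\mathbb R$, $C>0$ with $f(\lambda\cdot)\in F$, $\|f(\lambda\cdot)\|_F\le C\lambda^{\sigma_F}\|f\|_F$ for all $\lambda>0,f\in F$; $\sigma_F$ is the scaling exponent. $\mathcal H\subset\mathcal G$: Banach spaces $X$ of measurable functions such that (M1) $X\hookrightarrow L^1_{loc}$; (M2) $f\in X,g\in L^\infty$ imply $fg\in X$, $\|fg\|_X\le C\|g\|_{L^\infty}\|f\|_X$; (M3) $f\in X$, $x_0\in\mathbb R^n$ imply $f(\cdot-x_0)\in X$, $\|f(\cdot-x_0)\|_X\le C\|f\|_X$; (M4) for $g\in L^1_{loc}$ and $K:\mathbb R^n\times\mathbb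 R^n\to\mathbb R$ with $K(\cdot,y)\in X$ for every $y$, $\|\int g(y)K(\cdot,y)dy\|_X\le C\int|g(y)|\|K(\cdot,y)\|_Xdy$; (M5) $1_{D(0,1)}\in X$; (M6) if $f\in L^1_{loc}$, $f1_{D(x_0,R)}\in X$ for all $x_0,R$ and $\sup_{x_0,R}\|1_{D(x_0,R)}f\|_X<\infty$, then $f\in X$ and $\|f\|_X\le C\sup_{x_0,R}\|1_{D(x_0,R)}f\|_X$. Morrey spaces: for $\frac nl+\sigma_X\le0$ (always assumed when the space is written), $\mathcal M[X]^l=\{g\in\mathcal S':\|g\|_{\mathcal M[X]^l}=\sup_{x,\rho}\rho^{\frac nl+\sigma_X}\|1_{D(x,\rho)}g\|_X<\infty\}$. Block spaces: for $\frac nl+\sigma_X\ge0$ (always assumed; it is assumed here for the pairs $(X,l)$ and $(X_0,l_0)$), an $(l,X)$-block is a measurable $b$ with $\mathrm{supp}\,b\subset D(a,\rho)$ and $\rho^{\frac nl+\sigma_X}\|1_{D(a,\rho)}b\|_X\le1$ for some $a,\rho$; $\mathcal{PD}[X]^l$ is the set of $h\in\mathcal S'$ with $h=\sum_k\alpha_kb_k$ a.e., $b_k$ $(l,X)$-blocks, $\sum|\alpha_k|<\infty$, normed by $\inf\sum|\alpha_k|$; its dual is identified with $\mathcal M[X']^{l'}$. *)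

theory Defs
  imports "HOL-Analysis.Analysis" "HOL-Probability.Essential_Supremum"
begin

section \<open>Normed spaces given by a carrier and a norm\<close>

text \<open>
  The spaces in question are subspaces of spaces of functions, modulo equality almost everywhere,
  so they are carriers together with a norm, not types. Elements are representatives.
\<close>

record 'b nspace =
  elems :: "'b set"
  nrm :: "'b \<Rightarrow> real"

type_synonym 'n fspace = "(real ^ 'n \<Rightarrow> real) nspace"

definition embeds :: "'b nspace \<Rightarrow> 'b nspace \<Rightarrow> bool" where
  "embeds X Y \<longleftrightarrow> elems X \<subseteq> elems Y \<and> (\<exists>C. \<forall>f\<in>elems X. nrm Y f \<le> C * nrm X f)"

definition banach_fspace :: "('n::finite) fspace \<Rightarrow> bool" where
  "banach_fspace X \<longleftrightarrow>
     elems X \<subseteq> borel_measurable lebesgue \<and>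
     (\<forall>f\<in>elems X. \<forall>g\<in>borel_measurable lebesgue.
        (AE x in lebesgue. f x = g x) \<longrightarrow> g \<in> elems X \<and> nrm X g = nrm X f) \<and>
     (\<lambda>x. 0) \<in> elems X \<and>
     (\<forall>f\<in>elems X. \<forall>g\<in>elems X.
        (\<lambda>x. f x + g x) \<in> elems X \<and> nrm X (\<lambda>x. f x + g x) \<le> nrm X f + nrm X g) \<and>
     (\<forall>f\<in>elems X. \<forall>c. (\<lambda>x. c * f x) \<in> elems X \<and> nrm X (\<lambda>x. c * f x) = \<bar>c\<bar> * nrm X f) \<and>
     (\<forall>f\<in>elems X. nrm X f \<ge> 0 \<and> (nrm X f = 0 \<longleftrightarrow> (AE x in lebesgue. f x = 0))) \<and>
     (\<forall>F. (\<forall>k. F k \<in> elems X) \<and>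
          (\<forall>e>0. \<exists>N. \<forall>j\<ge>N. \<forall>k\<ge>N. nrm X (\<lambda>x. F j x - F k x) < e) \<longrightarrow>
          (\<exists>f\<in>elems X. (\<lambda>k. nrm X (\<lambda>x. F k x - f x)) \<longlonglongrightarrow> (0::real)))"

definition L1loc :: "(real ^ 'n::finite \<Rightarrow> real) set" where
  "L1loc = {f \<in> borel_measurable lebesgue. \<forall>S. compact S \<longrightarrow> set_integrable lebesgue S f}"

definition Linf :: "('n::finite) fspace" where
  "Linf = \<lparr>elems = {f \<in> borel_measurable lebesgue. esssup lebesgue (\<lambda>x. ereal \<bar>f x\<bar>) < \<infinity>},
           nrm = (\<lambda>f. real_of_ereal (esssup lebesgue (\<lambda>x. ereal \<bar>f x\<bar>)))\<rparr>"

text \<open>The function \<open>1\<^bsub>D\<^esub> f\<close> for the ball \<open>D\<close> of centre \<open>a\<close> and radius \<open>r\<close>.\<close>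

definition cut :: "real ^ 'n::finite \<Rightarrow> real \<Rightarrow> (real ^ 'n \<Rightarrow> real) \<Rightarrow> real ^ 'n \<Rightarrow> real" where
  "cut a r f = (\<lambda>x. indicator (ball a r) x * f x)"

section \<open>Tempered distributions\<close>

definition partial :: "'n::finite \<Rightarrow> (real ^ 'n \<Rightarrow> real) \<Rightarrow> real ^ 'n \<Rightarrow> real" where
  "partial i f = (\<lambda>x. frechet_derivative f (at x) (axis i 1))"

definition smooth :: "(real ^ 'n::finite \<Rightarrow> real) \<Rightarrow> bool" where
  "smooth f \<longleftrightarrow> (\<forall>is x. foldr partial is f differentiable (at x))"

definition test_functions :: "(real ^ 'n::finite \<Rightarrow> real) set" where
  "test_functions = {f. smooth f \<and> bounded {x. f x \<noteq> 0}}"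

definition schwartz :: "(real ^ 'n::finite \<Rightarrow> real) set" where
  "schwartz = {f. smooth f \<and> (\<forall>N is. bounded (range (\<lambda>x. (1 + norm x) ^ N * foldr partial is f x)))}"

definition schwartz_norm :: "nat \<Rightarrow> (real ^ 'n::finite \<Rightarrow> real) \<Rightarrow> real" where
  "schwartz_norm N f = (\<Sum>is\<in>{is. length is \<le> N}. SUP x. (1 + norm x) ^ N * \<bar>foldr partial is f x\<bar>)"

definition tempered_distribution :: "((real ^ 'n::finite \<Rightarrow> real) \<Rightarrow> real) \<Rightarrow> bool" where
  "tempered_distribution T \<longleftrightarrow>
     (\<forall>f\<in>schwartz. \<forall>g\<in>schwartz. \<forall>a b. T (\<lambda>x. a * f x + b * g x) = a * T f + b * T g) \<and>
     (\<exists>C N. \<forall>f\<in>schwartz. \<bar>T f\<bar> \<le> C * schwartz_norm N f)"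

definition pairing :: "(real ^ 'n::finite \<Rightarrow> real) \<Rightarrow> (real ^ 'n \<Rightarrow> real) \<Rightarrow> real" where
  "pairing g f = (\<integral>x. f x * g x \<partial>lebesgue)"

text \<open>
  A locally integrable function belongs to \<open>\<S>'\<close> if the distribution it defines on
  compactly supported test functions extends to a tempered distribution.
\<close>

definition tempered_functions :: "(real ^ 'n::finite \<Rightarrow> real) set" where
  "tempered_functions = {f \<in> L1loc. \<exists>T. tempered_distribution T \<and>
     (\<forall>\<phi>\<in>test_functions. T \<phi> = pairing f \<phi>)}"

section \<open>Duals\<close>

definition dual :: "('n::finite) fspace \<Rightarrow> ((real ^ 'n \<Rightarrow> real) \<Rightarrow> real) nspace" where
  "dual X = \<lparr>elems = {T.
       (\<forall>f\<in>elems X. \<forall>g\<in>elems X. \<forall>a b. T (\<lambda>x. a * f x + b * g x) = a * T f + b * T g) \<and>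
       (\<exists>C. \<forall>f\<in>elems X. \<bar>T f\<bar> \<le> C * nrm X f)},
     nrm = (\<lambda>T. Sup {\<bar>T f\<bar> | f. f \<in> elems X \<and> nrm X f \<le> 1})\<rparr>"

text \<open>
  The functions that define an element of the dual through the integral pairing, with the
  dual norm. Hence \<open>embeds Z (fdual X)\<close> says that \<open>Z\<close> embeds into the dual of \<open>X\<close> by
  means of the pairing, whether or not every functional on \<open>X\<close> is given by a function; if every
  functional is (\<open>dual_is_function_space\<close>), then \<open>fdual X\<close> is the dual.
\<close>

definition fdual :: "('n::finite) fspace \<Rightarrow> 'n fspace" where
  "fdual X = \<lparr>elems = {g \<in> borel_measurable lebesgue.
       (\<forall>f\<in>elems X. integrable lebesgue (\<lambda>x. f x * g x)) \<and> pairing g \<in> elems (dual X)},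
     nrm = (\<lambda>g. nrm (dual X) (pairing g))\<rparr>"

definition dual_is_function_space :: "('n::finite) fspace \<Rightarrow> bool" where
  "dual_is_function_space X \<longleftrightarrow>
     (\<forall>T\<in>elems (dual X). \<exists>g\<in>elems (fdual X). \<forall>f\<in>elems X. T f = pairing g f)"

section \<open>Scaling\<close>

definition dilate :: "real \<Rightarrow> (real ^ 'n::finite \<Rightarrow> real) \<Rightarrow> real ^ 'n \<Rightarrow> real" where
  "dilate r f = (\<lambda>x. f (r *\<^sub>R x))"

text \<open>
  The dilation of distributions, which extends the one of functions:
  \<open>\<integral> g(r x) f(x) dx = r\<^sup>-\<^sup>n \<integral> g(y) f(y/r) dy\<close>.
\<close>

definition dilate_functional ::
    "real \<Rightarrow> ((real ^ 'n::finite \<Rightarrow> real) \<Rightarrow> real) \<Rightarrow> (real ^ 'n \<Rightarrow> real) \<Rightarrow> real" where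
  "dilate_functional r T = (\<lambda>f. T (dilate (1 / r) f) / r ^ CARD('n))"

definition has_scaling :: "(real \<Rightarrow> 'b \<Rightarrow> 'b) \<Rightarrow> 'b nspace \<Rightarrow> real \<Rightarrow> bool" where
  "has_scaling dil F \<sigma> \<longleftrightarrow> (\<exists>C>0. \<forall>r>0. \<forall>f\<in>elems F.
     dil r f \<in> elems F \<and> nrm F (dil r f) \<le> C * r powr \<sigma> * nrm F f)"

text \<open>The exponent is unique as soon as \<open>F\<close> has an element of nonzero norm.\<close>

definition sigma :: "('n::finite) fspace \<Rightarrow> real" where
  "sigma X = (THE \<sigma>. has_scaling dilate X \<sigma>)"

definition sigma_dual :: "('n::finite) fspace \<Rightarrow> real" where
  "sigma_dual X = (THE \<sigma>. has_scaling dilate_functional (dual X) \<sigma>)"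

section \<open>The classes \<open>\<G>\<close> and \<open>\<H>\<close>\<close>

text \<open>The members of \<open>\<G>\<close> that consist of functions.\<close>

definition class_G :: "('n::finite) fspace \<Rightarrow> bool" where
  "class_G X \<longleftrightarrow> banach_fspace X \<and> elems X \<subseteq> tempered_functions \<and> (\<exists>\<sigma>. has_scaling dilate X \<sigma>)"

definition M1 :: "('n::finite) fspace \<Rightarrow> bool" where
  "M1 X \<longleftrightarrow> elems X \<subseteq> L1loc \<and>
     (\<forall>S. compact S \<longrightarrow> (\<exists>C. \<forall>f\<in>elems X. (LINT x:S|lebesgue. \<bar>f x\<bar>) \<le> C * nrm X f))"

definition M2 :: "('n::finite) fspace \<Rightarrow> bool" where
  "M2 X \<longleftrightarrow> (\<exists>C. \<forall>f\<in>elems X. \<forall>g\<in>elems Linf.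
     (\<lambda>x. f x * g x) \<in> elems X \<and> nrm X (\<lambda>x. f x * g x) \<le> C * nrm Linf g * nrm X f)"

definition M3 :: "('n::finite) fspace \<Rightarrow> bool" where
  "M3 X \<longleftrightarrow> (\<exists>C. \<forall>f\<in>elems X. \<forall>x0.
     (\<lambda>x. f (x - x0)) \<in> elems X \<and> nrm X (\<lambda>x. f (x - x0)) \<le> C * nrm X f)"

text \<open>
  The measurability conditions on \<open>k\<close> give a meaning to the integrals; the inequality is
  void if its right-hand side is infinite.
\<close>

definition M4 :: "('n::finite) fspace \<Rightarrow> bool" where
  "M4 X \<longleftrightarrow> (\<exists>C. \<forall>g\<in>L1loc. \<forall>k :: real ^ 'n \<Rightarrow> real ^ 'n \<Rightarrow> real.
     (\<lambda>(x, y). k x y) \<in> borel_measurable lebesgue \<and>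
     (\<forall>y. (\<lambda>x. k x y) \<in> elems X) \<and>
     (\<lambda>y. nrm X (\<lambda>x. k x y)) \<in> borel_measurable lebesgue \<and>
     integrable lebesgue (\<lambda>y. \<bar>g y\<bar> * nrm X (\<lambda>x. k x y)) \<longrightarrow>
     (\<lambda>x. \<integral>y. g y * k x y \<partial>lebesgue) \<in> elems X \<and>
     nrm X (\<lambda>x. \<integral>y. g y * k x y \<partial>lebesgue) \<le> C * (\<integral>y. \<bar>g y\<bar> * nrm X (\<lambda>x. k x y) \<partial>lebesgue))"

definition M5 :: "('n::finite) fspace \<Rightarrow> bool" where
  "M5 X \<longleftrightarrow> indicator (ball 0 1) \<in> elems X"

definition M6 :: "('n::finite) fspace \<Rightarrow> bool" where
  "M6 X \<longleftrightarrow> (\<exists>C. \<forall>f\<in>L1loc.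
     (\<forall>x0. \<forall>R>0. cut x0 R f \<in> elems X) \<and>
     bdd_above {nrm X (cut x0 R f) | x0 R. R > 0} \<longrightarrow>
     f \<in> elems X \<and> nrm X f \<le> C * Sup {nrm X (cut x0 R f) | x0 R. R > 0})"

definition class_H :: "('n::finite) fspace \<Rightarrow> bool" where
  "class_H X \<longleftrightarrow> class_G X \<and> M1 X \<and> M2 X \<and> M3 X \<and> M4 X \<and> M5 X \<and> M6 X"

section \<open>Real interpolation (K-method)\<close>

definition K_functional ::
    "('n::finite) fspace \<Rightarrow> 'n fspace \<Rightarrow> real \<Rightarrow> (real ^ 'n \<Rightarrow> real) \<Rightarrow> real" where
  "K_functional X Y t f = Inf {nrm X a + t * nrm Y b | a b.
     a \<in> elems X \<and> b \<in> elems Y \<and> f = (\<lambda>x. a x + b x)}"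

text \<open>Every function that equals \<open>a + b\<close> a.e. is again such a sum, after changing \<open>b\<close> on a null set.\<close>

definition interp :: "('n::finite) fspace \<Rightarrow> 'n fspace \<Rightarrow> real \<Rightarrow> ereal \<Rightarrow> 'n fspace" where
  "interp X Y \<theta> d = (let
     S = {\<lambda>x. a x + b x | a b. a \<in> elems X \<and> b \<in> elems Y};
     \<Phi> = (\<lambda>f t. t powr (- \<theta>) * K_functional X Y t f);
     I = (\<lambda>f. \<integral>\<^sup>+t\<in>{0<..}. ennreal (\<Phi> f t powr real_of_ereal d / t) \<partial>lborel)
     in if d = \<infinity>
        then \<lparr>elems = {f \<in> S. bdd_above (\<Phi> f ` {0<..})}, nrm = (\<lambda>f. SUP t\<in>{0<..}. \<Phi> f t)\<rparr>
        else \<lparr>elems = {f \<in> S. I f < \<infinity>}, nrm = (\<lambda>f. enn2real (I f) powr (1 / real_of_ereal d))\<rparr>)"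

section \<open>Morrey and block spaces\<close>

definition morrey :: "('n::finite) fspace \<Rightarrow> real \<Rightarrow> 'n fspace" where
  "morrey X l = (let
     V = (\<lambda>g. {\<rho> powr (real CARD('n) / l + sigma X) * nrm X (cut x \<rho> g) | x \<rho>. \<rho> > 0})
     in \<lparr>elems = {g \<in> tempered_functions. (\<forall>x. \<forall>\<rho>>0. cut x \<rho> g \<in> elems X) \<and> bdd_above (V g)},
         nrm = (\<lambda>g. Sup (V g))\<rparr>)"

definition is_block :: "('n::finite) fspace \<Rightarrow> real \<Rightarrow> (real ^ 'n \<Rightarrow> real) \<Rightarrow> bool" where
  "is_block X l b \<longleftrightarrow> b \<in> borel_measurable lebesgue \<and> (\<exists>a \<rho>. \<rho> > 0 \<and>
     (AE x in lebesgue. x \<notin> ball a \<rho> \<longrightarrow> b x = 0) \<and> cut a \<rho> b \<in> elems X \<and>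
     \<rho> powr (real CARD('n) / l + sigma X) * nrm X (cut a \<rho> b) \<le> 1)"

definition block_decomposition ::
    "('n::finite) fspace \<Rightarrow> real \<Rightarrow> (real ^ 'n \<Rightarrow> real) \<Rightarrow> (nat \<Rightarrow> real) \<Rightarrow> bool" where
  "block_decomposition X l h \<alpha> \<longleftrightarrow> summable (\<lambda>k. \<bar>\<alpha> k\<bar>) \<and>
     (\<exists>b. (\<forall>k. is_block X l (b k)) \<and> (AE x in lebesgue. (\<lambda>k. \<alpha> k * b k x) sums h x))"

definition block_space :: "('n::finite) fspace \<Rightarrow> real \<Rightarrow> 'n fspace" where
  "block_space X l =
     \<lparr>elems = {h \<in> tempered_functions. \<exists>\<alpha>. block_decomposition X l h \<alpha>},
      nrm = (\<lambda>h. Inf {\<Sum>k. \<bar>\<alpha> k\<bar> | \<alpha>. block_decomposition X l h \<alpha>})\<rparr>"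

section \<open>Vector fields and \<open>L\<^sup>\<infinity>\<close> in time\<close>

definition vec_space :: "('n::finite) fspace \<Rightarrow> (real ^ 'n \<Rightarrow> real ^ 'n) nspace" where
  "vec_space E = \<lparr>elems = {u. \<forall>i. (\<lambda>x. u x $ i) \<in> elems E},
     nrm = (\<lambda>u. \<Sum>i\<in>UNIV. nrm E (\<lambda>x. u x $ i))\<rparr>"

definition simple_in_time ::
    "(real ^ 'n \<Rightarrow> real ^ 'n) nspace \<Rightarrow> (real \<Rightarrow> real ^ 'n::finite \<Rightarrow> real ^ 'n) \<Rightarrow> bool" where
  "simple_in_time E s \<longleftrightarrow> finite (s ` {0<..}) \<and> s ` {0<..} \<subseteq> elems E \<and>
     (\<forall>g. {t. t > 0 \<and> s t = g} \<in> sets lebesgue)"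

text \<open>Strong (Bochner) measurability; the norm is the essential supremum.\<close>

definition Linf_time ::
    "(real ^ 'n::finite \<Rightarrow> real ^ 'n) nspace \<Rightarrow> (real \<Rightarrow> real ^ 'n \<Rightarrow> real ^ 'n) nspace" where
  "Linf_time E = \<lparr>elems = {u. (\<forall>t>0. u t \<in> elems E) \<and>
       (\<exists>s. (\<forall>k::nat. simple_in_time E (s k)) \<and>
            (AE t in lebesgue_on {0<..}. (\<lambda>k. nrm E (\<lambda>x. s k t x - u t x)) \<longlonglongrightarrow> (0::real))) \<and>
       esssup (lebesgue_on {0<..}) (\<lambda>t. ereal (nrm E (u t))) < \<infinity>},
     nrm = (\<lambda>u. real_of_ereal (esssup (lebesgue_on {0<..}) (\<lambda>t. ereal (nrm E (u t)))))\<rparr>"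

section \<open>The heat semigroup and the bilinear operator\<close>

definition heat_kernel :: "real \<Rightarrow> real ^ 'n::finite \<Rightarrow> real" where
  "heat_kernel t x = (4 * pi * t) powr (- (real CARD('n) / 2)) * exp (- (norm x)\<^sup>2 / (4 * t))"

definition heat :: "real \<Rightarrow> (real ^ 'n::finite \<Rightarrow> real) \<Rightarrow> real ^ 'n \<Rightarrow> real" where
  "heat t f = (\<lambda>x. \<integral>y. heat_kernel t (x - y) * f y \<partial>lebesgue)"

text \<open>
  \<open>w\<close> is the integral of \<open>U(t - s) F(s)\<close> over \<open>0 < s < t\<close>, in the weak sense given by the
  predual \<open>\<P>\<D>[X]\<close> with exponent \<open>n/(n-2)\<close> of \<open>\<M>[X']\<close> with exponent \<open>n/2\<close>.
\<close>

definition is_weak_heat_integral ::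
    "('n::finite) fspace \<Rightarrow> (real \<Rightarrow> real ^ 'n \<Rightarrow> real) \<Rightarrow> real \<Rightarrow> (real ^ 'n \<Rightarrow> real) \<Rightarrow> bool" where
  "is_weak_heat_integral X F t w \<longleftrightarrow>
     w \<in> elems (morrey (fdual X) (real CARD('n) / 2)) \<and>
     (\<forall>h\<in>elems (block_space X (real CARD('n) / (real CARD('n) - 2))).
        (\<forall>s\<in>{0<..<t}. integrable lebesgue (\<lambda>x. h x * heat (t - s) (F s) x)) \<and>
        set_integrable lebesgue {0<..<t} (\<lambda>s. pairing (heat (t - s) (F s)) h) \<and>
        pairing w h = (LINT s:{0<..<t}|lebesgue. pairing (heat (t - s) (F s)) h))"

definition B1_integrand :: "real ^ 'n ^ 'n \<Rightarrow> (real \<Rightarrow> real ^ 'n \<Rightarrow> real ^ 'n) \<Rightarrow>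
    (real \<Rightarrow> real ^ 'n \<Rightarrow> real ^ 'n) \<Rightarrow> real \<Rightarrow> real ^ 'n::finite \<Rightarrow> real" where
  "B1_integrand A u v = (\<lambda>s x. (A *v u s x) \<bullet> v s x)"

text \<open>The weak integral, when it exists, is determined up to a null set.\<close>

definition B1 :: "('n::finite) fspace \<Rightarrow> ('n \<Rightarrow> real ^ 'n ^ 'n) \<Rightarrow>
    (real \<Rightarrow> real ^ 'n \<Rightarrow> real ^ 'n) \<Rightarrow> (real \<Rightarrow> real ^ 'n \<Rightarrow> real ^ 'n) \<Rightarrow>
    real \<Rightarrow> real ^ 'n \<Rightarrow> real ^ 'n" where
  "B1 X A u v t = (\<lambda>x. \<chi> i. (SOME w. is_weak_heat_integral X (B1_integrand (A i) u v) t w) x)"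

section \<open>Conjugate exponents\<close>

definition conj_exp :: "ereal \<Rightarrow> ereal" where
  "conj_exp p = (if p = 1 then \<infinity> else if p = \<infinity> then 1 else p / (p - 1))"

end

theory Submission
  imports Defs "HOL-Real_Asymp.Real_Asymp"
begin

text \<open>
  Scaling of the product inequality on balls gives \<open>\<sigma>\<^bsub>X0'\<^esub> = 2 \<sigma>\<^bsub>X'\<^esub>\<close>, so \<open>l0'/l' = 1/2\<close>. The product
  \<open>g = \<langle>A u, v\<rangle>\<close> lies in \<open>\<M>[X0']\<close> with exponent \<open>n/4\<close>; hence \<open>U(\<tau>)g\<close> is bounded by \<open>C \<tau>\<^sup>-\<^sup>2\<close>
  in \<open>L\<^sup>\<infinity>\<close> and uniformly in \<open>\<tau>\<close> in \<open>\<M>[X0']\<close>, and by interpolation its restriction to a ball has a norm of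
  order \<open>\<tau>\<close> to the power \<open>-2(1 - \<theta>\<^sub>i)\<close> in \<open>X\<^sub>i'\<close>. These exponents lie on both sides of \<open>-1\<close>, and
  pairing with \<open>f \<in> X\<close> and integrating over \<open>\<tau>\<close> reproduces the \<open>K\<close>-method norm of \<open>f\<close> in
  \<open>(X1, X2)\<close> with parameters \<open>\<theta>, 1\<close>, with the power of the radius that defines \<open>\<M>[X']\<close> with
  exponent \<open>n/2\<close>. The weak integral is then the pointwise one, by Fubini.
\<close>

text \<open>The function dual is normed by signed pairings, whereas domination and Fubini need
  absolute integrals. All estimates therefore run through \<open>koethe_bound\<close>, a bound on
  the integral of |f g|; multiplying a test function by a sign, which (M2) allows, converts one into
  the other at the price of a constant. Since the data depend on time, the interpolation bound is
  applied to a different function at each \<tau>; what matters is only that their Morrey bounds are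
  uniform. Two further obstacles shape the end of the proof. \<open>Linf_time\<close> controls the
  data in norm, but Fubini needs U(t - s) F(s)(x) to be jointly measurable in (s, x); simple
  approximations in time give this, because the sup bound turns Morrey convergence into pointwise
  convergence. And \<open>B1\<close> is an arbitrary choice among the weak integrals: it inherits
  the estimate of the pointwise one since cut-off elements of X are multiples of blocks, so that all
  weak integrals have the same Morrey norm.\<close>

section \<open>Lebesgue measure under affine maps, and a test for a vanishing exponent\<close>

lemma sigma_finite_lebesgue: "sigma_finite_measure (lebesgue :: 'a::euclidean_space measure)"
proof
  have "\<exists>k::nat. x \<in> cball 0 (real k)" for x :: 'a
    by (simp add: real_arch_simple)
  moreover have "emeasure lborel (cball (0 :: 'a) (real k)) \<noteq> top" for k
    using emeasure_lborel_cball_finite[of "0 :: 'a" "real k"] by auto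
  ultimately show "\<exists>A. countable A \<and> A \<subseteq> sets lebesgue \<and> \<Union>A = space (lebesgue :: 'a measure) \<and>
      (\<forall>a\<in>A. emeasure lebesgue a \<noteq> \<infinity>)"
    by (intro exI[of _ "range (\<lambda>k::nat. cball 0 (real k))"])
       auto
qed

lemma
  fixes t :: "'a::euclidean_space"
  assumes "c \<noteq> 0"
  shows measurable_affine_lebesgue: "(\<lambda>x. t + c *\<^sub>R x) \<in> lebesgue \<rightarrow>\<^sub>M lebesgue"
    and lebesgue_affine: "lebesgue = density (distr lebesgue lebesgue (\<lambda>x. t + c *\<^sub>R x)) (\<lambda>_. \<bar>c\<bar> ^ DIM('a))"
proof -
  have "(\<lambda>x. t + (\<Sum>j\<in>Basis. (c * (x \<bullet> j)) *\<^sub>R j)) = (\<lambda>x. t + c *\<^sub>R x)"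
    unfolding scaleR_scaleR[symmetric] scaleR_sum_right[symmetric] by (simp add: euclidean_representation)
  with lebesgue_affine_measurable[of "\<lambda>_. c" t] lebesgue_affine_euclidean[of "\<lambda>_. c" t] assms
  show "(\<lambda>x. t + c *\<^sub>R x) \<in> lebesgue \<rightarrow>\<^sub>M lebesgue"
    "lebesgue = density (distr lebesgue lebesgue (\<lambda>x. t + c *\<^sub>R x)) (\<lambda>_. \<bar>c\<bar> ^ DIM('a))"
    by simp_all
qed

lemma nn_integral_affine_lebesgue:
  fixes f :: "'a::euclidean_space \<Rightarrow> ennreal"
  assumes [measurable]: "f \<in> borel_measurable lebesgue" and c: "c \<noteq> 0"
  shows "(\<integral>\<^sup>+x. f x \<partial>lebesgue) = ennreal (\<bar>c\<bar> ^ DIM('a)) * (\<integral>\<^sup>+x. f (t + c *\<^sub>R x) \<partial>lebesgue)"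
  by (subst lebesgue_affine[OF c, of t])
     (simp add: nn_integral_density nn_integral_distr nn_integral_cmult measurable_affine_lebesgue[OF c])

lemma measurable_dilate:
  assumes "f \<in> borel_measurable lebesgue" "r > 0"
  shows "dilate r f \<in> borel_measurable (lebesgue :: (real ^ 'n::finite) measure)"
  using measurable_compose[OF measurable_affine_lebesgue[of r 0] assms(1)] assms(2)
  by (simp add: dilate_def)

lemma nn_integral_dilate:
  fixes f :: "real ^ 'n::finite \<Rightarrow> ennreal"
  assumes f: "f \<in> borel_measurable lebesgue" and r: "r > 0"
  shows "(\<integral>\<^sup>+x. f (r *\<^sub>R x) \<partial>lebesgue) = ennreal (r powr - real CARD('n)) * (\<integral>\<^sup>+x. f x \<partial>lebesgue)"
proof -
  have "ennreal (r powr - real CARD('n)) * ennreal (r ^ CARD('n)) = 1"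
    using r by (simp add: ennreal_mult[symmetric] powr_realpow[symmetric] powr_add[symmetric])
  then show ?thesis
    using nn_integral_affine_lebesgue[OF f, of r 0] r by (simp add: mult.assoc[symmetric])
qed

text \<open>If a is nonzero, r powr a takes every positive value, in particular k / 2. The
  uniqueness of scaling exponents and the relation between those of X' and X0' both rest on
  this.\<close>

lemma powr_bounded_below_imp_eq_0:
  fixes k a :: real
  assumes "k > 0" and bd: "\<And>r. r > 0 \<Longrightarrow> k \<le> r powr a"
  shows "a = 0"
proof (rule ccontr)
  assume "a \<noteq> 0"
  then have "((k / 2) powr (1 / a)) powr a = k / 2"
    using \<open>k > 0\<close> by (simp add: powr_powr)
  with bd[of "(k / 2) powr (1 / a)"] \<open>k > 0\<close> show False by simp
qed

section \<open>Spaces of the class H\<close>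

lemma banach_fspaceD:
  assumes "banach_fspace X"
  shows "f \<in> elems X \<Longrightarrow> f \<in> borel_measurable lebesgue"
    and "f \<in> elems X \<Longrightarrow> g \<in> borel_measurable lebesgue \<Longrightarrow> AE x in lebesgue. f x = g x \<Longrightarrow> g \<in> elems X"
    and "(\<lambda>x. 0) \<in> elems X"
    and "f \<in> elems X \<Longrightarrow> g \<in> elems X \<Longrightarrow> (\<lambda>x. f x + g x) \<in> elems X"
    and "f \<in> elems X \<Longrightarrow> g \<in> elems X \<Longrightarrow> nrm X (\<lambda>x. f x + g x) \<le> nrm X f + nrm X g"
    and "f \<in> elems X \<Longrightarrow> (\<lambda>x. c * f x) \<in> elems X"
    and "f \<in> elems X \<Longrightarrow> nrm X (\<lambda>x. c * f x) = \<bar>c\<bar> * nrm X f"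
    and "f \<in> elems X \<Longrightarrow> nrm X f \<ge> 0"
    and "f \<in> elems X \<Longrightarrow> nrm X f = 0 \<longleftrightarrow> (AE x in lebesgue. f x = 0)"
  using assms unfolding banach_fspace_def by blast+

lemma banach_fspace_norm_zero:
  assumes "banach_fspace X" shows "nrm X (\<lambda>x. 0) = 0"
  using banach_fspaceD(9)[OF assms banach_fspaceD(3)[OF assms]] by simp

lemma class_H_banach: "class_H X \<Longrightarrow> banach_fspace X"
  by (simp add: class_H_def class_G_def)

lemmas class_H_measurable = banach_fspaceD(1)[OF class_H_banach]
  and class_H_norm_nonneg = banach_fspaceD(8)[OF class_H_banach]

text \<open>Since Lebesgue measure is not zero, a constant is its own essential supremum; on a null
  measure it would be -\<infinity>.\<close>

lemma esssup_abs_nonneg: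
  fixes g :: "real ^ 'n::finite \<Rightarrow> real"
  shows "0 \<le> esssup lebesgue (\<lambda>x. ereal \<bar>g x\<bar>)"
proof -
  have "esssup (lebesgue :: (real ^ 'n) measure) (\<lambda>x. 0 :: ereal) = 0"
    by (rule esssup_const) simp
  moreover have "esssup (lebesgue :: (real ^ 'n) measure) (\<lambda>x. 0 :: ereal)
      \<le> esssup lebesgue (\<lambda>x. ereal \<bar>g x\<bar>)"
    by (intro esssup_mono) auto
  ultimately show ?thesis by simp
qed

lemma Linf_bounded:
  fixes g :: "real ^ 'n::finite \<Rightarrow> real"
  assumes g: "g \<in> borel_measurable lebesgue" and bd: "\<And>x. \<bar>g x\<bar> \<le> c"
  shows "g \<in> elems Linf" "0 \<le> nrm Linf g" "nrm Linf g \<le> c"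
proof -
  let ?e = "esssup lebesgue (\<lambda>x. ereal \<bar>g x\<bar>)"
  have [measurable]: "(\<lambda>x. ereal \<bar>g x\<bar>) \<in> borel_measurable lebesgue" using g by measurable
  have le: "?e \<le> ereal c" by (intro esssup_I) (auto simp: bd)
  note ge = esssup_abs_nonneg[of g]
  obtain e where e: "?e = ereal e" using le ge by (cases ?e) auto
  show "g \<in> elems Linf" using le g by (auto simp: Linf_def e)
  show "0 \<le> nrm Linf g" "nrm Linf g \<le> c" using le ge by (auto simp: Linf_def e)
qed

text \<open>The constants in (M1), (M2) and (M3) come without a sign. Here and in the next two
  lemmas |C| + 1 replaces C, so that later constants can be multiplied and divided as positive
  numbers.\<close>

lemma class_H_mult_bounded:
  fixes X :: "('n::finite) fspace"
  assumes H: "class_H X"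
  obtains C where "C > 0"
    "\<And>f g. f \<in> elems X \<Longrightarrow> g \<in> borel_measurable lebesgue \<Longrightarrow> (\<And>x. \<bar>g x\<bar> \<le> 1) \<Longrightarrow>
       (\<lambda>x. f x * g x) \<in> elems X \<and> nrm X (\<lambda>x. f x * g x) \<le> C * nrm X f"
proof -
  obtain C where C: "\<And>f g. f \<in> elems X \<Longrightarrow> g \<in> elems Linf \<Longrightarrow>
     (\<lambda>x. f x * g x) \<in> elems X \<and> nrm X (\<lambda>x. f x * g x) \<le> C * nrm Linf g * nrm X f"
    using H unfolding class_H_def M2_def by blast
  have "(\<lambda>x. f x * g x) \<in> elems X \<and> nrm X (\<lambda>x. f x * g x) \<le> (\<bar>C\<bar> + 1) * nrm X f"
    if f: "f \<in> elems X" and g: "g \<in> borel_measurable lebesgue" "\<And>x. \<bar>g x\<bar> \<le> 1" for f g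
  proof -
    note L = Linf_bounded[OF g]
    have "C * nrm Linf g \<le> \<bar>C\<bar> * 1"
      using L by (intro order_trans[OF mult_right_mono[of C "\<bar>C\<bar>"]] mult_left_mono) auto
    then have "C * nrm Linf g * nrm X f \<le> (\<bar>C\<bar> + 1) * nrm X f"
      using class_H_norm_nonneg[OF H f] by (intro mult_right_mono) auto
    with C[OF f L(1)] show ?thesis by force
  qed
  then show thesis by (intro that[of "\<bar>C\<bar> + 1"]) auto
qed

lemma class_H_translate:
  fixes X :: "('n::finite) fspace"
  assumes H: "class_H X"
  obtains C where "C > 0"
    "\<And>f a. f \<in> elems X \<Longrightarrow> (\<lambda>x. f (x - a)) \<in> elems X \<and> nrm X (\<lambda>x. f (x - a)) \<le> C * nrm X f"
proof -
  obtain C where C: "\<And>f a. f \<in> elems X \<Longrightarrow> (\<lambda>x. f (x - a)) \<in> elems X \<and> nrm X (\<lambda>x. f (x - a)) \<le> C * nrm X f"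
    using H unfolding class_H_def M3_def by blast
  have "C * nrm X f \<le> (\<bar>C\<bar> + 1) * nrm X f" if "f \<in> elems X" for f
    using class_H_norm_nonneg[OF H that] by (intro mult_right_mono) auto
  with C have "(\<lambda>x. f (x - a)) \<in> elems X \<and> nrm X (\<lambda>x. f (x - a)) \<le> (\<bar>C\<bar> + 1) * nrm X f"
    if "f \<in> elems X" for f a using that order_trans by blast
  then show thesis by (intro that[of "\<bar>C\<bar> + 1"]) auto
qed

lemma class_H_L1_on_ball:
  fixes X :: "('n::finite) fspace"
  assumes H: "class_H X"
  obtains C where "C > 0"
    "\<And>f. f \<in> elems X \<Longrightarrow> (\<integral>\<^sup>+x. ennreal \<bar>f x\<bar> * indicator (ball 0 1) x \<partial>lebesgue) \<le> ennreal (C * nrm X f)"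
proof -
  have sub: "elems X \<subseteq> L1loc" and "\<exists>C. \<forall>f\<in>elems X. (LINT x:cball 0 1|lebesgue. \<bar>f x\<bar>) \<le> C * nrm X f"
    using H unfolding class_H_def M1_def by auto
  then obtain C where C: "\<And>f. f \<in> elems X \<Longrightarrow> (LINT x:cball 0 1|lebesgue. \<bar>f x\<bar>) \<le> C * nrm X f"
    by blast
  have "(\<integral>\<^sup>+x. ennreal \<bar>f x\<bar> * indicator (ball 0 1) x \<partial>lebesgue) \<le> ennreal ((\<bar>C\<bar> + 1) * nrm X f)"
    if f: "f \<in> elems X" for f
  proof -
    have "set_integrable lebesgue (cball 0 1) f" using sub f by (auto simp: L1loc_def)
    then have int: "set_integrable lebesgue (cball 0 1) (\<lambda>x. \<bar>f x\<bar>)"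
      by (rule set_integrable_abs)
    have "(\<integral>\<^sup>+x. ennreal \<bar>f x\<bar> * indicator (ball 0 1) x \<partial>lebesgue)
        \<le> (\<integral>\<^sup>+x. ennreal (indicator (cball 0 1) x *\<^sub>R \<bar>f x\<bar>) \<partial>lebesgue)"
      by (intro nn_integral_mono) (auto simp: indicator_def)
    also have "\<dots> = ennreal (LINT x:cball 0 1|lebesgue. \<bar>f x\<bar>)"
      unfolding set_lebesgue_integral_def
      using int by (intro nn_integral_eq_integral) (auto simp: set_integrable_def)
    also have "\<dots> \<le> ennreal ((\<bar>C\<bar> + 1) * nrm X f)"
      using class_H_norm_nonneg[OF H f]
      by (intro ennreal_leI order_trans[OF C[OF f]] mult_right_mono) auto
    finally show ?thesis .
  qed
  then show thesis by (intro that[of "\<bar>C\<bar> + 1"]) auto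
qed

section \<open>Scaling exponents and norms of balls\<close>

text \<open>Apply the exponent t to \<open>dil (1 / r)\<close> and s to \<open>dil r\<close>:
  returning to z costs at most the factor C D r^(s - t). As r is arbitrary, s - t must vanish. The
  dilation is a parameter because the argument serves functions as well as functionals.\<close>

lemma has_scaling_unique:
  assumes s: "has_scaling dil F s" and t: "has_scaling dil F t"
    and z: "z \<in> elems F" "nrm F z > 0" and inv: "\<And>r. r > 0 \<Longrightarrow> dil r (dil (1 / r) z) = z"
  shows "s = t"
proof -
  obtain C where C: "C > 0" "\<And>r f. r > 0 \<Longrightarrow> f \<in> elems F \<Longrightarrow>
      dil r f \<in> elems F \<and> nrm F (dil r f) \<le> C * r powr s * nrm F f"
    using s unfolding has_scaling_def by blast
  obtain D where D: "D > 0" "\<And>r f. r > 0 \<Longrightarrow> f \<in> elems F \<Longrightarrow>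
      dil r f \<in> elems F \<and> nrm F (dil r f) \<le> D * r powr t * nrm F f"
    using t unfolding has_scaling_def by blast
  have "1 / (C * D) \<le> r powr (s - t)" if r: "r > 0" for r
  proof -
    have "nrm F z \<le> C * r powr s * nrm F (dil (1 / r) z)"
      using C(2)[OF r, of "dil (1 / r) z"] D(2)[of "1 / r" z] z(1) r inv[OF r] by simp
    also have "\<dots> \<le> C * r powr s * (D * (1 / r) powr t * nrm F z)"
      using D(2)[of "1 / r" z] z(1) r C(1) by (intro mult_left_mono) auto
    finally have "nrm F z * 1 \<le> nrm F z * (C * D * r powr (s - t))"
      using r by (simp add: powr_divide powr_diff field_simps)
    then have "1 \<le> C * D * r powr (s - t)" using z(2) by (subst (asm) mult_le_cancel_left_pos) auto
    then show ?thesis using C(1) D(1) by (simp add: field_simps)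
  qed
  then have "s - t = 0"
    using C(1) D(1) by (intro powr_bounded_below_imp_eq_0[of "1 / (C * D)"]) auto
  then show ?thesis by simp
qed

lemma dilate_dilate [simp]: "r > 0 \<Longrightarrow> dilate r (dilate (1 / r) f) = f"
  by (simp add: dilate_def)

lemma ball_not_AE_zero: "r > 0 \<Longrightarrow> \<not> (AE x in lebesgue. indicator (ball (a :: 'a::euclidean_space) r) x = (0::real))"
proof
  assume r: "r > 0" and "AE x in lebesgue. indicator (ball a r) x = (0::real)"
  then have "AE x in lebesgue. x \<notin> ball a r" by (auto simp: indicator_def)
  then have "negligible (ball a r)" by (simp add: AE_iff_null_sets negligible_iff_null_sets)
  then show False using r open_not_negligible[of "ball a r"] by simp
qed

text \<open>By (M5) the unit ball supplies the element of nonzero norm that makes the exponent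
  unique, hence \<open>sigma\<close> meaningful.\<close>

lemma class_H_ball_norm_pos:
  assumes H: "class_H X" shows "indicator (ball 0 1) \<in> elems X" "nrm X (indicator (ball 0 1)) > 0"
proof -
  show i: "indicator (ball 0 1) \<in> elems X" using H by (simp add: class_H_def M5_def)
  have "nrm X (indicator (ball 0 1)) \<noteq> 0"
    using banach_fspaceD(9)[OF class_H_banach[OF H] i] ball_not_AE_zero[of 1 0] by auto
  then show "nrm X (indicator (ball 0 1)) > 0"
    using class_H_norm_nonneg[OF H i] by simp
qed

lemma sigma_eqI:
  assumes "class_H X" "has_scaling dilate X s" shows "sigma X = s"
  unfolding sigma_def
proof (rule the_equality)
  fix t assume "has_scaling dilate X t"
  then show "t = s"
    by (rule has_scaling_unique[OF _ assms(2) class_H_ball_norm_pos[OF assms(1)]]) simp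
qed (fact assms(2))

lemma class_H_has_scaling:
  assumes "class_H X" shows "has_scaling dilate X (sigma X)"
proof -
  obtain s where "has_scaling dilate X s" using assms unfolding class_H_def class_G_def by blast
  with sigma_eqI[OF assms this] show ?thesis by simp
qed

lemma class_H_dilate:
  assumes "class_H X"
  obtains C where "C > 0" "\<And>r f. r > 0 \<Longrightarrow> f \<in> elems X \<Longrightarrow>
    dilate r f \<in> elems X \<and> nrm X (dilate r f) \<le> C * r powr sigma X * nrm X f"
  using class_H_has_scaling[OF assms] unfolding has_scaling_def by blast

lemma dilate_indicator_ball:
  "r > 0 \<Longrightarrow> dilate (1 / r) (indicator (ball (0 :: real ^ 'n::finite) s)) = indicator (ball 0 (r * s))"
  by (auto simp: dilate_def indicator_def fun_eq_iff field_simps)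

text \<open>The ball is the unit ball dilated by 1 / r and then translated: the exponent changes
  sign, and (M3) makes the constant independent of the centre.\<close>

lemma class_H_ball_norm:
  fixes X :: "('n::finite) fspace"
  assumes H: "class_H X"
  obtains C where "C > 0"
    "\<And>a r. r > 0 \<Longrightarrow> indicator (ball a r) \<in> elems X \<and> nrm X (indicator (ball a r)) \<le> C * r powr - sigma X"
proof -
  obtain C where C: "C > 0" "\<And>r f. r > 0 \<Longrightarrow> f \<in> elems X \<Longrightarrow>
    dilate r f \<in> elems X \<and> nrm X (dilate r f) \<le> C * r powr sigma X * nrm X f"
    using class_H_dilate[OF H] by blast
  obtain D where D: "D > 0"
    "\<And>f a. f \<in> elems X \<Longrightarrow> (\<lambda>x. f (x - a)) \<in> elems X \<and> nrm X (\<lambda>x. f (x - a)) \<le> D * nrm X f"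
    using class_H_translate[OF H] by blast
  let ?i = "indicator (ball 0 1) :: real ^ 'n \<Rightarrow> real"
  show thesis
  proof (rule that)
    show "D * (C * nrm X ?i) > 0" using C D class_H_ball_norm_pos[OF H] by simp
    fix a :: "real ^ 'n" and r :: real assume r: "r > 0"
    have 1: "indicator (ball 0 r) \<in> elems X \<and>
       nrm X (indicator (ball 0 r)) \<le> C * (1 / r) powr sigma X * nrm X ?i"
      using C(2)[of "1 / r" ?i] class_H_ball_norm_pos[OF H] r dilate_indicator_ball[of r 1, where 'n='n]
      by simp
    have sh: "(\<lambda>x. indicator (ball 0 r) (x - a)) = (indicator (ball a r) :: real ^ 'n \<Rightarrow> real)"
      by (auto simp: indicator_def fun_eq_iff dist_norm norm_minus_commute)
    have 2: "indicator (ball a r) \<in> elems X \<and> nrm X (indicator (ball a r)) \<le> D * nrm X (indicator (ball 0 r))"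
      using D(2)[of "indicator (ball 0 r)" a] 1 unfolding sh by simp
    have "D * nrm X (indicator (ball 0 r)) \<le> D * (C * (1 / r) powr sigma X * nrm X ?i)"
      using 1 D(1) by (intro mult_left_mono) auto
    also have "\<dots> = D * (C * nrm X ?i) * r powr - sigma X"
      using r by (simp add: powr_divide powr_minus field_simps)
    finally show "indicator (ball a r) \<in> elems X \<and>
        nrm X (indicator (ball a r)) \<le> D * (C * nrm X ?i) * r powr - sigma X"
      using 2 by linarith
  qed
qed

section \<open>Function duals\<close>

abbreviation abs_pairing :: "(real ^ 'n::finite \<Rightarrow> real) \<Rightarrow> (real ^ 'n \<Rightarrow> real) \<Rightarrow> ennreal" where
  "abs_pairing f g \<equiv> \<integral>\<^sup>+x. ennreal \<bar>f x * g x\<bar> \<partial>lebesgue"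

abbreviation ball_pairing :: "real ^ 'n::finite \<Rightarrow> real \<Rightarrow> (real ^ 'n \<Rightarrow> real) \<Rightarrow> (real ^ 'n \<Rightarrow> ennreal) \<Rightarrow> ennreal" where
  "ball_pairing a r f G \<equiv> \<integral>\<^sup>+x. ennreal \<bar>f x\<bar> * indicator (ball a r) x * G x \<partial>lebesgue"

text \<open>The norm of the Koethe (associate) dual, as an upper bound c instead of a value. The
  integral of |f g| lives in \<open>ennreal\<close>, so no integrability has to be known in advance;
  the condition is stable under pointwise domination and open to Tonelli.\<close>

definition koethe_bound :: "('n::finite) fspace \<Rightarrow> (real ^ 'n \<Rightarrow> real) \<Rightarrow> real \<Rightarrow> bool" where
  "koethe_bound X g c \<longleftrightarrow> g \<in> borel_measurable lebesgue \<and> 0 \<le> c \<and>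
     (\<forall>f\<in>elems X. abs_pairing f g \<le> ennreal (c * nrm X f))"

lemma koethe_boundD:
  assumes "koethe_bound X g c"
  shows "g \<in> borel_measurable lebesgue" "0 \<le> c"
    "f \<in> elems X \<Longrightarrow> abs_pairing f g \<le> ennreal (c * nrm X f)"
  using assms by (auto simp: koethe_bound_def)

lemma koethe_bound_mono:
  assumes X: "banach_fspace X" and h: "koethe_bound X h d" and g: "g \<in> borel_measurable lebesgue"
    and le: "AE x in lebesgue. \<bar>g x\<bar> \<le> \<bar>h x\<bar>" and "d \<le> c"
  shows "koethe_bound X g c"
  unfolding koethe_bound_def
proof (intro conjI ballI)
  show "0 \<le> c" using koethe_boundD(2)[OF h] \<open>d \<le> c\<close> by simp
  fix f assume f: "f \<in> elems X"
  have "abs_pairing f g \<le> abs_pairing f h"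
    using le by (intro nn_integral_mono_AE) (auto simp: abs_mult intro!: ennreal_leI mult_left_mono)
  also have "\<dots> \<le> ennreal (d * nrm X f)" using koethe_boundD(3)[OF h f] .
  also have "\<dots> \<le> ennreal (c * nrm X f)"
    using \<open>d \<le> c\<close> banach_fspaceD(8)[OF X f] by (intro ennreal_leI mult_right_mono)
  finally show "abs_pairing f g \<le> ennreal (c * nrm X f)" .
qed (fact g)

lemma koethe_bound_zero: "banach_fspace X \<Longrightarrow> koethe_bound X (\<lambda>x. 0) 0"
  by (auto simp: koethe_bound_def)

lemma koethe_bound_add:
  assumes X: "banach_fspace X" and g: "koethe_bound X g c" and h: "koethe_bound X h d"
  shows "koethe_bound X (\<lambda>x. g x + h x) (c + d)"
  unfolding koethe_bound_def
proof (intro conjI ballI)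
  note [measurable] = koethe_boundD(1)[OF g] koethe_boundD(1)[OF h]
  show "(\<lambda>x. g x + h x) \<in> borel_measurable lebesgue" by measurable
  show "0 \<le> c + d" using koethe_boundD(2)[OF h] koethe_boundD(2)[OF g] by simp
  fix f assume f: "f \<in> elems X"
  note [measurable] = banach_fspaceD(1)[OF X f]
  have "(\<integral>\<^sup>+x. ennreal \<bar>f x * (g x + h x)\<bar> \<partial>lebesgue)
      \<le> (\<integral>\<^sup>+x. ennreal \<bar>f x * g x\<bar> + ennreal \<bar>f x * h x\<bar> \<partial>lebesgue)"
    by (intro nn_integral_mono) (auto simp: ennreal_plus[symmetric] algebra_simps simp del: ennreal_plus intro!: ennreal_leI)
  also have "\<dots> \<le> ennreal (c * nrm X f) + ennreal (d * nrm X f)"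
    using koethe_boundD(3)[OF g f] koethe_boundD(3)[OF h f] by (subst nn_integral_add) (auto intro: add_mono)
  also have "\<dots> = ennreal ((c + d) * nrm X f)"
    using banach_fspaceD(8)[OF X f] koethe_boundD(2)[OF h] koethe_boundD(2)[OF g]
    by (simp add: ennreal_plus[symmetric] algebra_simps del: ennreal_plus)
  finally show "(\<integral>\<^sup>+x. ennreal \<bar>f x * (g x + h x)\<bar> \<partial>lebesgue) \<le> ennreal ((c + d) * nrm X f)" .
qed

lemma koethe_bound_cmult:
  assumes X: "banach_fspace X" and g: "koethe_bound X g c"
  shows "koethe_bound X (\<lambda>x. a * g x) (\<bar>a\<bar> * c)"
  unfolding koethe_bound_def
proof (intro conjI ballI)
  note [measurable] = koethe_boundD(1)[OF g]
  show "(\<lambda>x. a * g x) \<in> borel_measurable lebesgue" by measurable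
  show "0 \<le> \<bar>a\<bar> * c" using koethe_boundD(2)[OF g] by simp
  fix f assume f: "f \<in> elems X"
  note [measurable] = banach_fspaceD(1)[OF X f]
  have "(\<integral>\<^sup>+x. ennreal \<bar>f x * (a * g x)\<bar> \<partial>lebesgue) = (\<integral>\<^sup>+x. ennreal \<bar>a\<bar> * ennreal \<bar>f x * g x\<bar> \<partial>lebesgue)"
    by (simp add: abs_mult ennreal_mult[symmetric] mult_ac)
  also have "\<dots> = ennreal \<bar>a\<bar> * abs_pairing f g"
    by (rule nn_integral_cmult) measurable
  also have "\<dots> \<le> ennreal \<bar>a\<bar> * ennreal (c * nrm X f)"
    by (intro mult_left_mono koethe_boundD(3)[OF g f]) auto
  also have "\<dots> = ennreal (\<bar>a\<bar> * c * nrm X f)"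
    using banach_fspaceD(8)[OF X f] koethe_boundD(2)[OF g] by (simp add: ennreal_mult[symmetric] mult.assoc)
  finally show "(\<integral>\<^sup>+x. ennreal \<bar>f x * (a * g x)\<bar> \<partial>lebesgue) \<le> ennreal (\<bar>a\<bar> * c * nrm X f)" .
qed

section \<open>Norms of functionals and of pairings\<close>

text \<open>Boundedness of T makes the \<open>Sup\<close> a genuine supremum. Elements of norm 0
  cannot be normalised, but T vanishes on them.\<close>

lemma dual_bound:
  assumes X: "banach_fspace X" and T: "T \<in> elems (dual X)" and f: "f \<in> elems X"
  shows "\<bar>T f\<bar> \<le> nrm (dual X) T * nrm X f"
proof -
  obtain C where C: "\<And>f. f \<in> elems X \<Longrightarrow> \<bar>T f\<bar> \<le> C * nrm X f" and
    lin: "\<And>f g a b. f \<in> elems X \<Longrightarrow> g \<in> elems X \<Longrightarrow> T (\<lambda>x. a * f x + b * g x) = a * T f + b * T g"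
    using T unfolding dual_def by fastforce
  show ?thesis
  proof (cases "nrm X f = 0")
    case True then show ?thesis using C[OF f] by simp
  next
    case False
    then have pos: "nrm X f > 0" using banach_fspaceD(8)[OF X f] by simp
    define g where "g = (\<lambda>x. (1 / nrm X f) * f x)"
    have g: "g \<in> elems X" "nrm X g = 1"
      using banach_fspaceD(6,7)[OF X f, of "1 / nrm X f"] pos by (auto simp: g_def)
    have "bdd_above {\<bar>T f\<bar> | f. f \<in> elems X \<and> nrm X f \<le> 1}"
    proof (rule bdd_aboveI)
      fix y assume "y \<in> {\<bar>T f\<bar> | f. f \<in> elems X \<and> nrm X f \<le> 1}"
      then obtain h where h: "h \<in> elems X" "nrm X h \<le> 1" "y = \<bar>T h\<bar>" by auto
      have "y \<le> C * nrm X h" using C h by simp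
      also have "\<dots> \<le> \<bar>C\<bar> * 1" using h banach_fspaceD(8)[OF X h(1)] by (intro mult_mono) auto
      finally show "y \<le> \<bar>C\<bar>" by simp
    qed
    then have "\<bar>T g\<bar> \<le> nrm (dual X) T"
      unfolding dual_def using g by (auto intro!: cSup_upper)
    moreover have "T g = T f / nrm X f"
      using lin[OF f f, of "1 / nrm X f" 0] by (simp add: g_def)
    ultimately show ?thesis using pos by (simp add: field_simps abs_divide)
  qed
qed

lemma dual_norm_le:
  assumes X: "banach_fspace X" and c: "0 \<le> c" and T: "\<And>f. f \<in> elems X \<Longrightarrow> \<bar>T f\<bar> \<le> c * nrm X f"
  shows "nrm (dual X) T \<le> c"
proof -
  have "Sup {\<bar>T f\<bar> | f. f \<in> elems X \<and> nrm X f \<le> 1} \<le> c"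
  proof (rule cSup_least)
    show "{\<bar>T f\<bar> | f. f \<in> elems X \<and> nrm X f \<le> 1} \<noteq> {}"
      using banach_fspaceD(3)[OF X] banach_fspace_norm_zero[OF X] by fastforce
    fix y assume "y \<in> {\<bar>T f\<bar> | f. f \<in> elems X \<and> nrm X f \<le> 1}"
    then obtain h where h: "h \<in> elems X" "nrm X h \<le> 1" "y = \<bar>T h\<bar>" by auto
    have "y \<le> c * nrm X h" using T h by simp
    also have "\<dots> \<le> c * 1" using h c by (intro mult_left_mono) auto
    finally show "y \<le> c" by simp
  qed
  then show ?thesis by (simp add: dual_def)
qed

text \<open>A single f of positive norm decides the sign. If there is none, every T f is 0 and the
  set below the \<open>Sup\<close> is {0}.\<close>

lemma dual_norm_nonneg:
  assumes X: "banach_fspace X" and T: "T \<in> elems (dual X)"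
  shows "0 \<le> nrm (dual X) T"
proof (cases "\<exists>f\<in>elems X. nrm X f > 0")
  case True
  then obtain f where f: "f \<in> elems X" "nrm X f > 0" by blast
  have "0 \<le> nrm (dual X) T * nrm X f"
    using dual_bound[OF X T f(1)] by linarith
  then show ?thesis using f(2) by (simp add: zero_le_mult_iff)
next
  case False
  obtain C where C: "\<And>f. f \<in> elems X \<Longrightarrow> \<bar>T f\<bar> \<le> C * nrm X f"
    using T unfolding dual_def by fastforce
  have z: "T f = 0" "nrm X f \<le> 1" if "f \<in> elems X" for f
  proof -
    have "nrm X f = 0" using False that banach_fspaceD(8)[OF X that] by force
    then show "T f = 0" "nrm X f \<le> 1" using C[OF that] by auto
  qed
  have "{\<bar>T f\<bar> | f. f \<in> elems X \<and> nrm X f \<le> 1} = {0}"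
    using z banach_fspaceD(3)[OF X] by (auto intro!: exI[of _ "\<lambda>x. 0"])
  then show ?thesis by (simp add: dual_def)
qed

lemma fdual_norm: "nrm (fdual X) g = nrm (dual X) (pairing g)"
  by (simp add: fdual_def)

lemma koethe_bound_integrable:
  assumes X: "banach_fspace X" and g: "koethe_bound X g c" and f: "f \<in> elems X"
  shows "integrable lebesgue (\<lambda>x. f x * g x)" "\<bar>pairing g f\<bar> \<le> c * nrm X f"
proof -
  have [measurable]: "(\<lambda>x. f x * g x) \<in> borel_measurable lebesgue"
    using koethe_boundD(1)[OF g] banach_fspaceD(1)[OF X f] by measurable
  have le: "(\<integral>\<^sup>+x. ennreal (norm (f x * g x)) \<partial>lebesgue) \<le> ennreal (c * nrm X f)"
    using koethe_boundD(3)[OF g f] by simp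
  then show int: "integrable lebesgue (\<lambda>x. f x * g x)"
    unfolding integrable_iff_bounded using le_less_trans[OF le ennreal_less_top] by auto
  have "ennreal \<bar>pairing g f\<bar> \<le> (\<integral>\<^sup>+x. ennreal (norm (f x * g x)) \<partial>lebesgue)"
    unfolding pairing_def using integral_norm_bound_ennreal[OF int] by simp
  with le have "ennreal \<bar>pairing g f\<bar> \<le> ennreal (c * nrm X f)" by (rule order_trans[rotated])
  then show "\<bar>pairing g f\<bar> \<le> c * nrm X f"
    using koethe_boundD(2)[OF g] banach_fspaceD(8)[OF X f] by simp
qed

lemma koethe_bound_fdual:
  assumes X: "banach_fspace X" and g: "koethe_bound X g c"
  shows "g \<in> elems (fdual X)" "nrm (fdual X) g \<le> c"
proof -
  note int = koethe_bound_integrable[OF X g]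
  have "pairing g (\<lambda>x. a * f x + b * h x) = a * pairing g f + b * pairing g h"
    if "f \<in> elems X" "h \<in> elems X" for f h a b
    using int(1)[OF that(1)] int(1)[OF that(2)] by (simp add: pairing_def algebra_simps)
  then have "pairing g \<in> elems (dual X)"
    using int(2) unfolding dual_def by (auto intro!: exI[of _ c])
  then show "g \<in> elems (fdual X)"
    using int(1) koethe_boundD(1)[OF g] by (simp add: fdual_def)
  show "nrm (fdual X) g \<le> c"
    unfolding fdual_norm by (intro dual_norm_le[OF X koethe_boundD(2)[OF g]] int(2))
qed

lemma fdual_norm_nonneg: "banach_fspace X \<Longrightarrow> g \<in> elems (fdual X) \<Longrightarrow> 0 \<le> nrm (fdual X) g"
  unfolding fdual_norm by (rule dual_norm_nonneg) (auto simp: fdual_def)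

text \<open>Test g against f sgn(f g) instead of f: the pairing becomes the integral of |f g|, and
  (M2) bounds the norm of the modified function by C ||f||, the sign being bounded by 1.\<close>

lemma fdual_koethe_bound:
  assumes H: "class_H X"
  obtains C where "C > 0" "\<And>g. g \<in> elems (fdual X) \<Longrightarrow> koethe_bound X g (C * nrm (fdual X) g)"
proof -
  note X = class_H_banach[OF H]
  obtain C where C: "C > 0"
    "\<And>f g. f \<in> elems X \<Longrightarrow> g \<in> borel_measurable lebesgue \<Longrightarrow> (\<And>x. \<bar>g x\<bar> \<le> 1) \<Longrightarrow>
       (\<lambda>x. f x * g x) \<in> elems X \<and> nrm X (\<lambda>x. f x * g x) \<le> C * nrm X f"
    using class_H_mult_bounded[OF H] by blast
  have "koethe_bound X g (C * nrm (fdual X) g)" if g: "g \<in> elems (fdual X)" for g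
    unfolding koethe_bound_def
  proof (intro conjI ballI)
    show [measurable]: "g \<in> borel_measurable lebesgue" using g by (simp add: fdual_def)
    have dual: "pairing g \<in> elems (dual X)" using g by (simp add: fdual_def)
    have nn: "0 \<le> nrm (fdual X) g" using fdual_norm_nonneg[OF X g] .
    show "0 \<le> C * nrm (fdual X) g" using nn C(1) by simp
    fix f assume f: "f \<in> elems X"
    note [measurable] = banach_fspaceD(1)[OF X f]
    define h where "h = (\<lambda>x. f x * sgn (f x * g x))"
    have h: "h \<in> elems X" "nrm X h \<le> C * nrm X f"
      using C(2)[OF f, of "\<lambda>x. sgn (f x * g x)"] by (auto simp: h_def abs_sgn_eq)
    have hg: "h x * g x = \<bar>f x * g x\<bar>" for x
      using sgn_mult_abs[of "f x * g x"] by (simp add: h_def abs_sgn mult_ac)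
    have int: "integrable lebesgue (\<lambda>x. \<bar>f x * g x\<bar>)"
      using g h(1) unfolding fdual_def hg[symmetric] by auto
    have "abs_pairing f g = ennreal (pairing g h)"
      unfolding pairing_def hg using int by (intro nn_integral_eq_integral) auto
    also have "\<dots> \<le> ennreal (nrm (fdual X) g * nrm X h)"
      using dual_bound[OF X dual h(1)] unfolding fdual_norm by (intro ennreal_leI) auto
    also have "\<dots> \<le> ennreal (nrm (fdual X) g * (C * nrm X f))"
      using h nn by (intro ennreal_leI mult_left_mono)
    finally show "abs_pairing f g \<le> ennreal (C * nrm (fdual X) g * nrm X f)"
      by (simp add: mult_ac)
  qed
  with C(1) that show thesis by blast
qed

text \<open>(M1) on the unit ball says that its indicator defines an element of the dual.\<close>

lemma koethe_bound_ball:
  assumes H: "class_H X"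
  obtains C where "koethe_bound X (indicator (ball 0 1)) C"
proof -
  obtain C where C: "C > 0" "\<And>f. f \<in> elems X \<Longrightarrow>
      (\<integral>\<^sup>+x. ennreal \<bar>f x\<bar> * indicator (ball 0 1) x \<partial>lebesgue) \<le> ennreal (C * nrm X f)"
    using class_H_L1_on_ball[OF H] by blast
  have "ennreal \<bar>f x * indicator (ball 0 1) x\<bar> = ennreal \<bar>f x\<bar> * indicator (ball 0 1) x"
    for f :: "real ^ 'a \<Rightarrow> real" and x by (auto simp: indicator_def)
  moreover have "(indicator (ball 0 1) :: real ^ 'a \<Rightarrow> real) \<in> borel_measurable lebesgue"
    by (intro borel_measurable_indicator) auto
  ultimately show thesis using C by (intro that[of C]) (auto simp: koethe_bound_def)
qed

section \<open>Scaling exponents of duals\<close>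

text \<open>Substitution moves the dilation from g to f: the measure contributes r^-n, and
  \<open>dilate (1 / r) f\<close> contributes r^-\<sigma>.\<close>

lemma koethe_bound_dilate:
  fixes X :: "('n::finite) fspace"
  assumes H: "class_H X"
  obtains C where "C > 0" "\<And>g c r. koethe_bound X g c \<Longrightarrow> r > 0 \<Longrightarrow>
    koethe_bound X (dilate r g) (C * r powr (- real CARD('n) - sigma X) * c)"
proof -
  obtain C where C: "C > 0" "\<And>r f. r > 0 \<Longrightarrow> f \<in> elems X \<Longrightarrow>
    dilate r f \<in> elems X \<and> nrm X (dilate r f) \<le> C * r powr sigma X * nrm X f"
    using class_H_dilate[OF H] by blast
  have "koethe_bound X (dilate r g) (C * r powr (- real CARD('n) - sigma X) * c)"
    if g: "koethe_bound X g c" and r: "r > 0" for g c r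
    unfolding koethe_bound_def
  proof (intro conjI ballI)
    note [measurable] = koethe_boundD(1)[OF g]
    show "dilate r g \<in> borel_measurable lebesgue" using r by (intro measurable_dilate) auto
    show "0 \<le> C * r powr (- real CARD('n) - sigma X) * c" using C(1) koethe_boundD(2)[OF g] by simp
    fix f assume f: "f \<in> elems X"
    define h where "h = dilate (1 / r) f"
    have h: "h \<in> elems X" "nrm X h \<le> C * (1 / r) powr sigma X * nrm X f"
      using C(2)[OF _ f, of "1 / r"] r by (auto simp: h_def)
    note [measurable] = class_H_measurable[OF H h(1)]
    have "abs_pairing f (dilate r g)
        = (\<integral>\<^sup>+x. ennreal \<bar>h (r *\<^sub>R x) * g (r *\<^sub>R x)\<bar> \<partial>lebesgue)"
      using r by (simp add: h_def dilate_def)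
    also have "\<dots> = ennreal (r powr - real CARD('n)) * abs_pairing h g"
      by (rule nn_integral_dilate[OF _ r]) measurable
    also have "\<dots> \<le> ennreal (r powr - real CARD('n)) * ennreal (c * (C * (1 / r) powr sigma X * nrm X f))"
      using h koethe_boundD[OF g]
      by (intro mult_left_mono order_trans[OF koethe_boundD(3)[OF g h(1)]] ennreal_leI) auto
    also have "\<dots> = ennreal (C * r powr (- real CARD('n) - sigma X) * c * nrm X f)"
      using r koethe_boundD(2)[OF g] C(1) class_H_norm_nonneg[OF H f]
      by (subst ennreal_mult[symmetric]) (auto simp: powr_diff powr_divide field_simps)
    finally show "abs_pairing f (dilate r g)
        \<le> ennreal (C * r powr (- real CARD('n) - sigma X) * c * nrm X f)" .
  qed
  with C(1) that show thesis by blast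
qed

lemma fdual_has_scaling:
  fixes X :: "('n::finite) fspace"
  assumes H: "class_H X"
  shows "has_scaling dilate (fdual X) (- real CARD('n) - sigma X)"
proof -
  obtain C where C: "C > 0" "\<And>g c r. koethe_bound X g c \<Longrightarrow> r > 0 \<Longrightarrow>
    koethe_bound X (dilate r g) (C * r powr (- real CARD('n) - sigma X) * c)"
    using koethe_bound_dilate[OF H] by blast
  obtain D where D: "D > 0" "\<And>g. g \<in> elems (fdual X) \<Longrightarrow> koethe_bound X g (D * nrm (fdual X) g)"
    using fdual_koethe_bound[OF H] by blast
  have "dilate r g \<in> elems (fdual X) \<and>
      nrm (fdual X) (dilate r g) \<le> (C * D) * r powr (- real CARD('n) - sigma X) * nrm (fdual X) g"
    if "r > 0" "g \<in> elems (fdual X)" for r g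
    using koethe_bound_fdual[OF class_H_banach[OF H] C(2)[OF D(2)[OF that(2)] that(1)]]
    by (simp add: mult_ac)
  with C(1) D(1) show ?thesis unfolding has_scaling_def by (intro exI[of _ "C * D"]) auto
qed

lemma sigma_fdual:
  fixes X :: "('n::finite) fspace"
  assumes "class_H X" "class_H (fdual X)"
  shows "sigma (fdual X) = - real CARD('n) - sigma X"
  using sigma_eqI[OF assms(2) fdual_has_scaling[OF assms(1)]] .

text \<open>The exponent of the full dual, whose elements need not be functions; the \<theta>i are
  defined through it. Dilations of functionals are adjoint to those of functions, so the argument
  for \<open>fdual X\<close> carries over. The pairing with the indicator of the unit ball is the
  nonzero functional that uniqueness asks for.\<close>

lemma sigma_dual_eq:
  fixes X :: "('n::finite) fspace"
  assumes H: "class_H X"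
  shows "sigma_dual X = - real CARD('n) - sigma X"
proof -
  note X = class_H_banach[OF H]
  obtain C where C: "C > 0" "\<And>r f. r > 0 \<Longrightarrow> f \<in> elems X \<Longrightarrow>
    dilate r f \<in> elems X \<and> nrm X (dilate r f) \<le> C * r powr sigma X * nrm X f"
    using class_H_dilate[OF H] by blast
  have sc: "has_scaling dilate_functional (dual X) (- real CARD('n) - sigma X)"
    unfolding has_scaling_def
  proof (intro exI[of _ C] conjI allI impI ballI)
    fix r :: real and T assume r: "r > 0" and T: "T \<in> elems (dual X)"
    have bd: "\<bar>dilate_functional r T f\<bar> \<le> (C * r powr (- real CARD('n) - sigma X) * nrm (dual X) T) * nrm X f"
      if f: "f \<in> elems X" for f
    proof -
      have d: "dilate (1 / r) f \<in> elems X" "nrm X (dilate (1 / r) f) \<le> C * (1 / r) powr sigma X * nrm X f"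
        using C(2)[OF _ f, of "1 / r"] r by auto
      have "\<bar>T (dilate (1 / r) f)\<bar> \<le> nrm (dual X) T * (C * (1 / r) powr sigma X * nrm X f)"
        using dual_norm_nonneg[OF X T] d by (intro order_trans[OF dual_bound[OF X T d(1)]] mult_left_mono)
      then have "\<bar>T (dilate (1 / r) f)\<bar> / r ^ CARD('n)
          \<le> nrm (dual X) T * (C * (1 / r) powr sigma X * nrm X f) / r ^ CARD('n)"
        using r by (intro divide_right_mono) auto
      then show ?thesis
        using r by (simp add: dilate_functional_def abs_divide powr_diff powr_minus powr_divide
            powr_realpow field_simps)
    qed
    have "dilate_functional r T (\<lambda>x. a * f x + b * g x) = a * dilate_functional r T f + b * dilate_functional r T g"
      if "f \<in> elems X" "g \<in> elems X" for f g a b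
    proof -
      have "dilate (1 / r) f \<in> elems X" "dilate (1 / r) g \<in> elems X"
        using C(2)[of "1 / r"] that r by auto
      then have "T (\<lambda>x. a * dilate (1 / r) f x + b * dilate (1 / r) g x)
          = a * T (dilate (1 / r) f) + b * T (dilate (1 / r) g)"
        using T unfolding dual_def by auto
      then show ?thesis by (simp add: dilate_functional_def dilate_def add_divide_distrib)
    qed
    moreover have "\<exists>c. \<forall>f\<in>elems X. \<bar>dilate_functional r T f\<bar> \<le> c * nrm X f" using bd by blast
    ultimately show "dilate_functional r T \<in> elems (dual X)" by (simp add: dual_def)
    show "nrm (dual X) (dilate_functional r T) \<le> C * r powr (- real CARD('n) - sigma X) * nrm (dual X) T"
      using C(1) dual_norm_nonneg[OF X T] by (intro dual_norm_le[OF X _ bd]) auto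
  qed (fact C(1))
  let ?i = "indicator (ball 0 1) :: real ^ 'n \<Rightarrow> real"
  obtain c where c: "koethe_bound X ?i c" using koethe_bound_ball[OF H] by blast
  have el: "pairing ?i \<in> elems (dual X)" using koethe_bound_fdual(1)[OF X c] by (simp add: fdual_def)
  \<comment> \<open>Evaluated at the ball itself, this functional gives the positive volume of the
    ball, so its norm is positive.\<close>
  have "pairing ?i ?i = measure lebesgue (ball (0 :: real ^ 'n) 1)"
    unfolding pairing_def by (simp flip: indicator_inter_arith)
  moreover have "\<dots> > 0" by (simp add: content_ball_pos)
  ultimately have "0 < nrm (dual X) (pairing ?i) * nrm X ?i"
    using dual_bound[OF X el class_H_ball_norm_pos(1)[OF H]] by linarith
  then have pos: "nrm (dual X) (pairing ?i) > 0"
    using class_H_ball_norm_pos(2)[OF H] by (simp add: zero_less_mult_iff)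
  have inv: "dilate_functional r (dilate_functional (1 / r) T) = T"
    if r: "r > 0" for r and T :: "(real ^ 'n \<Rightarrow> real) \<Rightarrow> real"
    using r by (simp add: dilate_functional_def dilate_def fun_eq_iff power_divide)
  show ?thesis
    unfolding sigma_dual_def
  proof (rule the_equality)
    fix s assume "has_scaling dilate_functional (dual X) s"
    then show "s = - real CARD('n) - sigma X" using has_scaling_unique[where dil = dilate_functional and F = "dual X" and z = "pairing ?i"]
      sc el pos inv by blast
  qed (fact sc)
qed

section \<open>Integrals over balls and the range of the exponents\<close>

text \<open>The indicator of the ball of radius r is that of the unit ball dilated by 1 / r, so its
  bound in the dual scales with the power n + \<sigma>.\<close>

lemma class_H_L1_on_dilated_ball:
  fixes X :: "('n::finite) fspace"
  assumes H: "class_H X"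
  obtains C where "C > 0" "\<And>f r. f \<in> elems X \<Longrightarrow> r > 0 \<Longrightarrow>
    (\<integral>\<^sup>+x. ennreal \<bar>f x\<bar> * indicator (ball 0 r) x \<partial>lebesgue)
      \<le> ennreal (C * r powr (real CARD('n) + sigma X) * nrm X f)"
proof -
  obtain c where c: "koethe_bound X (indicator (ball 0 1)) c" using koethe_bound_ball[OF H] by blast
  obtain C where C: "C > 0" "\<And>g c r. koethe_bound X g c \<Longrightarrow> r > 0 \<Longrightarrow>
    koethe_bound X (dilate r g) (C * r powr (- real CARD('n) - sigma X) * c)"
    using koethe_bound_dilate[OF H] by blast
  show thesis
  proof (rule that)
    \<comment> \<open>c is only known to be nonnegative; c + 1 keeps the constant positive.\<close>
    show "C * (c + 1) > 0" using C(1) koethe_boundD(2)[OF c] by simp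
    fix f and r :: real assume f: "f \<in> elems X" and r: "r > 0"
    have "(\<integral>\<^sup>+x. ennreal \<bar>f x\<bar> * indicator (ball 0 r) x \<partial>lebesgue)
      = abs_pairing f (dilate (1 / r) (indicator (ball 0 1)))"
      using dilate_indicator_ball[OF r, of 1, where 'n='n]
      by (intro nn_integral_cong) (auto simp: indicator_def)
    also have "\<dots> \<le> ennreal (C * (1 / r) powr (- real CARD('n) - sigma X) * c * nrm X f)"
      using koethe_boundD(3)[OF C(2)[OF c, of "1 / r"] f] r by simp
    also have "C * (1 / r) powr (- real CARD('n) - sigma X) * c * nrm X f
        = C * c * r powr (real CARD('n) + sigma X) * nrm X f"
      using r by (simp add: powr_divide powr_diff powr_add powr_minus field_simps)
    also have "\<dots> \<le> C * (c + 1) * r powr (real CARD('n) + sigma X) * nrm X f"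
      using C(1) class_H_norm_nonneg[OF H f]
      by (intro mult_right_mono) auto
    finally show "(\<integral>\<^sup>+x. ennreal \<bar>f x\<bar> * indicator (ball 0 r) x \<partial>lebesgue)
      \<le> ennreal (C * (c + 1) * r powr (real CARD('n) + sigma X) * nrm X f)"
      by (auto simp: ennreal_leI)
  qed
qed

text \<open>The indicator of the unit ball keeps its integral on every larger ball, while the bound
  r^(n + \<sigma>) would tend to 0 if this exponent were negative. For the dual it means
  \<open>sigma_dual X \<le> 0\<close>, which later yields \<theta>1 \<ge> 0.\<close>

lemma class_H_sigma_ge:
  fixes X :: "('n::finite) fspace"
  assumes H: "class_H X"
  shows "sigma X \<ge> - real CARD('n)"
proof (rule ccontr)
  assume "\<not> ?thesis"
  then have neg: "real CARD('n) + sigma X < 0" by simp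
  let ?i = "indicator (ball 0 1) :: real ^ 'n \<Rightarrow> real"
  note i = class_H_ball_norm_pos[OF H]
  obtain C where C: "C > 0" "\<And>f r. f \<in> elems X \<Longrightarrow> r > 0 \<Longrightarrow>
    (\<integral>\<^sup>+x. ennreal \<bar>f x\<bar> * indicator (ball 0 r) x \<partial>lebesgue)
      \<le> ennreal (C * r powr (real CARD('n) + sigma X) * nrm X f)"
    using class_H_L1_on_dilated_ball[OF H] by blast
  let ?v = "measure lebesgue (ball (0 :: real ^ 'n) 1)"
  have le: "?v \<le> C * nrm X ?i * r powr (real CARD('n) + sigma X)" if "r \<ge> 1" for r
  proof -
    have "ennreal ?v = (\<integral>\<^sup>+x. indicator (ball (0 :: real ^ 'n) 1) x \<partial>lebesgue)"
      by (simp add: emeasure_eq_measure2 emeasure_lborel_ball_finite)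
    also have "\<dots> \<le> (\<integral>\<^sup>+x. ennreal \<bar>?i x\<bar> * indicator (ball 0 r) x \<partial>lebesgue)"
      using that by (intro nn_integral_mono) (auto simp: indicator_def)
    also have "\<dots> \<le> ennreal (C * r powr (real CARD('n) + sigma X) * nrm X ?i)"
      using C(2)[OF i(1), of r] that by auto
    finally show ?thesis using C(1) i(2) by (simp add: mult_ac)
  qed
  have "((\<lambda>r. C * nrm X ?i * r powr (real CARD('n) + sigma X)) \<longlongrightarrow> C * nrm X ?i * 0) at_top"
    using neg by (intro tendsto_intros tendsto_neg_powr filterlim_ident)
  then have "?v \<le> C * nrm X ?i * 0"
  proof (rule tendsto_lowerbound)
    show "\<forall>\<^sub>F r in at_top. ?v \<le> C * nrm X ?i * r powr (real CARD('n) + sigma X)"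
      using eventually_ge_at_top[of 1] by (rule eventually_mono) (rule le)
  qed simp
  then have "?v \<le> 0" by simp
  moreover have "?v > 0" by (simp add: content_ball_pos)
  ultimately show False by linarith
qed

text \<open>A space with the scaling of \<open>L\<^sup>1\<close> lies in \<open>L\<^sup>1\<close>, because dilating the ball costs nothing.\<close>

lemma koethe_bound_of_bounded:
  fixes X :: "('n::finite) fspace"
  assumes H: "class_H X" and s: "sigma X = - real CARD('n)"
  obtains C where "C > 0" "\<And>g c. g \<in> borel_measurable lebesgue \<Longrightarrow> 0 \<le> c \<Longrightarrow> (\<And>x. \<bar>g x\<bar> \<le> c) \<Longrightarrow>
    koethe_bound X g (C * c)"
proof -
  obtain C where C: "C > 0" "\<And>f r. f \<in> elems X \<Longrightarrow> r > 0 \<Longrightarrow>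
    (\<integral>\<^sup>+x. ennreal \<bar>f x\<bar> * indicator (ball 0 r) x \<partial>lebesgue)
      \<le> ennreal (C * r powr (real CARD('n) + sigma X) * nrm X f)"
    using class_H_L1_on_dilated_ball[OF H] by blast
  have L1: "(\<integral>\<^sup>+x. ennreal \<bar>f x\<bar> \<partial>lebesgue) \<le> ennreal (C * nrm X f)" if f: "f \<in> elems X" for f
  proof -
    have [measurable]: "f \<in> borel_measurable lebesgue" using class_H_measurable[OF H f] .
    \<comment> \<open>The bound on balls requires a positive radius, hence \<open>Suc k\<close>.
      With \<sigma> = -n its right-hand side does not depend on the radius and survives the
      limit.\<close>
    have "(SUP k::nat. indicator (ball 0 (real (Suc k))) x) = (1 :: ennreal)" for x :: "real ^ 'n"
    proof (rule antisym)
      show "(SUP k::nat. indicator (ball 0 (real (Suc k))) x) \<le> (1 :: ennreal)"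
        by (rule SUP_least) (auto simp: indicator_def)
      obtain k :: nat where "norm x \<le> real k" using real_arch_simple by blast
      then have "indicator (ball 0 (real (Suc k))) x = (1 :: ennreal)" by (simp add: indicator_def)
      then show "(1 :: ennreal) \<le> (SUP k::nat. indicator (ball 0 (real (Suc k))) x)"
        by (intro SUP_upper2[of k]) auto
    qed
    then have "(\<integral>\<^sup>+x. ennreal \<bar>f x\<bar> \<partial>lebesgue)
      = (\<integral>\<^sup>+x. (SUP k::nat. ennreal \<bar>f x\<bar> * indicator (ball 0 (real (Suc k))) x) \<partial>lebesgue)"
      by (simp flip: SUP_mult_left_ennreal)
    also have "\<dots> = (SUP k::nat. (\<integral>\<^sup>+x. ennreal \<bar>f x\<bar> * indicator (ball 0 (real (Suc k))) x \<partial>lebesgue))"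
      by (rule nn_integral_monotone_convergence_SUP)
         (auto simp: incseq_def le_fun_def intro!: mult_left_mono indicator_leI
           borel_measurable_times_ennreal borel_measurable_indicator)
    also have "\<dots> \<le> ennreal (C * nrm X f)"
      using C(2)[OF f] by (intro SUP_least) (simp add: s)
    finally show ?thesis .
  qed
  have "koethe_bound X g (C * c)"
    if [measurable]: "g \<in> borel_measurable lebesgue" and c: "0 \<le> c" "\<And>x. \<bar>g x\<bar> \<le> c" for g c
    unfolding koethe_bound_def
  proof (intro conjI ballI)
    show "0 \<le> C * c" using C(1) c(1) by simp
    fix f assume f: "f \<in> elems X"
    have [measurable]: "f \<in> borel_measurable lebesgue" using class_H_measurable[OF H f] .
    have "abs_pairing f g \<le> (\<integral>\<^sup>+x. ennreal c * ennreal \<bar>f x\<bar> \<partial>lebesgue)"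
      using c by (intro nn_integral_mono) (auto simp: ennreal_mult[symmetric] abs_mult mult.commute[of c] intro!: ennreal_leI mult_left_mono)
    also have "\<dots> = ennreal c * (\<integral>\<^sup>+x. ennreal \<bar>f x\<bar> \<partial>lebesgue)"
      by (rule nn_integral_cmult) measurable
    also have "\<dots> \<le> ennreal c * ennreal (C * nrm X f)" by (intro mult_left_mono L1[OF f]) auto
    finally show "abs_pairing f g \<le> ennreal (C * c * nrm X f)"
      using c(1) C(1) class_H_norm_nonneg[OF H f] by (simp add: ennreal_mult[symmetric] mult_ac)
  qed (fact that(1))
  with C(1) that show thesis by blast
qed

text \<open>Indicators are idempotent, so f = g = indicator of \<open>ball 0 r\<close> compares its
  norm in X0' with the square of its norm in X'. Dilating back to the unit ball bounds the former
  below by a multiple of r^-\<sigma> with the exponent of X0'; the latter is at most a multiple of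
  r^(-2\<sigma>) with that of X'.\<close>

lemma sigma_fdual_of_product:
  fixes X X0 :: "('n::finite) fspace"
  assumes H: "class_H (fdual X)" "class_H (fdual X0)"
    and prod: "\<And>f g. f \<in> elems (fdual X) \<Longrightarrow> g \<in> elems (fdual X) \<Longrightarrow>
       nrm (fdual X0) (\<lambda>x. f x * g x) \<le> C * nrm (fdual X) f * nrm (fdual X) g"
  shows "sigma (fdual X0) = 2 * sigma (fdual X)"
proof -
  define Y Y0 where "Y = fdual X" and "Y0 = fdual X0"
  have Y: "class_H Y" and Y0: "class_H Y0" using H by (auto simp: Y_def Y0_def)
  obtain D where D: "D > 0"
    "\<And>a r. r > 0 \<Longrightarrow> indicator (ball a r) \<in> elems Y \<and> nrm Y (indicator (ball a r)) \<le> D * r powr - sigma Y"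
    using class_H_ball_norm[OF Y] by blast
  obtain E where E: "E > 0" "\<And>r f. r > 0 \<Longrightarrow> f \<in> elems Y0 \<Longrightarrow>
    dilate r f \<in> elems Y0 \<and> nrm Y0 (dilate r f) \<le> E * r powr sigma Y0 * nrm Y0 f"
    using class_H_dilate[OF Y0] by blast
  let ?i = "\<lambda>r. indicator (ball 0 r) :: real ^ 'n \<Rightarrow> real"
  define k where "k = nrm Y0 (?i 1)"
  have k: "k > 0" unfolding k_def using class_H_ball_norm_pos[OF Y0] by simp
  \<comment> \<open>The summand k keeps the denominator positive even if the constant of the product
    inequality is 0.\<close>
  have "k / (E * \<bar>C\<bar> * D\<^sup>2 + k) \<le> r powr (sigma Y0 - 2 * sigma Y)" if r: "r > 0" for r
  proof -
    obtain F where F: "F > 0"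
      "\<And>a r. r > 0 \<Longrightarrow> indicator (ball a r) \<in> elems Y0 \<and> nrm Y0 (indicator (ball a r)) \<le> F * r powr - sigma Y0"
      using class_H_ball_norm[OF Y0] by blast
    have d: "dilate r (?i r) = ?i 1"
      using dilate_indicator_ball[of "1 / r" r, where 'n='n] r by simp
    have i: "?i r \<in> elems Y" "nrm Y (?i r) \<le> D * r powr - sigma Y" using D(2)[OF r, of 0] by auto
    have nn: "0 \<le> nrm Y (?i r)" using banach_fspaceD(8)[OF class_H_banach[OF Y] i(1)] .
    have "k \<le> E * r powr sigma Y0 * nrm Y0 (?i r)"
      using E(2)[OF r, of "?i r"] F(2)[OF r, of 0] unfolding d k_def by simp
    also have "nrm Y0 (?i r) \<le> C * nrm Y (?i r) * nrm Y (?i r)"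
    proof -
      have "(\<lambda>x. ?i r x * ?i r x) = ?i r" by (auto simp: indicator_def)
      with prod[folded Y_def Y0_def, OF i(1) i(1)] show ?thesis by simp
    qed
    also have "\<dots> \<le> \<bar>C\<bar> * nrm Y (?i r) * nrm Y (?i r)" using nn by (intro mult_right_mono) auto
    also have "\<dots> \<le> \<bar>C\<bar> * (D * r powr - sigma Y) * (D * r powr - sigma Y)"
      using i(2) nn D(1) by (intro mult_mono) auto
    finally have "k \<le> E * r powr sigma Y0 * (\<bar>C\<bar> * (D * r powr - sigma Y) * (D * r powr - sigma Y))"
      using E(1) by (simp add: mult_left_mono)
    also have "\<dots> = E * \<bar>C\<bar> * D\<^sup>2 * (r powr sigma Y0 * r powr - sigma Y * r powr - sigma Y)"
      by (simp add: power2_eq_square mult_ac)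
    also have "r powr sigma Y0 * r powr - sigma Y * r powr - sigma Y = r powr (sigma Y0 - 2 * sigma Y)"
      by (simp flip: powr_add)
    also have "E * \<bar>C\<bar> * D\<^sup>2 * \<dots> \<le> (E * \<bar>C\<bar> * D\<^sup>2 + k) * r powr (sigma Y0 - 2 * sigma Y)"
      using k by (intro mult_right_mono) auto
    finally show ?thesis using k E(1) D(1) by (simp add: pos_divide_le_eq mult.commute add_nonneg_pos)
  qed
  moreover have "k / (E * \<bar>C\<bar> * D\<^sup>2 + k) > 0" using k E(1) by (simp add: add_nonneg_pos)
  ultimately have "sigma Y0 - 2 * sigma Y = 0" by (rule powr_bounded_below_imp_eq_0[rotated])
  then show ?thesis by (simp add: Y_def Y0_def)
qed

section \<open>Real interpolation\<close>

lemma Linf_norm_nonneg: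
  fixes g :: "real ^ 'n::finite \<Rightarrow> real"
  assumes "g \<in> elems Linf" shows "0 \<le> nrm Linf g"
  unfolding Linf_def by (simp add: real_of_ereal_pos esssup_abs_nonneg)

text \<open>Nonnegative norms bound the set of values below by 0, as a real \<open>Inf\<close>
  requires. The spaces enter only through this, so \<open>Linf\<close> and \<open>fdual\<close> can
  be inserted directly.\<close>

lemma
  assumes "\<And>a. a \<in> elems X \<Longrightarrow> 0 \<le> nrm X a" "\<And>b. b \<in> elems Y \<Longrightarrow> 0 \<le> nrm Y b" "0 \<le> t"
    and ab: "a \<in> elems X" "b \<in> elems Y" "f = (\<lambda>x. a x + b x)"
  shows K_functional_nonneg: "0 \<le> K_functional X Y t f"
    and K_functional_le: "K_functional X Y t f \<le> nrm X a + t * nrm Y b"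
proof -
  let ?S = "{nrm X a + t * nrm Y b |a b. a \<in> elems X \<and> b \<in> elems Y \<and> f = (\<lambda>x. a x + b x)}"
  have S: "nrm X a + t * nrm Y b \<in> ?S" and nn: "\<And>y. y \<in> ?S \<Longrightarrow> 0 \<le> y" using assms by auto
  show "0 \<le> K_functional X Y t f"
    unfolding K_functional_def using S nn by (intro cInf_greatest) blast+
  show "K_functional X Y t f \<le> nrm X a + t * nrm Y b"
    unfolding K_functional_def using nn by (intro cInf_lower[OF S] bdd_belowI[of _ 0])
qed

text \<open>Serves the case d = \<infinity>: the K-functional is at most min \<alpha> (t \<beta>),
  and t^-\<theta> cancels the power of t that this bound produces.\<close>

lemma min_le_powr:
  fixes a b :: real
  assumes "a > 0" "b > 0" "0 \<le> \<theta>" "\<theta> \<le> 1"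
  shows "min a b \<le> a powr (1 - \<theta>) * b powr \<theta>"
proof -
  have m: "min a b > 0" using assms by simp
  have "min a b = min a b powr (1 - \<theta>) * min a b powr \<theta>"
    using m by (simp flip: powr_add)
  also have "\<dots> \<le> a powr (1 - \<theta>) * b powr \<theta>"
    using m assms by (intro mult_mono powr_mono2) auto
  finally show ?thesis .
qed

text \<open>The counterpart for finite d. Up to t = a / b the minimum is t b, afterwards it is a;
  since 0 < \<theta> < 1, the resulting powers of t are integrable at 0 and at \<infinity>
  respectively. At the crossing point both pieces equal (a^(1-\<theta>) b^\<theta>)^d up to a
  factor.\<close>

lemma nn_integral_powr_min:
  fixes a b \<theta> d :: real
  assumes a: "a > 0" and b: "b > 0" and th: "0 < \<theta>" "\<theta> < 1" and d: "d > 0"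
  shows "(\<integral>\<^sup>+t\<in>{0<..}. ennreal ((t powr - \<theta> * min a (t * b)) powr d / t) \<partial>lborel)
     \<le> ennreal ((1 / ((1 - \<theta>) * d) + 1 / (\<theta> * d)) * (a powr (1 - \<theta>) * b powr \<theta>) powr d)"
proof -
  define u where "u = a / b"
  have u: "u > 0" using a b by (simp add: u_def)
  let ?e1 = "(1 - \<theta>) * d - 1" and ?e2 = "- (\<theta> * d) - 1"
  have e1: "?e1 > -1" and e2: "?e2 < -1" using th d by auto
  have I1: "(\<integral>\<^sup>+t. ennreal (t powr ?e1) * indicator {0..u} t \<partial>lborel) = ennreal (u powr (?e1 + 1) / (?e1 + 1))"
    using has_integral_powr_from_0[OF e1, of u] u by (intro nn_integral_has_integral_lebesgue') auto
  have I2: "(\<integral>\<^sup>+t. ennreal (t powr ?e2) * indicator {u..} t \<partial>lborel) = ennreal (- (u powr (?e2 + 1)) / (?e2 + 1))"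
    using has_integral_powr_to_inf[OF e2 u] by (intro nn_integral_has_integral_lebesgue') auto
  have "(\<integral>\<^sup>+t\<in>{0<..}. ennreal ((t powr - \<theta> * min a (t * b)) powr d / t) \<partial>lborel)
     \<le> (\<integral>\<^sup>+t. ennreal (b powr d) * (ennreal (t powr ?e1) * indicator {0..u} t)
          + ennreal (a powr d) * (ennreal (t powr ?e2) * indicator {u..} t) \<partial>lborel)"
  proof (rule nn_integral_mono)
    fix t :: real
    show "ennreal ((t powr - \<theta> * min a (t * b)) powr d / t) * indicator {0<..} t
      \<le> ennreal (b powr d) * (ennreal (t powr ?e1) * indicator {0..u} t)
          + ennreal (a powr d) * (ennreal (t powr ?e2) * indicator {u..} t)"
    proof (cases "t > 0")
      case t: True
      show ?thesis
      proof (cases "t \<le> u")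
        case True
        have "(t powr - \<theta> * min a (t * b)) powr d / t \<le> (t powr - \<theta> * (t * b)) powr d / t"
          using t a b d by (intro divide_right_mono powr_mono2 mult_left_mono) auto
        also have "t powr - \<theta> * (t * b) = t powr (1 - \<theta>) * b"
          using t by (simp add: powr_diff powr_minus field_simps)
        also have "(t powr (1 - \<theta>) * b) powr d / t = b powr d * (t powr ((1 - \<theta>) * d) / t)"
          using t b by (simp add: powr_mult powr_powr)
        also have "t powr ((1 - \<theta>) * d) / t = t powr ?e1"
          using t powr_diff[of t "(1 - \<theta>) * d" 1] by simp
        finally have "ennreal ((t powr - \<theta> * min a (t * b)) powr d / t)
            \<le> ennreal (b powr d) * ennreal (t powr ?e1)"
          by (simp add: ennreal_mult[symmetric] ennreal_leI)
        then show ?thesis using t True by (simp add: add_increasing2)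
      next
        case False
        have "(t powr - \<theta> * min a (t * b)) powr d / t \<le> (t powr - \<theta> * a) powr d / t"
          using t a b d by (intro divide_right_mono powr_mono2 mult_left_mono) auto
        also have "(t powr - \<theta> * a) powr d = t powr (- (\<theta> * d)) * a powr d"
          unfolding powr_mult powr_powr by simp
        also have "\<dots> / t = a powr d * t powr ?e2"
          using t powr_diff[of t "- (\<theta> * d)" 1] by simp
        finally have "ennreal ((t powr - \<theta> * min a (t * b)) powr d / t)
            \<le> ennreal (a powr d) * ennreal (t powr ?e2)"
          by (simp add: ennreal_mult[symmetric] ennreal_leI)
        then show ?thesis using t False by simp
      qed
    qed simp
  qed
  also have "\<dots> = ennreal (b powr d) * ennreal (u powr (?e1 + 1) / (?e1 + 1))
      + ennreal (a powr d) * ennreal (- (u powr (?e2 + 1)) / (?e2 + 1))"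
    by (simp add: nn_integral_add nn_integral_cmult I1 I2)
  also have "\<dots> = ennreal (b powr d * (u powr (?e1 + 1) / (?e1 + 1))
      + a powr d * (u powr (- (\<theta> * d)) / (\<theta> * d)))"
    using e1 th d by (simp add: ennreal_mult[symmetric] ennreal_plus[symmetric] del: ennreal_plus)
  also have "b powr d * (u powr (?e1 + 1) / (?e1 + 1)) + a powr d * (u powr (- (\<theta> * d)) / (\<theta> * d))
     = (1 / ((1 - \<theta>) * d) + 1 / (\<theta> * d)) * (a powr (1 - \<theta>) * b powr \<theta>) powr d"
  proof -
    have "b powr d * u powr ((1 - \<theta>) * d) = (a powr (1 - \<theta>) * b powr \<theta>) powr d"
      using a b by (simp add: u_def powr_divide powr_mult powr_powr powr_diff left_diff_distrib)
    moreover have "a powr d * u powr (- (\<theta> * d)) = (a powr (1 - \<theta>) * b powr \<theta>) powr d"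
      using a b by (simp add: u_def powr_divide powr_mult powr_powr powr_diff powr_minus left_diff_distrib)
    ultimately show ?thesis by (simp add: distrib_right)
  qed
  finally show ?thesis .
qed

text \<open>The interpolation inequality for bounded functions, freed from the parameter d. It has
  two sources: the embedding of an interpolation space if \<theta> > 0, and the scaling of L1 if
  \<theta> = 0.\<close>

definition koethe_interp :: "('n::finite) fspace \<Rightarrow> 'n fspace \<Rightarrow> real \<Rightarrow> real \<Rightarrow> bool" where
  "koethe_interp X0 Xi \<theta> C \<longleftrightarrow> C > 0 \<and>
     (\<forall>g \<alpha> \<beta>. 0 < \<alpha> \<longrightarrow> 0 < \<beta> \<longrightarrow> (\<forall>x. \<bar>g x\<bar> \<le> \<alpha>) \<longrightarrow> koethe_bound X0 g \<beta> \<longrightarrow>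
       koethe_bound Xi g (C * (\<alpha> powr (1 - \<theta>) * \<beta> powr \<theta>)))"

text \<open>The trivial splittings g = g + 0 and g = 0 + g suffice: they give K(t) \<le> min
  \<alpha> (t \<beta>), whose interpolation norm is at most c \<alpha>^(1-\<theta>)
  \<beta>^\<theta>.\<close>

lemma interp_Linf_koethe_bound:
  fixes X0 Xi :: "('n::finite) fspace" and \<theta> :: real
  assumes H0: "class_H X0" and Hi: "class_H Xi" and th: "0 < \<theta>" "\<theta> < 1" and d: "1 \<le> d"
    and emb: "embeds (interp Linf (fdual X0) \<theta> d) (fdual Xi)"
  shows "\<exists>C. koethe_interp X0 Xi \<theta> C"
proof -
  let ?Y = "fdual X0" and ?Z = "interp Linf (fdual X0) \<theta> d"
  note X0 = class_H_banach[OF H0]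
  obtain E where E: "elems ?Z \<subseteq> elems (fdual Xi)" "\<And>f. f \<in> elems ?Z \<Longrightarrow> nrm (fdual Xi) f \<le> E * nrm ?Z f"
    using emb unfolding embeds_def by blast
  obtain D where D: "D > 0" "\<And>g. g \<in> elems (fdual Xi) \<Longrightarrow> koethe_bound Xi g (D * nrm (fdual Xi) g)"
    using fdual_koethe_bound[OF Hi] by blast
  \<comment> \<open>The d-th root of the constant in \<open>nn_integral_powr_min\<close>; for d =
    \<infinity> the supremum costs no factor.\<close>
  define c where "c = (if d = \<infinity> then 1 else
    (1 / ((1 - \<theta>) * real_of_ereal d) + 1 / (\<theta> * real_of_ereal d)) powr (1 / real_of_ereal d))"
  have c: "c > 0"
  proof (cases "d = \<infinity>")
    case False
    then obtain r where "d = ereal r" "r \<ge> 1" using d by (cases d) auto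
    moreover from this have "1 / ((1 - \<theta>) * r) > 0" "1 / (\<theta> * r) > 0" using th by auto
    ultimately show ?thesis using False by (simp add: c_def less_imp_neq[OF add_pos_pos, symmetric])
  qed (simp add: c_def)
  have main: "g \<in> elems ?Z \<and> 0 \<le> nrm ?Z g \<and> nrm ?Z g \<le> c * (\<alpha> powr (1 - \<theta>) * \<beta> powr \<theta>)"
    if ab: "0 < \<alpha>" "0 < \<beta>" and g1: "\<And>x. \<bar>g x\<bar> \<le> \<alpha>" and g2: "koethe_bound X0 g \<beta>" for g \<alpha> \<beta>
  proof -
    have gm: "g \<in> borel_measurable lebesgue" using koethe_boundD(1)[OF g2] .
    note L = Linf_bounded[OF gm g1]
    note Y = koethe_bound_fdual[OF X0 g2]
    have L0: "(\<lambda>x::real^'n. 0) \<in> elems Linf" "nrm Linf (\<lambda>x::real^'n. 0) = 0"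
      using Linf_bounded[of "\<lambda>x::real^'n. 0" 0] by auto
    have Y0: "(\<lambda>x. 0) \<in> elems ?Y" "nrm ?Y (\<lambda>x. 0) = 0"
      using koethe_bound_fdual[OF X0 koethe_bound_zero[OF X0]] fdual_norm_nonneg[OF X0] by force+
    let ?K = "\<lambda>t. K_functional Linf ?Y t g"
    note nn = Linf_norm_nonneg fdual_norm_nonneg[OF X0]
    have K0: "0 \<le> ?K t" if "t > 0" for t
      using that L(1) Y0(1) by (intro K_functional_nonneg[of Linf ?Y t g "\<lambda>x. 0"] nn) auto
    have K1: "?K t \<le> \<alpha>" if "t > 0" for t
      using K_functional_le[of Linf ?Y t g "\<lambda>x. 0" g, OF nn] that L Y0 by simp
    have K2: "?K t \<le> t * \<beta>" if "t > 0" for t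
    proof -
      have "?K t \<le> t * nrm ?Y g"
        using K_functional_le[of Linf ?Y t "\<lambda>x. 0" g g, OF nn] that L0 Y by simp
      also have "\<dots> \<le> t * \<beta>" using Y(2) that by (intro mult_left_mono) auto
      finally show ?thesis .
    qed
    have S: "g \<in> {\<lambda>x. a x + b x | a b. a \<in> elems Linf \<and> b \<in> elems ?Y}"
      unfolding mem_Collect_eq by (intro exI[of _ g] exI[of _ "\<lambda>x. 0"]) (simp add: L(1) Y0(1))
    define P where "P = (\<lambda>t. t powr - \<theta> * ?K t)"
    show ?thesis
    proof (cases "d = \<infinity>")
      case True
      have P: "0 \<le> P t" "P t \<le> \<alpha> powr (1 - \<theta>) * \<beta> powr \<theta>" if t: "t > 0" for t
      proof -
        show "0 \<le> P t" using K0[OF t] by (simp add: P_def)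
        have "?K t \<le> \<alpha> powr (1 - \<theta>) * (t * \<beta>) powr \<theta>"
          using min_le_powr[of \<alpha> "t * \<beta>" \<theta>] ab t th K1[OF t] K2[OF t] by simp
        then have "P t \<le> t powr - \<theta> * (\<alpha> powr (1 - \<theta>) * (t * \<beta>) powr \<theta>)"
          unfolding P_def by (intro mult_left_mono) auto
        also have "\<dots> = \<alpha> powr (1 - \<theta>) * \<beta> powr \<theta>"
          using t ab by (simp add: powr_mult powr_minus field_simps)
        finally show "P t \<le> \<alpha> powr (1 - \<theta>) * \<beta> powr \<theta>" .
      qed
      have bdd: "bdd_above (P ` {0<..})" using P(2) by (intro bdd_aboveI2) auto
      have "nrm ?Z g = (SUP t\<in>{0<..}. P t)" using True by (simp add: interp_def P_def)
      moreover have "(SUP t\<in>{0<..}. P t) \<le> \<alpha> powr (1 - \<theta>) * \<beta> powr \<theta>"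
        using P(2) by (intro cSUP_least) auto
      moreover have "0 \<le> (SUP t\<in>{0<..}. P t)"
        using bdd P(1)[of 1] by (intro cSUP_upper2[of _ _ 1]) auto
      moreover have "g \<in> elems ?Z" using True S bdd by (simp add: interp_def P_def)
      ultimately show ?thesis using True by (simp add: c_def)
    next
      case False
      then obtain r where r: "d = ereal r" "r \<ge> 1" using d by (cases d) auto
      let ?I = "\<integral>\<^sup>+t\<in>{0<..}. ennreal (P t powr r / t) \<partial>lborel"
      let ?k = "1 / ((1 - \<theta>) * r) + 1 / (\<theta> * r)"
      let ?m = "\<alpha> powr (1 - \<theta>) * \<beta> powr \<theta>"
      have k: "?k > 0" using r th by (intro add_pos_pos) auto
      have "?I \<le> (\<integral>\<^sup>+t\<in>{0<..}. ennreal ((t powr - \<theta> * min \<alpha> (t * \<beta>)) powr r / t) \<partial>lborel)"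
      proof (rule nn_integral_mono)
        fix t :: real
        show "ennreal (P t powr r / t) * indicator {0<..} t
          \<le> ennreal ((t powr - \<theta> * min \<alpha> (t * \<beta>)) powr r / t) * indicator {0<..} t"
          using K0[of t] K1[of t] K2[of t] r unfolding P_def
          by (cases "t > 0") (auto intro!: ennreal_leI divide_right_mono powr_mono2 mult_left_mono)
      qed
      also have "\<dots> \<le> ennreal (?k * ?m powr r)"
        using nn_integral_powr_min[OF ab th, of r] r by simp
      finally have I: "?I \<le> ennreal (?k * ?m powr r)" .
      have fin: "?I < \<infinity>" using le_less_trans[OF I ennreal_less_top] by simp
      have el: "g \<in> elems ?Z" using False S fin r by (simp add: interp_def P_def)
      have "nrm ?Z g = enn2real ?I powr (1 / r)" using r by (simp add: interp_def P_def)
      also have "\<dots> \<le> (?k * ?m powr r) powr (1 / r)"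
      proof (intro powr_mono2)
        show "enn2real ?I \<le> ?k * ?m powr r" using enn2real_mono[OF I] k by simp
      qed (use r in auto)
      also have "\<dots> = ?k powr (1 / r) * ?m" using r k ab by (simp add: powr_mult powr_powr)
      finally have "nrm ?Z g \<le> c * ?m" using r by (simp add: c_def)
      then show ?thesis using el \<open>nrm ?Z g = enn2real ?I powr (1 / r)\<close> by simp
    qed
  qed
  show ?thesis
    unfolding koethe_interp_def
  proof (intro exI[of _ "D * ((\<bar>E\<bar> + 1) * c)"] conjI allI impI)
    show "D * ((\<bar>E\<bar> + 1) * c) > 0" using c D(1) by simp
    fix g \<alpha> \<beta> assume a: "0 < \<alpha>" "0 < \<beta>" "\<forall>x. \<bar>g x\<bar> \<le> \<alpha>" "koethe_bound X0 g \<beta>"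
    let ?m = "\<alpha> powr (1 - \<theta>) * \<beta> powr \<theta>"
    note m = main[OF a(1,2) spec[OF a(3)] a(4)]
    have "nrm (fdual Xi) g \<le> E * nrm ?Z g" using E(2) m by blast
    also have "\<dots> \<le> (\<bar>E\<bar> + 1) * (c * ?m)" using m by (intro mult_mono) auto
    finally have "D * nrm (fdual Xi) g \<le> D * ((\<bar>E\<bar> + 1) * c) * ?m"
      using D(1) by (simp add: mult.assoc)
    moreover have "koethe_bound Xi g (D * nrm (fdual Xi) g)" using D(2) E(1) m by blast
    ultimately show "koethe_bound Xi g (D * ((\<bar>E\<bar> + 1) * c) * ?m)"
      using koethe_bound_mono[OF class_H_banach[OF Hi]] koethe_boundD(1)[OF a(4)] by fastforce
  qed
qed

section \<open>Integrals over time as K-method norms\<close>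

text \<open>Substitution r = c t^p on the half-line. Finiteness of the integral allows a passage
  through absolutely integrable functions, where the change of variables is available; nonnegativity
  leads back to the extended integral.\<close>

lemma nn_integral_powr_substitution:
  fixes f :: "real \<Rightarrow> real"
  assumes meas: "f \<in> borel_measurable borel" and nn: "\<And>r. r > 0 \<Longrightarrow> 0 \<le> f r"
    and I: "(\<integral>\<^sup>+r\<in>{0<..}. ennreal (f r) \<partial>lborel) = ennreal I" "I \<ge> 0"
    and c: "c > 0" and p: "p > 0"
  shows "(\<integral>\<^sup>+t\<in>{0<..}. ennreal (c * p * t powr (p - 1) * f (c * t powr p)) \<partial>lborel) = ennreal I"
proof -
  let ?g = "\<lambda>t. c * t powr p" and ?g' = "\<lambda>t. c * p * t powr (p - 1)"
  have inj: "inj_on ?g {0<..}"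
  proof (rule inj_onI)
    fix s t :: real assume st: "s \<in> {0<..}" "t \<in> {0<..}" "c * s powr p = c * t powr p"
    then have "(s powr p) powr (1 / p) = (t powr p) powr (1 / p)" using c by simp
    then show "s = t" using st p by (simp add: powr_powr)
  qed
  have img: "?g ` {0<..} = {0<..}"
  proof
    show "{0<..} \<subseteq> ?g ` {0<..}"
    proof
      fix r :: real assume r: "r \<in> {0<..}"
      then have "r = ?g ((r / c) powr (1 / p))" using c p by (simp add: powr_powr)
      moreover have "(r / c) powr (1 / p) \<in> {0<..}" using r c by simp
      ultimately show "r \<in> ?g ` {0<..}" by blast
    qed
  qed (use c in auto)
  have der: "(?g has_field_derivative ?g' t) (at t within {0<..})" if "t \<in> {0<..}" for t
    using that by (auto intro!: derivative_eq_intros)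
  have eq: "(\<integral>\<^sup>+r\<in>{0<..}. ennreal (h r) \<partial>lborel) = (\<integral>\<^sup>+r. ennreal (indicator {0<..} r *\<^sub>R h r) \<partial>lebesgue)"
    for h :: "real \<Rightarrow> real"
    unfolding nn_integral_completion by (intro nn_integral_cong) (auto simp: indicator_def)
  have "integrable lebesgue (\<lambda>r. indicator {0<..} r *\<^sub>R f r)"
  proof (rule integrableI_nonneg)
    show "(\<lambda>r. indicator {0<..} r *\<^sub>R f r) \<in> borel_measurable lebesgue"
      using meas by (intro measurable_completion) auto
    show "(\<integral>\<^sup>+r. ennreal (indicator {0<..} r *\<^sub>R f r) \<partial>lebesgue) < \<infinity>"
      unfolding eq[symmetric] I(1) by simp
  qed (use nn in \<open>auto simp: indicator_def\<close>)
  then have int: "f absolutely_integrable_on {0<..}" by (simp add: set_integrable_def)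
  have "(LINT r:{0<..}|lebesgue. f r) = I"
  proof -
    have ae: "AE r in lebesgue. 0 \<le> indicator {0<..} r *\<^sub>R f r"
      using nn by (auto simp: indicator_def)
    have "ennreal (LINT r:{0<..}|lebesgue. f r) = ennreal I"
      using nn_integral_eq_integral[OF int[unfolded set_integrable_def] ae]
      unfolding eq[symmetric] I(1) set_lebesgue_integral_def by simp
    moreover have "0 \<le> (LINT r:{0<..}|lebesgue. f r)"
      unfolding set_lebesgue_integral_def by (rule integral_nonneg_AE[OF ae])
    ultimately show ?thesis using I(2) by simp
  qed
  then have "f absolutely_integrable_on (?g ` {0<..}) \<and> integral (?g ` {0<..}) f = I"
    using int set_lebesgue_integral_eq_integral(2)[OF int] by (simp add: img)
  then have T: "(\<lambda>t. \<bar>?g' t\<bar> * f (?g t)) absolutely_integrable_on {0<..}"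
      "integral {0<..} (\<lambda>t. \<bar>?g' t\<bar> * f (?g t)) = I"
    using has_absolute_integral_change_of_variables_1'[OF _ der inj, of f I] by auto
  have "(\<integral>\<^sup>+t\<in>{0<..}. ennreal (\<bar>?g' t\<bar> * f (?g t)) \<partial>lborel)
      = ennreal (LINT t:{0<..}|lebesgue. \<bar>?g' t\<bar> * f (?g t))"
    unfolding eq set_lebesgue_integral_def
    using T(1) nn c p unfolding set_integrable_def
    by (intro nn_integral_eq_integral) (auto simp: indicator_def)
  also have "\<dots> = ennreal I" using set_lebesgue_integral_eq_integral(2)[OF T(1)] T(2) by simp
  finally show ?thesis using c p by simp
qed

text \<open>Monotonicity in t makes the K-functional Borel measurable, and it bounds the value at r
  by a weighted integral over t \<ge> r.\<close>

lemma K_functional_mono: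
  assumes "\<And>a. a \<in> elems X \<Longrightarrow> 0 \<le> nrm X a" "\<And>b. b \<in> elems Y \<Longrightarrow> 0 \<le> nrm Y b" "0 \<le> s" "s \<le> t"
    and "a \<in> elems X" "b \<in> elems Y" "f = (\<lambda>x. a x + b x)"
  shows "K_functional X Y s f \<le> K_functional X Y t f"
  unfolding K_functional_def[of _ _ t]
proof (rule cInf_greatest)
  show "{nrm X a + t * nrm Y b |a b. a \<in> elems X \<and> b \<in> elems Y \<and> f = (\<lambda>x. a x + b x)} \<noteq> {}"
    using assms(5-7) by blast
  fix y assume "y \<in> {nrm X a + t * nrm Y b |a b. a \<in> elems X \<and> b \<in> elems Y \<and> f = (\<lambda>x. a x + b x)}"
  then obtain a b where ab: "y = nrm X a + t * nrm Y b" "a \<in> elems X" "b \<in> elems Y" "f = (\<lambda>x. a x + b x)"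
    by blast
  have "K_functional X Y s f \<le> nrm X a + s * nrm Y b"
    using K_functional_le[OF assms(1-3) ab(2-4)] .
  also have "\<dots> \<le> y" using assms(2)[OF ab(3)] \<open>s \<le> t\<close> by (simp add: ab(1) mult_right_mono)
  finally show "K_functional X Y s f \<le> y" .
qed

text \<open>A splitting f = a + b gives the bound A ||a|| + B ||b|| = A (||a|| + (B / A) ||b||). The
  infimum over all splittings is A times the K-functional at the ratio of the two bounds.\<close>

lemma koethe_bound_K_functional:
  assumes X: "banach_fspace X" and Y: "banach_fspace Y"
    and W: "koethe_bound X W A" "koethe_bound Y W B" and A: "A > 0"
    and f: "a \<in> elems X" "b \<in> elems Y" "f = (\<lambda>x. a x + b x)"
  shows "abs_pairing f W \<le> ennreal (A * K_functional X Y (B / A) f)"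
proof -
  let ?I = "\<integral>\<^sup>+x. ennreal \<bar>f x * W x\<bar> \<partial>lebesgue"
  note [measurable] = koethe_boundD(1)[OF W(1)]
  have le: "?I \<le> ennreal (A * (nrm X a + B / A * nrm Y b))"
    if ab: "a \<in> elems X" "b \<in> elems Y" "f = (\<lambda>x. a x + b x)" for a b
  proof -
    note [measurable] = banach_fspaceD(1)[OF X ab(1)] banach_fspaceD(1)[OF Y ab(2)]
    have "?I \<le> (\<integral>\<^sup>+x. ennreal \<bar>a x * W x\<bar> + ennreal \<bar>b x * W x\<bar> \<partial>lebesgue)"
      by (intro nn_integral_mono)
         (auto simp: ab(3) ennreal_plus[symmetric] algebra_simps simp del: ennreal_plus intro!: ennreal_leI)
    also have "\<dots> \<le> ennreal (A * nrm X a) + ennreal (B * nrm Y b)"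
      using koethe_boundD(3)[OF W(1) ab(1)] koethe_boundD(3)[OF W(2) ab(2)]
      by (subst nn_integral_add) (auto intro: add_mono)
    also have "\<dots> = ennreal (A * (nrm X a + B / A * nrm Y b))"
      using A koethe_boundD(2)[OF W(2)] banach_fspaceD(8)[OF X ab(1)] banach_fspaceD(8)[OF Y ab(2)]
      by (simp add: ennreal_plus[symmetric] distrib_left del: ennreal_plus)
    finally show ?thesis .
  qed
  have "?I < \<infinity>" using le_less_trans[OF le[OF f] ennreal_less_top] by simp
  then obtain r where r: "r \<ge> 0" "?I = ennreal r" by (cases ?I) auto
  have "r / A \<le> K_functional X Y (B / A) f"
    unfolding K_functional_def
  proof (rule cInf_greatest)
    show "{nrm X a + B / A * nrm Y b |a b. a \<in> elems X \<and> b \<in> elems Y \<and> f = (\<lambda>x. a x + b x)} \<noteq> {}"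
      using f by blast
    fix y assume "y \<in> {nrm X a + B / A * nrm Y b |a b. a \<in> elems X \<and> b \<in> elems Y \<and> f = (\<lambda>x. a x + b x)}"
    then obtain a b where ab: "y = nrm X a + B / A * nrm Y b" "a \<in> elems X" "b \<in> elems Y" "f = (\<lambda>x. a x + b x)"
      by blast
    have "0 \<le> y"
      using A koethe_boundD(2)[OF W(2)] banach_fspaceD(8)[OF X ab(2)] banach_fspaceD(8)[OF Y ab(3)]
      by (simp add: ab(1))
    then have "r \<le> A * y" using le[OF ab(2-4)] A r by (simp add: ab(1))
    then show "r / A \<le> y" using A by (simp add: field_simps)
  qed
  then show ?thesis using r A by (simp add: field_simps ennreal_leI)
qed

text \<open>The integral over \<open>\<tau>\<close> becomes the interpolation norm of \<open>f\<close> when the ratio of the two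
  bounds on \<open>W \<tau>\<close> is taken as the new variable.\<close>

lemma interp_time_integral:
  fixes X1 X2 :: "('n::finite) fspace" and W :: "real \<Rightarrow> real ^ 'n \<Rightarrow> real" and \<theta> \<theta>1 \<theta>2 :: real
  assumes X1: "banach_fspace X1" and X2: "banach_fspace X2"
    and th: "0 < \<theta>" "\<theta> < 1" "\<theta>1 < \<theta>2" and half: "\<theta> * \<theta>2 + (1 - \<theta>) * \<theta>1 = 1 / 2"
    and f: "f \<in> elems (interp X1 X2 \<theta> 1)"
    and pos: "C1 > 0" "C2 > 0" "M > 0" "\<mu> > 0"
    and W1: "\<And>\<tau>. \<tau> > 0 \<Longrightarrow> koethe_bound X1 (W \<tau>) (C1 * (M * \<tau> powr (- 2 * (1 - \<theta>1)) * \<mu> powr \<theta>1))"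
    and W2: "\<And>\<tau>. \<tau> > 0 \<Longrightarrow> koethe_bound X2 (W \<tau>) (C2 * (M * \<tau> powr (- 2 * (1 - \<theta>2)) * \<mu> powr \<theta>2))"
  defines "C \<equiv> C1 * (C2 / C1) powr \<theta>"
  shows "0 \<le> nrm (interp X1 X2 \<theta> 1) f"
    and "\<tau> > 0 \<Longrightarrow> abs_pairing f (W \<tau>)
       \<le> ennreal (C * (M * \<mu> powr (1 / 2) * nrm (interp X1 X2 \<theta> 1) f) / \<tau>)"
    and "(\<integral>\<^sup>+\<tau>\<in>{0<..}. abs_pairing f (W \<tau>) \<partial>lborel)
       \<le> ennreal (C / (2 * (\<theta>2 - \<theta>1)) * (M * \<mu> powr (1 / 2) * nrm (interp X1 X2 \<theta> 1) f))"
proof -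
  let ?N = "nrm (interp X1 X2 \<theta> 1) f"
  define k where "k = (\<lambda>r. K_functional X1 X2 r f)"
  \<comment> \<open>With these p and c, the bound of W \<tau> in the dual of X2 divided by that in
    the dual of X1 is c \<tau>^p.\<close>
  define p where "p = 2 * (\<theta>2 - \<theta>1)"
  define c where "c = C2 / C1 * \<mu> powr (\<theta>2 - \<theta>1)"
  have p: "p > 0" and c: "c > 0" using th pos by (auto simp: p_def c_def)
  have "\<exists>a b. a \<in> elems X1 \<and> b \<in> elems X2 \<and> f = (\<lambda>x. a x + b x)"
    using f by (auto simp: interp_def)
  then obtain a b where ab: "a \<in> elems X1" "b \<in> elems X2" "f = (\<lambda>x. a x + b x)" by blast
  note nn = banach_fspaceD(8)[OF X1] banach_fspaceD(8)[OF X2]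
  have k0: "0 \<le> k r" if "r \<ge> 0" for r
    unfolding k_def using that by (intro K_functional_nonneg[OF nn _ ab]) auto
  have kmono: "k r \<le> k s" if "0 \<le> r" "r \<le> s" for r s
    unfolding k_def using that by (intro K_functional_mono[OF nn _ _ ab]) auto
  \<comment> \<open>\<open>max 0 r\<close> extends the K-functional to a monotone function on the
    whole line, which is therefore Borel.\<close>
  define \<phi> where "\<phi> = (\<lambda>r. r powr (- \<theta> - 1) * k (max 0 r))"
  have \<phi>m [measurable]: "\<phi> \<in> borel_measurable borel"
  proof -
    have "mono (\<lambda>r. k (max 0 r))" by (rule monoI) (auto intro!: kmono)
    then have [measurable]: "(\<lambda>r. k (max 0 r)) \<in> borel_measurable borel" by (rule borel_measurable_mono)
    show ?thesis unfolding \<phi>_def by measurable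
  qed
  let ?I = "\<integral>\<^sup>+r\<in>{0<..}. ennreal (\<phi> r) \<partial>lborel"
  have Ieq: "?I = (\<integral>\<^sup>+t\<in>{0<..}. ennreal ((t powr - \<theta> * K_functional X1 X2 t f) powr real_of_ereal 1 / t) \<partial>lborel)"
  proof (rule nn_integral_cong)
    fix t :: real
    show "ennreal (\<phi> t) * indicator {0<..} t
      = ennreal ((t powr - \<theta> * K_functional X1 X2 t f) powr real_of_ereal 1 / t) * indicator {0<..} t"
      using k0[of t] by (cases "t > 0") (auto simp: \<phi>_def k_def powr_diff powr_one)
  qed
  have fin: "?I < \<infinity>" using f unfolding Ieq by (auto simp: interp_def)
  have Neq: "?N = enn2real ?I" unfolding Ieq by (simp add: interp_def powr_one)
  then show N0: "0 \<le> ?N" by simp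
  have IN: "?I = ennreal ?N" using fin Neq by simp
  have bound: "abs_pairing f (W \<tau>)
      \<le> ennreal (C1 * M * \<mu> powr \<theta>1 * (\<tau> powr (- 2 * (1 - \<theta>1)) * k (c * \<tau> powr p)))" if t: "\<tau> > 0" for \<tau>
  proof -
    let ?A = "C1 * (M * \<tau> powr (- 2 * (1 - \<theta>1)) * \<mu> powr \<theta>1)"
    let ?B = "C2 * (M * \<tau> powr (- 2 * (1 - \<theta>2)) * \<mu> powr \<theta>2)"
    have e: "\<tau> powr (- 2 * (1 - \<theta>2)) = \<tau> powr p * \<tau> powr (- 2 * (1 - \<theta>1))"
      unfolding powr_add[symmetric] p_def by (simp add: algebra_simps)
    have m: "\<mu> powr \<theta>2 = \<mu> powr (\<theta>2 - \<theta>1) * \<mu> powr \<theta>1" by (simp flip: powr_add)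
    have q: "?B / ?A = c * \<tau> powr p"
      unfolding e m c_def using pos t by (simp add: field_simps)
    have "?A > 0" using pos t by simp
    from koethe_bound_K_functional[OF X1 X2 W1[OF t] W2[OF t] this ab]
    show ?thesis unfolding q by (simp add: k_def mult_ac)
  qed
  \<comment> \<open>The embedding of the interpolation space with second parameter 1 into that with
    \<infinity>: k is monotone, and t^(-\<theta>-1) has integral r^-\<theta> / \<theta> over t \<ge>
    r.\<close>
  have ke: "k r \<le> \<theta> * r powr \<theta> * ?N" if r: "r > 0" for r
  proof -
    have "ennreal (k r * (r powr - \<theta> / \<theta>)) = (\<integral>\<^sup>+t. ennreal (k r) * (ennreal (t powr (- \<theta> - 1)) * indicator {r..} t) \<partial>lborel)"
    proof -
      have "(\<integral>\<^sup>+t. ennreal (t powr (- \<theta> - 1)) * indicator {r..} t \<partial>lborel) = ennreal (- (r powr (- \<theta> - 1 + 1)) / (- \<theta> - 1 + 1))"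
        using has_integral_powr_to_inf[of "- \<theta> - 1" r] th r by (intro nn_integral_has_integral_lebesgue') auto
      then show ?thesis
        using k0[of r] r th ennreal_mult[of "k r" "r powr - \<theta> / \<theta>"] by (simp add: nn_integral_cmult)
    qed
    also have "\<dots> \<le> ?I"
    proof (rule nn_integral_mono)
      fix t :: real
      show "ennreal (k r) * (ennreal (t powr (- \<theta> - 1)) * indicator {r..} t) \<le> ennreal (\<phi> t) * indicator {0<..} t"
        using r k0[of r] kmono[of r t]
        by (cases "t \<ge> r") (auto simp: \<phi>_def ennreal_mult[symmetric] mult.commute intro!: ennreal_leI mult_left_mono)
    qed
    also have "\<dots> = ennreal ?N" by (fact IN)
    finally have "k r * (r powr - \<theta> / \<theta>) \<le> ?N" using N0 by simp
    then show ?thesis using th r by (simp add: powr_minus field_simps)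
  qed
  \<comment> \<open>The power of \<mu> interpolates to 1/2; with \<mu> = r^-e this halves the Morrey
    exponent of the product.\<close>
  have mu: "\<mu> powr \<theta>1 * (\<mu> powr (\<theta>2 - \<theta>1)) powr \<theta> = \<mu> powr (1 / 2)"
    unfolding powr_powr powr_add[symmetric] half[symmetric] by (simp add: algebra_simps)
  have cth: "C1 * M * \<mu> powr \<theta>1 * c powr \<theta> = C * M * \<mu> powr (1 / 2)"
    unfolding mu[symmetric] c_def C_def using pos by (subst powr_mult) auto
  \<comment> \<open>The same relation between \<theta>, \<theta>1 and \<theta>2 balances the powers
    of time: \<tau>^(p \<theta>) \<tau>^(-2(1-\<theta>1)) = 1 / \<tau>.\<close>
  have pth: "p * \<theta> - 2 * (1 - \<theta>1) = - 1"
    using half by (simp add: p_def algebra_simps)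
  show "abs_pairing f (W \<tau>) \<le> ennreal (C * (M * \<mu> powr (1 / 2) * ?N) / \<tau>)" if t: "\<tau> > 0"
  proof -
    have "k (c * \<tau> powr p) \<le> \<theta> * (c * \<tau> powr p) powr \<theta> * ?N" using t c by (intro ke) auto
    also have "\<dots> \<le> 1 * (c * \<tau> powr p) powr \<theta> * ?N" using th N0 by (intro mult_right_mono) auto
    finally have "C1 * M * \<mu> powr \<theta>1 * (\<tau> powr (- 2 * (1 - \<theta>1)) * k (c * \<tau> powr p))
        \<le> C1 * M * \<mu> powr \<theta>1 * (\<tau> powr (- 2 * (1 - \<theta>1)) * ((c * \<tau> powr p) powr \<theta> * ?N))"
      using pos by (intro mult_left_mono) auto
    also have "\<dots> = (C1 * M * \<mu> powr \<theta>1 * c powr \<theta>) * (\<tau> powr (p * \<theta>) * \<tau> powr (- 2 * (1 - \<theta>1))) * ?N"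
      using c by (simp add: powr_mult powr_powr mult_ac)
    also have "\<tau> powr (p * \<theta>) * \<tau> powr (- 2 * (1 - \<theta>1)) = 1 / \<tau>"
    proof -
      have "p * \<theta> + - 2 * (1 - \<theta>1) = - 1" using pth by simp
      then have "\<tau> powr (p * \<theta>) * \<tau> powr (- 2 * (1 - \<theta>1)) = \<tau> powr (- 1)"
        by (simp only: powr_add[symmetric])
      then show ?thesis using t by (simp only: powr_minus powr_one divide_inverse mult_1)
    qed
    finally have "C1 * M * \<mu> powr \<theta>1 * (\<tau> powr (- 2 * (1 - \<theta>1)) * k (c * \<tau> powr p))
        \<le> C * (M * \<mu> powr (1 / 2) * ?N) / \<tau>" unfolding cth by (simp add: mult_ac)
    with bound[OF t] show ?thesis by (meson ennreal_leI order_trans)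
  qed
  have "(\<integral>\<^sup>+\<tau>\<in>{0<..}. abs_pairing f (W \<tau>) \<partial>lborel)
     \<le> (\<integral>\<^sup>+\<tau>\<in>{0<..}. ennreal (C * M * \<mu> powr (1 / 2) / p) * ennreal (c * p * \<tau> powr (p - 1) * \<phi> (c * \<tau> powr p)) \<partial>lborel)"
  proof (rule nn_integral_mono)
    fix \<tau> :: real
    show "abs_pairing f (W \<tau>) * indicator {0<..} \<tau>
       \<le> ennreal (C * M * \<mu> powr (1 / 2) / p) * ennreal (c * p * \<tau> powr (p - 1) * \<phi> (c * \<tau> powr p)) * indicator {0<..} \<tau>"
    proof (cases "\<tau> > 0")
      case t: True
      have z: "c * \<tau> powr p > 0" using t c by simp
      \<comment> \<open>The factor c p \<tau>^(p-1) is the Jacobian of r = c \<tau>^p. The division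
        by p cancels its p and becomes 1 / (2(\<theta>2 - \<theta>1)) in the result.\<close>
      have "C * M * \<mu> powr (1 / 2) / p * (c * p * \<tau> powr (p - 1) * \<phi> (c * \<tau> powr p))
         = C1 * M * \<mu> powr \<theta>1 * (c powr \<theta> * c * c powr (- \<theta> - 1)) * (\<tau> powr (p - 1) * \<tau> powr (p * (- \<theta> - 1))) * k (c * \<tau> powr p)"
        using p c z unfolding cth[symmetric] by (simp add: \<phi>_def powr_mult powr_powr mult_ac)
      also have "c powr \<theta> * c * c powr (- \<theta> - 1) = 1"
        using c by (simp add: powr_diff powr_minus field_simps)
      also have "\<tau> powr (p - 1) * \<tau> powr (p * (- \<theta> - 1)) = \<tau> powr (- 2 * (1 - \<theta>1))"
      proof -
        have "(p - 1) + p * (- \<theta> - 1) = - 2 * (1 - \<theta>1)" using pth by (simp add: algebra_simps)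
        then show ?thesis by (simp only: powr_add[symmetric])
      qed
      finally have eq: "C * M * \<mu> powr (1 / 2) / p * (c * p * \<tau> powr (p - 1) * \<phi> (c * \<tau> powr p))
         = C1 * M * \<mu> powr \<theta>1 * (\<tau> powr (- 2 * (1 - \<theta>1)) * k (c * \<tau> powr p))" by simp
      have C0: "0 \<le> C * M * \<mu> powr (1 / 2) / p" using pos p by (simp add: C_def)
      show ?thesis using bound[OF t] t C0 unfolding ennreal_mult'[OF C0, symmetric] eq by simp
    qed simp
  qed
  also have "\<dots> = ennreal (C * M * \<mu> powr (1 / 2) / p) * (\<integral>\<^sup>+\<tau>\<in>{0<..}. ennreal (c * p * \<tau> powr (p - 1) * \<phi> (c * \<tau> powr p)) \<partial>lborel)"
    by (simp add: mult.assoc nn_integral_cmult)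
  also have "\<dots> = ennreal (C * M * \<mu> powr (1 / 2) / p) * ennreal ?N"
    using nn_integral_powr_substitution[OF \<phi>m _ IN N0 c p] k0 by (simp add: \<phi>_def)
  also have "\<dots> = ennreal (C / (2 * (\<theta>2 - \<theta>1)) * (M * \<mu> powr (1 / 2) * ?N))"
    using N0 by (simp add: ennreal_mult''[symmetric] p_def mult.assoc)
  finally show "(\<integral>\<^sup>+\<tau>\<in>{0<..}. abs_pairing f (W \<tau>) \<partial>lborel)
       \<le> ennreal (C / (2 * (\<theta>2 - \<theta>1)) * (M * \<mu> powr (1 / 2) * ?N))" .
qed

section \<open>The heat semigroup\<close>

lemma ident_borel_lebesgue: "(\<lambda>x. x) \<in> borel_measurable lebesgue"
  using id_borel_measurable_lebesgue by (simp add: id_def)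

lemma borel_fst_lebesgue [measurable]:
  "fst \<in> borel_measurable ((lebesgue :: 'a::euclidean_space measure) \<Otimes>\<^sub>M M)"
  by (rule measurable_compose[OF measurable_fst ident_borel_lebesgue])

lemma borel_snd_lebesgue [measurable]:
  "snd \<in> borel_measurable (M \<Otimes>\<^sub>M (lebesgue :: 'a::euclidean_space measure))"
  by (rule measurable_compose[OF measurable_snd ident_borel_lebesgue])

lemma heat_kernel_nonneg: "0 \<le> heat_kernel t x"
  by (simp add: heat_kernel_def)

lemma heat_kernel_measurable [measurable]:
  assumes [measurable]: "a \<in> borel_measurable M" "b \<in> borel_measurable M"
  shows "(\<lambda>p. heat_kernel (a p) (b p)) \<in> borel_measurable M"
  unfolding heat_kernel_def by measurable

text \<open>\<open>heat\<close> is 0 by default where its integral diverges. The convolution with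
  |g| as an extended integral is always meaningful, and its finiteness licenses the linearity of
  \<open>heat\<close>.\<close>

definition heat_abs :: "real \<Rightarrow> (real ^ 'n::finite \<Rightarrow> real) \<Rightarrow> real ^ 'n \<Rightarrow> ennreal" where
  "heat_abs t g x = (\<integral>\<^sup>+y. ennreal (heat_kernel t (x - y) * \<bar>g y\<bar>) \<partial>lebesgue)"



text \<open>Joint measurability in (s, x) of U(t - s) g for one fixed g; time-dependent data are
  reduced to this case through simple functions.\<close>

lemma heat_measurable:
  fixes g :: "real ^ 'n::finite \<Rightarrow> real"
  assumes [measurable]: "g \<in> borel_measurable lebesgue"
  shows "(\<lambda>p. heat (t - fst p) g (snd p)) \<in> borel_measurable ((lebesgue :: real measure) \<Otimes>\<^sub>M lebesgue)"
proof -
  interpret sigma_finite_measure "lebesgue :: (real ^ 'n) measure" by (rule sigma_finite_lebesgue)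
  have [measurable]: "(\<lambda>q. fst (fst q)) \<in> borel_measurable (((lebesgue :: real measure) \<Otimes>\<^sub>M (lebesgue :: (real ^ 'n) measure)) \<Otimes>\<^sub>M (lebesgue :: (real ^ 'n) measure))"
    using measurable_compose[OF measurable_fst borel_fst_lebesgue] by simp
  have [measurable]: "(\<lambda>q. snd (fst q)) \<in> borel_measurable (((lebesgue :: real measure) \<Otimes>\<^sub>M (lebesgue :: (real ^ 'n) measure)) \<Otimes>\<^sub>M (lebesgue :: (real ^ 'n) measure))"
    using measurable_compose[OF measurable_fst borel_snd_lebesgue] by simp
  show ?thesis
    unfolding heat_def
    by (rule borel_measurable_lebesgue_integral) (simp add: case_prod_beta, measurable)
qed

lemma heat_measurable_space:
  fixes g :: "real ^ 'n::finite \<Rightarrow> real"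
  assumes "g \<in> borel_measurable lebesgue"
  shows "heat t g \<in> borel_measurable lebesgue"
proof -
  have "(\<lambda>x. (0 :: real, x)) \<in> lebesgue \<rightarrow>\<^sub>M (lebesgue :: real measure) \<Otimes>\<^sub>M (lebesgue :: (real ^ 'n) measure)"
    by measurable
  from measurable_compose[OF this heat_measurable[OF assms, of t]] show ?thesis by simp
qed

lemma heat_abs_cong:
  assumes "AE y in lebesgue. \<bar>g y\<bar> = \<bar>h y\<bar>" shows "heat_abs t g = heat_abs t h"
  unfolding heat_abs_def using assms by (intro ext nn_integral_cong_AE) auto

lemma heat_abs_finite_integrable:
  assumes [measurable]: "g \<in> borel_measurable lebesgue" and fin: "heat_abs t g x < \<infinity>"
  shows "integrable lebesgue (\<lambda>y. heat_kernel t (x - y) * g y)"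
proof (rule integrableI_bounded)
  have [measurable]: "(\<lambda>y. y) \<in> borel_measurable (lebesgue :: (real ^ 'a) measure)"
    by (rule ident_borel_lebesgue)
  show "(\<lambda>y. heat_kernel t (x - y) * g y) \<in> borel_measurable lebesgue" by measurable
  show "(\<integral>\<^sup>+y. ennreal (norm (heat_kernel t (x - y) * g y)) \<partial>lebesgue) < \<infinity>"
    using fin by (simp add: heat_abs_def abs_mult heat_kernel_nonneg)
qed

lemma heat_le_heat_abs: "ennreal \<bar>heat t g x\<bar> \<le> heat_abs t g x"
proof (cases "integrable lebesgue (\<lambda>y. heat_kernel t (x - y) * g y)")
  case True
  from integral_norm_bound_ennreal[OF this] show ?thesis
    by (simp add: heat_def heat_abs_def abs_mult heat_kernel_nonneg)
next
  case False
  then have "heat t g x = 0" unfolding heat_def by (rule not_integrable_integral_eq)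
  then show ?thesis by simp
qed

text \<open>Cut space into the shells k s \<le> |x - y| < (k + 1) s. On each of them \<kappa> is at
  most c k, and the shell lies in the ball of radius (k + 1) s, where the mass of G is
  controlled.\<close>

lemma nn_integral_le_shells:
  fixes G :: "real ^ 'n::finite \<Rightarrow> ennreal" and c :: "nat \<Rightarrow> real"
  assumes s: "s > 0" and M: "0 \<le> M" and c: "\<And>k. 0 \<le> c k"
    and \<kappa>: "\<And>y k. real k \<le> norm (x - y) / s \<Longrightarrow> \<kappa> y \<le> c k"
    and G [measurable]: "G \<in> borel_measurable lebesgue"
    and le: "\<And>r. r > 0 \<Longrightarrow> (\<integral>\<^sup>+y. G y * indicator (ball x r) y \<partial>lebesgue) \<le> ennreal (M * r powr q)"
  shows "(\<integral>\<^sup>+y. ennreal (\<kappa> y) * G y \<partial>lebesgue) \<le> (\<Sum>k. ennreal (c k * (M * ((real k + 1) * s) powr q)))"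
proof -
  let ?r = "\<lambda>k. (real k + 1) * s"
  let ?f = "\<lambda>k y. ennreal (c k) * (G y * indicator (ball x (?r k)) y)"
  have Gm: "(\<lambda>y. G y * indicator (ball x r) y) \<in> borel_measurable lebesgue" for r
    by (intro borel_measurable_times_ennreal borel_measurable_indicator) auto
  have "(\<integral>\<^sup>+y. ennreal (\<kappa> y) * G y \<partial>lebesgue) \<le> (\<integral>\<^sup>+y. (\<Sum>k. ?f k y) \<partial>lebesgue)"
  proof (rule nn_integral_mono)
    fix y
    define k where "k = nat \<lfloor>norm (x - y) / s\<rfloor>"
    have k: "real k \<le> norm (x - y) / s" "norm (x - y) / s < real k + 1"
      using s by (auto simp: k_def)
    then have "y \<in> ball x (?r k)" using s by (simp add: pos_divide_less_eq dist_norm)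
    then have "ennreal (\<kappa> y) * G y \<le> ?f k y" using \<kappa>[OF k(1)] by (simp add: mult_right_mono ennreal_leI)
    also have "\<dots> = sum (\<lambda>k. ?f k y) {k}"
      by (simp only: sum.insert finite.emptyI empty_iff not_False_eq_True sum.empty add_0_right)
    also have "\<dots> \<le> (\<Sum>k. ?f k y)" by (rule sum_le_suminf) auto
    finally show "ennreal (\<kappa> y) * G y \<le> (\<Sum>k. ?f k y)" .
  qed
  also have "\<dots> = (\<Sum>k. ennreal (c k) * (\<integral>\<^sup>+y. G y * indicator (ball x (?r k)) y \<partial>lebesgue))"
    by (subst nn_integral_suminf) (auto intro!: borel_measurable_times_ennreal Gm suminf_cong nn_integral_cmult)
  also have "\<dots> \<le> (\<Sum>k. ennreal (c k) * ennreal (M * ?r k powr q))"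
    using s by (intro suminf_le mult_left_mono le) (auto intro: add_nonneg_pos)
  also have "\<dots> = (\<Sum>k. ennreal (c k * (M * ?r k powr q)))"
    using M c by (intro suminf_cong ennreal_mult[symmetric]) auto
  finally show ?thesis .
qed

text \<open>Shells of width sqrt t: on the k-th the kernel is at most (4 \<pi> t)^(-n/2) e^(-k^2/4)
  and the mass of G at most M (k + 1)^q t^(q/2). The Gaussian makes the series converge for every
  real q, and the powers of t combine to (q - n)/2.\<close>

lemma heat_kernel_integral_bound:
  fixes q :: real
  obtains C where "C > 0" "\<And>t M x (G :: real ^ 'n::finite \<Rightarrow> ennreal). t > 0 \<Longrightarrow> 0 \<le> M \<Longrightarrow>
    G \<in> borel_measurable lebesgue \<Longrightarrow>
    (\<And>r. r > 0 \<Longrightarrow> (\<integral>\<^sup>+y. G y * indicator (ball x r) y \<partial>lebesgue) \<le> ennreal (M * r powr q)) \<Longrightarrow>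
    (\<integral>\<^sup>+y. ennreal (heat_kernel t (x - y)) * G y \<partial>lebesgue) \<le> ennreal (C * M * t powr ((q - real CARD('n)) / 2))"
proof -
  define a where "a = (\<lambda>k. exp (- ((real k)\<^sup>2 / 4)) * (real k + 1) powr q)"
  have sa: "summable a"
  proof (rule summable_comparison_test_bigo)
    show "a \<in> O(\<lambda>k. 1 / (real k)\<^sup>2)" unfolding a_def by real_asymp
    show "summable (\<lambda>k. norm (1 / (real k)\<^sup>2))"
      using inverse_power_summable[of 2, where 'a=real] by (simp add: field_simps)
  qed
  define S where "S = (\<Sum>k. a k)"
  have S: "S > 0" unfolding S_def by (rule suminf_pos[OF sa]) (simp add: a_def)
  define K where "K = (4 * pi) powr (- (real CARD('n) / 2))"
  have K: "K > 0" by (simp add: K_def)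
  show thesis
  proof (rule that[of "K * S"])
    show "K * S > 0" using S K by simp
    fix t M :: real and x and G :: "real ^ 'n \<Rightarrow> ennreal"
    assume t: "t > 0" and M: "0 \<le> M" and [measurable]: "G \<in> borel_measurable lebesgue"
      and G: "\<And>r. r > 0 \<Longrightarrow> (\<integral>\<^sup>+y. G y * indicator (ball x r) y \<partial>lebesgue) \<le> ennreal (M * r powr q)"
    let ?c = "\<lambda>k. (4 * pi * t) powr (- (real CARD('n) / 2)) * exp (- ((real k)\<^sup>2 / 4))"
    let ?r = "\<lambda>k. (real k + 1) * sqrt t"
    have "(\<integral>\<^sup>+y. ennreal (heat_kernel t (x - y)) * G y \<partial>lebesgue) \<le> (\<Sum>k. ennreal (?c k * (M * ?r k powr q)))"
    proof (rule nn_integral_le_shells[OF _ M _ _ _ G])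
      fix y k assume "real k \<le> norm (x - y) / sqrt t"
      then have "(real k)\<^sup>2 \<le> (norm (x - y) / sqrt t)\<^sup>2" by (intro power_mono) auto
      also have "\<dots> = (norm (x - y))\<^sup>2 / t" using t by (simp add: power_divide)
      finally have "(real k)\<^sup>2 / 4 \<le> (norm (x - y))\<^sup>2 / (4 * t)" using t by (simp add: field_simps)
      then show "heat_kernel t (x - y) \<le> ?c k"
        unfolding heat_kernel_def by (intro mult_left_mono) auto
    qed (use t in auto)
    also have "\<dots> = (\<Sum>k. ennreal (K * M * t powr ((q - real CARD('n)) / 2) * a k))"
    proof (intro suminf_cong)
      fix k
      have e1: "(4 * pi * t) powr (- (real CARD('n) / 2)) = K * t powr (- (real CARD('n) / 2))"
        unfolding K_def using t by (simp add: powr_mult)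
      have e2: "?r k powr q = (real k + 1) powr q * t powr (q / 2)"
        using t by (simp add: powr_mult powr_half_sqrt[symmetric] powr_powr)
      have e3: "t powr (- (real CARD('n) / 2)) * t powr (q / 2) = t powr ((q - real CARD('n)) / 2)"
        unfolding powr_add[symmetric] by (simp add: diff_divide_distrib)
      have "?c k * (M * ?r k powr q) = K * M * (t powr (- (real CARD('n) / 2)) * t powr (q / 2)) * a k"
        unfolding e1 e2 a_def by (simp only: mult_ac)
      then show "ennreal (?c k * (M * ?r k powr q)) = ennreal (K * M * t powr ((q - real CARD('n)) / 2) * a k)"
        unfolding e3 by (simp only:)
    qed
    also have "\<dots> = ennreal (\<Sum>k. K * M * t powr ((q - real CARD('n)) / 2) * a k)"
      using M K by (intro suminf_ennreal2 summable_mult sa) (simp add: a_def)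
    also have "\<dots> = ennreal (K * S * M * t powr ((q - real CARD('n)) / 2))"
      unfolding S_def suminf_mult[OF sa] by (simp add: mult_ac)
    finally show "(\<integral>\<^sup>+y. ennreal (heat_kernel t (x - y)) * G y \<partial>lebesgue)
       \<le> ennreal (K * S * M * t powr ((q - real CARD('n)) / 2))" .
  qed
qed

text \<open>The case G = 1, q = n: the power of t is then 0, so the bound is uniform in t.\<close>

lemma heat_kernel_mass_bound:
  obtains C where "C > 0" "\<And>t. t > 0 \<Longrightarrow> (\<integral>\<^sup>+z. ennreal (heat_kernel t (z :: real ^ 'n::finite)) \<partial>lebesgue) \<le> ennreal C"
proof -
  obtain C where C: "C > 0" "\<And>t M x (G :: real ^ 'n::finite \<Rightarrow> ennreal). t > 0 \<Longrightarrow> 0 \<le> M \<Longrightarrow>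
    G \<in> borel_measurable lebesgue \<Longrightarrow>
    (\<And>r. r > 0 \<Longrightarrow> (\<integral>\<^sup>+y. G y * indicator (ball x r) y \<partial>lebesgue) \<le> ennreal (M * r powr real CARD('n))) \<Longrightarrow>
    (\<integral>\<^sup>+y. ennreal (heat_kernel t (x - y)) * G y \<partial>lebesgue) \<le> ennreal (C * M * t powr ((real CARD('n) - real CARD('n)) / 2))"
    using heat_kernel_integral_bound[of "real CARD('n)", where 'n='n] by blast
  let ?v = "unit_ball_vol (real DIM(real ^ 'n))"
  have "(\<integral>\<^sup>+z. ennreal (heat_kernel t (z :: real ^ 'n)) \<partial>lebesgue) \<le> ennreal (C * ?v)" if t: "t > 0" for t
  proof -
    have "(\<integral>\<^sup>+y. ennreal (heat_kernel t ((0 :: real ^ 'n) - y)) * 1 \<partial>lebesgue)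
        \<le> ennreal (C * ?v * t powr ((real CARD('n) - real CARD('n)) / 2))"
      using t by (intro C(2)) (auto simp: emeasure_ball powr_realpow unit_ball_vol_nonneg)
    then show ?thesis using t by (simp add: heat_kernel_def)
  qed
  moreover have "C * ?v > 0" using C(1) unit_ball_vol_pos[of "real DIM(real ^ 'n)"] by simp
  ultimately show thesis using that by blast
qed

section \<open>Morrey bounds under the heat flow\<close>

text \<open>The Morrey condition through \<open>koethe_bound\<close>, with the power e of the radius
  as a free parameter. For e = n / l + \<open>sigma (fdual X)\<close> it corresponds to
  \<open>morrey (fdual X) l\<close>.\<close>

definition morrey_bound :: "('n::finite) fspace \<Rightarrow> real \<Rightarrow> (real ^ 'n \<Rightarrow> real) \<Rightarrow> real \<Rightarrow> bool" where
  "morrey_bound X e g m \<longleftrightarrow> g \<in> borel_measurable lebesgue \<and> 0 \<le> m \<and>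
     (\<forall>a. \<forall>r>0. koethe_bound X (cut a r g) (m * r powr - e))"

lemma morrey_boundD:
  assumes "morrey_bound X e g m"
  shows "g \<in> borel_measurable lebesgue" "0 \<le> m" "r > 0 \<Longrightarrow> koethe_bound X (cut a r g) (m * r powr - e)"
  using assms by (auto simp: morrey_bound_def)

lemma cut_measurable:
  "f \<in> borel_measurable lebesgue \<Longrightarrow> cut a r f \<in> borel_measurable (lebesgue :: (real ^ 'n::finite) measure)"
  unfolding cut_def by (intro borel_measurable_times borel_measurable_indicator) auto

lemma morrey_bound_mono:
  assumes X: "banach_fspace X" and h: "morrey_bound X e h m" and g: "g \<in> borel_measurable lebesgue"
    and le: "AE x in lebesgue. \<bar>g x\<bar> \<le> \<bar>h x\<bar>" and "m \<le> k"
  shows "morrey_bound X e g k"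
  unfolding morrey_bound_def
proof (intro conjI allI impI)
  show "0 \<le> k" using morrey_boundD(2)[OF h] \<open>m \<le> k\<close> by simp
  fix a and r :: real assume "r > 0"
  then show "koethe_bound X (cut a r g) (k * r powr - e)"
    using le \<open>m \<le> k\<close>
    by (intro koethe_bound_mono[OF X morrey_boundD(3)[OF h]] cut_measurable g)
       (auto simp: cut_def abs_mult mult_right_mono elim!: eventually_mono intro!: mult_left_mono)
qed (fact g)

lemma morrey_bound_zero: "banach_fspace X \<Longrightarrow> morrey_bound X e (\<lambda>x. 0) 0"
  using koethe_bound_zero[of X] by (simp add: morrey_bound_def cut_def)

lemma morrey_bound_add:
  assumes X: "banach_fspace X" and g: "morrey_bound X e g m" and h: "morrey_bound X e h k"
  shows "morrey_bound X e (\<lambda>x. g x + h x) (m + k)"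
proof -
  have c: "cut a r (\<lambda>x. g x + h x) = (\<lambda>x. cut a r g x + cut a r h x)" for a r
    by (simp add: cut_def distrib_left)
  show ?thesis
    using morrey_boundD[OF g] morrey_boundD[OF h] koethe_bound_add[OF X morrey_boundD(3)[OF g] morrey_boundD(3)[OF h]]
    by (auto simp: morrey_bound_def c distrib_right)
qed

lemma morrey_bound_cmult:
  assumes X: "banach_fspace X" and g: "morrey_bound X e g m"
  shows "morrey_bound X e (\<lambda>x. c * g x) (\<bar>c\<bar> * m)"
proof -
  have e: "cut a r (\<lambda>x. c * g x) = (\<lambda>x. c * cut a r g x)" for a r
    by (simp add: cut_def mult_ac)
  show ?thesis
    using morrey_boundD[OF g] koethe_bound_cmult[OF X morrey_boundD(3)[OF g]]
    by (auto simp: morrey_bound_def e mult.assoc)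
qed

lemma morrey_bound_sum:
  assumes X: "banach_fspace X" and "finite I" and "\<And>i. i \<in> I \<Longrightarrow> morrey_bound X e (g i) (m i)"
  shows "morrey_bound X e (\<lambda>x. \<Sum>i\<in>I. g i x) (\<Sum>i\<in>I. m i)"
  using assms(2,3)
proof (induction I rule: finite_induct)
  case empty
  then show ?case using morrey_bound_zero[OF X] by simp
next
  case (insert i I)
  then show ?case using morrey_bound_add[OF X, of e "g i" "m i"] by simp
qed

text \<open>Test with the indicator of the ball, an element of X of norm O(r^-\<sigma>).\<close>

lemma morrey_bound_L1:
  fixes X :: "('n::finite) fspace"
  assumes H: "class_H X"
  obtains C where "C > 0" "\<And>e g m a r. morrey_bound X e g m \<Longrightarrow> r > 0 \<Longrightarrow>
    (\<integral>\<^sup>+y. ennreal \<bar>g y\<bar> * indicator (ball a r) y \<partial>lebesgue) \<le> ennreal (C * m * r powr (- e - sigma X))"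
proof -
  obtain C where C: "C > 0"
    "\<And>a r. r > 0 \<Longrightarrow> indicator (ball a r) \<in> elems X \<and> nrm X (indicator (ball a r)) \<le> C * r powr - sigma X"
    using class_H_ball_norm[OF H] by blast
  have "(\<integral>\<^sup>+y. ennreal \<bar>g y\<bar> * indicator (ball a r) y \<partial>lebesgue) \<le> ennreal (C * m * r powr (- e - sigma X))"
    if g: "morrey_bound X e g m" and r: "r > 0" for e g m a r
  proof -
    have "(\<integral>\<^sup>+y. ennreal \<bar>g y\<bar> * indicator (ball a r) y \<partial>lebesgue)
      = (\<integral>\<^sup>+y. ennreal \<bar>indicator (ball a r) y * cut a r g y\<bar> \<partial>lebesgue)"
      by (intro nn_integral_cong) (auto simp: cut_def indicator_def)
    also have "\<dots> \<le> ennreal (m * r powr - e * nrm X (indicator (ball a r)))"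
      using C(2)[OF r] by (intro koethe_boundD(3)[OF morrey_boundD(3)[OF g r]]) auto
    also have "\<dots> \<le> ennreal (m * r powr - e * (C * r powr - sigma X))"
      using C(2)[OF r] morrey_boundD(2)[OF g] by (intro ennreal_leI mult_left_mono) auto
    also have "m * r powr - e * (C * r powr - sigma X) = C * m * (r powr - e * r powr - sigma X)"
      by (simp add: mult_ac)
    also have "r powr - e * r powr - sigma X = r powr (- e - sigma X)" by (simp flip: powr_add)
    finally show ?thesis .
  qed
  with C(1) that show thesis by blast
qed

text \<open>The growth of the integral of |g| over balls, with q = -e - \<sigma>, is inserted into
  the Gaussian shell estimate.\<close>

lemma heat_abs_sup_bound:
  fixes X :: "('n::finite) fspace"
  assumes H: "class_H X"
  obtains C where "C > 0" "\<And>g m t x. morrey_bound X e g m \<Longrightarrow> t > 0 \<Longrightarrow>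
    heat_abs t g x \<le> ennreal (C * m * t powr (- (e + sigma X + real CARD('n)) / 2))"
proof -
  obtain C where C: "C > 0" "\<And>e g m a r. morrey_bound X e g m \<Longrightarrow> r > 0 \<Longrightarrow>
    (\<integral>\<^sup>+y. ennreal \<bar>g y\<bar> * indicator (ball a r) y \<partial>lebesgue) \<le> ennreal (C * m * r powr (- e - sigma X))"
    using morrey_bound_L1[OF H] by blast
  obtain D where D: "D > 0" "\<And>t M x (G :: real ^ 'n::finite \<Rightarrow> ennreal). t > 0 \<Longrightarrow> 0 \<le> M \<Longrightarrow>
    G \<in> borel_measurable lebesgue \<Longrightarrow>
    (\<And>r. r > 0 \<Longrightarrow> (\<integral>\<^sup>+y. G y * indicator (ball x r) y \<partial>lebesgue) \<le> ennreal (M * r powr (- e - sigma X))) \<Longrightarrow>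
    (\<integral>\<^sup>+y. ennreal (heat_kernel t (x - y)) * G y \<partial>lebesgue)
      \<le> ennreal (D * M * t powr ((- e - sigma X - real CARD('n)) / 2))"
    using heat_kernel_integral_bound[of "- e - sigma X", where 'n='n] by blast
  have "heat_abs t g x \<le> ennreal (D * C * m * t powr (- (e + sigma X + real CARD('n)) / 2))"
    if g: "morrey_bound X e g m" and t: "t > 0" for g m t x
  proof -
    have [measurable]: "g \<in> borel_measurable lebesgue" by (rule morrey_boundD(1)[OF g])
    have "heat_abs t g x = (\<integral>\<^sup>+y. ennreal (heat_kernel t (x - y)) * ennreal \<bar>g y\<bar> \<partial>lebesgue)"
      unfolding heat_abs_def by (simp add: ennreal_mult heat_kernel_nonneg)
    also have "\<dots> \<le> ennreal (D * (C * m) * t powr ((- e - sigma X - real CARD('n)) / 2))"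
      using C(1) morrey_boundD(2)[OF g] by (intro D(2)[OF t] C(2)[OF g]) auto
    also have "(- e - sigma X - real CARD('n)) / 2 = - (e + sigma X + real CARD('n)) / 2" by simp
    finally show ?thesis by (simp add: mult_ac)
  qed
  then show thesis using C(1) D(1) that[of "D * C"] by simp
qed

text \<open>The heat flow averages translates of g. Each translation is moved onto f, where (M3)
  controls it, and onto the ball, in whose centre the Morrey bound is uniform. The price is the
  constant of (M3) and the mass of the kernel.\<close>

lemma heat_koethe_bound:
  fixes X :: "('n::finite) fspace"
  assumes H: "class_H X"
  obtains C where "C > 0" "\<And>e g m t a r. morrey_bound X e g m \<Longrightarrow> t > 0 \<Longrightarrow> r > 0 \<Longrightarrow>
    koethe_bound X (cut a r (heat t g)) (C * m * r powr - e)"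
proof -
  obtain D where D: "D > 0"
    "\<And>f a. f \<in> elems X \<Longrightarrow> (\<lambda>x. f (x - a)) \<in> elems X \<and> nrm X (\<lambda>x. f (x - a)) \<le> D * nrm X f"
    using class_H_translate[OF H] by blast
  obtain E where E: "E > 0" "\<And>t. t > 0 \<Longrightarrow> (\<integral>\<^sup>+z. ennreal (heat_kernel t (z :: real ^ 'n)) \<partial>lebesgue) \<le> ennreal E"
    using heat_kernel_mass_bound by blast
  have "koethe_bound X (cut a r (heat t g)) (E * D * m * r powr - e)"
    if g: "morrey_bound X e g m" and t: "t > 0" and r: "r > 0" for e g m t a r
    unfolding koethe_bound_def
  proof (intro conjI ballI)
    show "cut a r (heat t g) \<in> borel_measurable lebesgue"
      by (intro cut_measurable heat_measurable_space morrey_boundD(1)[OF g])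
    show "0 \<le> E * D * m * r powr - e" using D(1) E(1) morrey_boundD(2)[OF g] by simp
    fix f assume f: "f \<in> elems X"
    interpret L: sigma_finite_measure "lebesgue :: (real ^ 'n) measure" by (rule sigma_finite_lebesgue)
    interpret P: pair_sigma_finite "lebesgue :: (real ^ 'n) measure" "lebesgue :: (real ^ 'n) measure" ..
    have [measurable]: "f \<in> borel_measurable lebesgue" by (rule class_H_measurable[OF H f])
    have f1 [measurable]: "(\<lambda>x. ennreal \<bar>f x\<bar> * indicator (ball a r) x) \<in> borel_measurable lebesgue"
      by (intro borel_measurable_times_ennreal borel_measurable_indicator) auto
    have id [measurable]: "(\<lambda>y. y) \<in> borel_measurable (lebesgue :: (real ^ 'n) measure)"
      by (rule ident_borel_lebesgue)
    \<comment> \<open>As g is only Lebesgue measurable, g (x - z) need not be measurable in (x, z)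
      for the product sigma-algebra. A Borel function equal to g almost everywhere has the same
      \<open>heat_abs\<close> and the same Morrey bound.\<close>
    obtain h where h [measurable]: "h \<in> borel_measurable borel" and gh: "AE x in lebesgue. g x = h x"
      using completion_ex_borel_measurable_real[of g lborel] morrey_boundD(1)[OF g]
      by (auto dest: AE_completion)
    have hL [measurable]: "h \<in> borel_measurable lebesgue" using h by (intro measurable_completion) auto
    have hb: "morrey_bound X e h m"
      using gh by (intro morrey_bound_mono[OF class_H_banach[OF H] g hL]) auto
    have gt: "heat_abs t g = heat_abs t h" using gh by (intro heat_abs_cong) auto
    have ht: "heat_abs t h x = (\<integral>\<^sup>+z. ennreal (heat_kernel t z) * ennreal \<bar>h (x - z)\<bar> \<partial>lebesgue)" for x
    proof -
      have hm: "(\<lambda>y. ennreal (heat_kernel t (x - y) * \<bar>h y\<bar>)) \<in> borel_measurable lebesgue" by measurable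
      have "heat_abs t h x = (\<integral>\<^sup>+z. ennreal (heat_kernel t (x - (x + (-1) *\<^sub>R z)) * \<bar>h (x + (-1) *\<^sub>R z)\<bar>) \<partial>lebesgue)"
        unfolding heat_abs_def using nn_integral_affine_lebesgue[of _ "-1" x, OF hm] by simp
      then show ?thesis by (simp add: ennreal_mult heat_kernel_nonneg)
    qed
    have "abs_pairing f (cut a r (heat t g))
       \<le> ball_pairing a r f (heat_abs t g)"
      by (intro nn_integral_mono)
         (auto simp: cut_def indicator_def abs_mult ennreal_mult intro!: mult_left_mono heat_le_heat_abs)
    also have "\<dots> = (\<integral>\<^sup>+x. (\<integral>\<^sup>+z. (ennreal \<bar>f x\<bar> * indicator (ball a r) x) * (ennreal (heat_kernel t z) * ennreal \<bar>h (x - z)\<bar>) \<partial>lebesgue) \<partial>lebesgue)"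
      unfolding gt ht by (auto intro!: nn_integral_cong nn_integral_cmult[symmetric])
    also have "\<dots> = (\<integral>\<^sup>+z. (\<integral>\<^sup>+x. (ennreal \<bar>f x\<bar> * indicator (ball a r) x) * (ennreal (heat_kernel t z) * ennreal \<bar>h (x - z)\<bar>) \<partial>lebesgue) \<partial>lebesgue)"
      by (rule P.Fubini'[symmetric]) (simp add: case_prod_beta, measurable)
    also have "\<dots> \<le> (\<integral>\<^sup>+z. ennreal (heat_kernel t (z :: real ^ 'n)) * ennreal (m * r powr - e * (D * nrm X f)) \<partial>lebesgue)"
    proof (rule nn_integral_mono)
      fix z :: "real ^ 'n"
      have sh: "(\<lambda>x. f (x - - z)) \<in> elems X" "nrm X (\<lambda>x. f (x - - z)) \<le> D * nrm X f"
        using D(2)[OF f, of "- z"] by auto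
      have "(\<integral>\<^sup>+x. (ennreal \<bar>f x\<bar> * indicator (ball a r) x) * (ennreal (heat_kernel t z) * ennreal \<bar>h (x - z)\<bar>) \<partial>lebesgue)
         = (\<integral>\<^sup>+x. ennreal (heat_kernel t z) * ((ennreal \<bar>f x\<bar> * indicator (ball a r) x) * ennreal \<bar>h (x - z)\<bar>) \<partial>lebesgue)"
        by (simp add: mult_ac)
      also have "\<dots> = ennreal (heat_kernel t z) * (\<integral>\<^sup>+x. (ennreal \<bar>f x\<bar> * indicator (ball a r) x) * ennreal \<bar>h (x - z)\<bar> \<partial>lebesgue)"
        by (rule nn_integral_cmult) measurable
      \<comment> \<open>The shift of x by z frees h from its translation; f is translated by -z
        instead, and the ball gets the centre a - z.\<close>
      also have "(\<integral>\<^sup>+x. (ennreal \<bar>f x\<bar> * indicator (ball a r) x) * ennreal \<bar>h (x - z)\<bar> \<partial>lebesgue)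
         = (\<integral>\<^sup>+x. (ennreal \<bar>f (z + 1 *\<^sub>R x)\<bar> * indicator (ball a r) (z + 1 *\<^sub>R x)) * ennreal \<bar>h (z + 1 *\<^sub>R x - z)\<bar> \<partial>lebesgue)"
        by (subst nn_integral_affine_lebesgue[where t=z and c=1]) (measurable, auto)
      also have "\<dots> = (\<integral>\<^sup>+x. ennreal \<bar>f (x - - z) * cut (a - z) r h x\<bar> \<partial>lebesgue)"
        by (intro nn_integral_cong)
           (auto simp: cut_def indicator_def abs_mult ennreal_mult add.commute dist_norm algebra_simps)
      also have "\<dots> \<le> ennreal (m * r powr - e * nrm X (\<lambda>x. f (x - - z)))"
        by (rule koethe_boundD(3)[OF morrey_boundD(3)[OF hb r] sh(1)])
      also have "\<dots> \<le> ennreal (m * r powr - e * (D * nrm X f))"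
        using sh(2) morrey_boundD(2)[OF g] by (intro ennreal_leI mult_left_mono) auto
      finally show "(\<integral>\<^sup>+x. (ennreal \<bar>f x\<bar> * indicator (ball a r) x) * (ennreal (heat_kernel t z) * ennreal \<bar>h (x - z)\<bar>) \<partial>lebesgue)
         \<le> ennreal (heat_kernel t z) * ennreal (m * r powr - e * (D * nrm X f))"
        by (simp add: mult_left_mono)
    qed
    also have "\<dots> = (\<integral>\<^sup>+z. ennreal (heat_kernel t (z :: real ^ 'n)) \<partial>lebesgue) * ennreal (m * r powr - e * (D * nrm X f))"
      by (rule nn_integral_multc) measurable
    also have "\<dots> \<le> ennreal E * ennreal (m * r powr - e * (D * nrm X f))"
      by (intro mult_right_mono E(2)[OF t]) auto
    also have "\<dots> = ennreal (E * D * m * r powr - e * nrm X f)"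
      using E(1) D(1) morrey_boundD(2)[OF g] class_H_norm_nonneg[OF H f]
      by (simp add: ennreal_mult[symmetric] mult_ac)
    finally show "abs_pairing f (cut a r (heat t g))
      \<le> ennreal (E * D * m * r powr - e * nrm X f)" .
  qed
  then show thesis using D(1) E(1) that[of "E * D"] by simp
qed

definition heat_koethe_interp :: "('n::finite) fspace \<Rightarrow> 'n fspace \<Rightarrow> real \<Rightarrow> real \<Rightarrow> real \<Rightarrow> bool" where
  "heat_koethe_interp X0 Xi e \<theta> C \<longleftrightarrow> C > 0 \<and>
     (\<forall>g m t a r. morrey_bound X0 e g m \<longrightarrow> m > 0 \<longrightarrow> t > 0 \<longrightarrow> r > 0 \<longrightarrow>
       koethe_bound Xi (cut a r (heat t g)) (C * (m * t powr (- 2 * (1 - \<theta>)) * (r powr - e) powr \<theta>)))"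

text \<open>Interpolate between \<alpha> = D m t^-2 and \<beta> = E m r^-e. The condition on e is
  what makes the sup bound decay like t^-2, and m^(1-\<theta>) m^\<theta> = m keeps the estimate
  linear in m.\<close>

lemma heat_interp_bound:
  fixes X0 Xi :: "('n::finite) fspace"
  assumes H0: "class_H X0" and interp: "koethe_interp X0 Xi \<theta> C1"
    and e: "e + sigma X0 + real CARD('n) = 4"
  shows "\<exists>C. heat_koethe_interp X0 Xi e \<theta> C"
proof -
  obtain D where D: "D > 0" "\<And>g m t x. morrey_bound X0 e g m \<Longrightarrow> t > 0 \<Longrightarrow>
    heat_abs t g x \<le> ennreal (D * m * t powr (- (e + sigma X0 + real CARD('n)) / 2))"
    using heat_abs_sup_bound[OF H0] by blast
  obtain E where E: "E > 0" "\<And>e g m t a r. morrey_bound X0 e g m \<Longrightarrow> t > 0 \<Longrightarrow> r > 0 \<Longrightarrow>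
    koethe_bound X0 (cut a r (heat t g)) (E * m * r powr - e)"
    using heat_koethe_bound[OF H0] by blast
  let ?C = "C1 * (D powr (1 - \<theta>) * E powr \<theta>)"
  have "koethe_bound Xi (cut a r (heat t g)) (?C * (m * t powr (- 2 * (1 - \<theta>)) * (r powr - e) powr \<theta>))"
    if g: "morrey_bound X0 e g m" and m: "m > 0" and t: "t > 0" and r: "r > 0" for g m t a r
  proof -
    let ?\<alpha> = "D * m * t powr - 2" and ?\<beta> = "E * m * r powr - e"
    have "\<bar>heat t g x\<bar> \<le> ?\<alpha>" for x
    proof -
      have "ennreal \<bar>heat t g x\<bar> \<le> ennreal ?\<alpha>"
        using order_trans[OF heat_le_heat_abs D(2)[OF g t]] by (simp add: e)
      then show ?thesis using D(1) m by simp
    qed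
    then have sup: "\<bar>cut a r (heat t g) x\<bar> \<le> ?\<alpha>" for x
      using D(1) m by (auto simp: cut_def indicator_def)
    have "koethe_bound Xi (cut a r (heat t g)) (C1 * (?\<alpha> powr (1 - \<theta>) * ?\<beta> powr \<theta>))"
      using interp D(1) E(1) m t r sup E(2)[OF g t r, of a] unfolding koethe_interp_def by simp
    moreover have "?\<alpha> powr (1 - \<theta>) * ?\<beta> powr \<theta>
       = (D powr (1 - \<theta>) * E powr \<theta>) * ((m powr (1 - \<theta>) * m powr \<theta>) * (t powr - 2) powr (1 - \<theta>) * (r powr - e) powr \<theta>)"
      using D(1) E(1) m t r by (simp only: powr_mult mult_ac)
    moreover have "m powr (1 - \<theta>) * m powr \<theta> = m" using m by (simp flip: powr_add)
    moreover have "(t powr - 2) powr (1 - \<theta>) = t powr (- 2 * (1 - \<theta>))" by (simp only: powr_powr)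
    ultimately show ?thesis by (simp add: mult.assoc)
  qed
  moreover have "?C > 0" using interp D(1) E(1) by (simp add: koethe_interp_def)
  ultimately show ?thesis unfolding heat_koethe_interp_def by blast
qed

lemma heat_diff:
  assumes "g \<in> borel_measurable lebesgue" "h \<in> borel_measurable lebesgue"
    and "heat_abs t g x < \<infinity>" "heat_abs t h x < \<infinity>"
  shows "heat t (\<lambda>y. g y - h y) x = heat t g x - heat t h x"
  unfolding heat_def right_diff_distrib using assms by (intro Bochner_Integration.integral_diff heat_abs_finite_integrable)

section \<open>Morrey and block spaces\<close>

text \<open>The undifferentiated function is the summand of the empty list in
  \<open>schwartz_norm\<close>; all other summands are nonnegative.\<close>

lemma schwartz_pointwise_bound:
  assumes f: "f \<in> schwartz"
  shows "(1 + norm x) ^ k * \<bar>f x\<bar> \<le> schwartz_norm k (f :: real ^ 'n::finite \<Rightarrow> real)"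
proof -
  let ?g = "\<lambda>is x. (1 + norm x) ^ k * \<bar>foldr partial is f x\<bar>"
  have bdd: "bdd_above (range (?g is))" for "is"
  proof -
    have "bounded (range (\<lambda>x. (1 + norm x) ^ k * foldr partial is f x))"
      using f by (simp add: schwartz_def)
    then obtain B where "\<And>x. norm ((1 + norm x) ^ k * foldr partial is f x) \<le> B"
      unfolding bounded_iff by blast
    then show ?thesis by (intro bdd_aboveI2[of _ _ B]) (simp add: abs_mult)
  qed
  have fin: "finite {is :: 'n list. length is \<le> k}"
    using finite_lists_length_le[of "UNIV :: 'n set" k] by simp
  have "(1 + norm x) ^ k * \<bar>f x\<bar> = ?g [] x" by simp
  also have "\<dots> \<le> (SUP x. ?g [] x)" by (rule cSUP_upper[OF _ bdd]) simp
  also have "\<dots> \<le> schwartz_norm k f"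
    unfolding schwartz_norm_def
  proof (rule member_le_sum[OF _ _ fin])
    fix "is" :: "'n list"
    have "0 \<le> ?g is 0" by simp
    also have "\<dots> \<le> (SUP x. ?g is x)" by (rule cSUP_upper[OF _ bdd]) simp
    finally show "0 \<le> (SUP x. ?g is x)" .
  qed simp
  finally show ?thesis .
qed

lemma schwartz_measurable:
  assumes "f \<in> schwartz" shows "f \<in> borel_measurable lebesgue"
proof -
  have "\<forall>is x. foldr partial is f differentiable (at x)" using assms by (simp add: schwartz_def smooth_def)
  then have "\<forall>x. foldr partial [] f differentiable (at x)" by blast
  then have "continuous_on UNIV f"
    by (intro continuous_at_imp_continuous_on) (simp add: differentiable_imp_continuous_within)
  then have "f \<in> borel_measurable borel" by (rule borel_measurable_continuous_onI)
  then show ?thesis by (intro measurable_completion) simp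
qed

text \<open>Shells of width 1 around the origin: the mass grows at most like a power of the radius,
  which a weight of sufficiently high degree makes summable.\<close>

lemma morrey_bound_weighted_L1:
  fixes X :: "('n::finite) fspace"
  assumes H: "class_H X" and w: "morrey_bound X e w m"
  obtains k :: nat where "integrable lebesgue (\<lambda>x. \<bar>w x\<bar> / (1 + norm x) ^ k)"
proof -
  define p where "p = - e - sigma X"
  obtain C where C: "C > 0" "\<And>e g m a r. morrey_bound X e g m \<Longrightarrow> r > 0 \<Longrightarrow>
    (\<integral>\<^sup>+y. ennreal \<bar>g y\<bar> * indicator (ball a r) y \<partial>lebesgue) \<le> ennreal (C * m * r powr (- e - sigma X))"
    using morrey_bound_L1[OF H] by blast
  \<comment> \<open>The surplus 2 in the degree leaves a multiple of the convergent series of 1 / (j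
    + 1)^2.\<close>
  define k where "k = nat \<lceil>p + 2\<rceil>"
  have k: "p - real k \<le> - 2" unfolding k_def by linarith
  note wm [measurable] = morrey_boundD(1)[OF w]
  have [measurable]: "(\<lambda>y. y) \<in> borel_measurable (lebesgue :: (real ^ 'n) measure)"
    by (rule ident_borel_lebesgue)
  let ?c = "\<lambda>j. 1 / (1 + real j) ^ k"
  have Cm: "0 \<le> C * m" using C(1) morrey_boundD(2)[OF w] by simp
  have "(\<integral>\<^sup>+y. ennreal (\<bar>w y\<bar> / (1 + norm y) ^ k) \<partial>lebesgue)
     = (\<integral>\<^sup>+y. ennreal (1 / (1 + norm y) ^ k) * ennreal \<bar>w y\<bar> \<partial>lebesgue)"
    by (simp add: ennreal_mult[symmetric])
  also have "\<dots> \<le> (\<Sum>j. ennreal (?c j * (C * m * ((real j + 1) * 1) powr p)))"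
    unfolding p_def
    by (rule nn_integral_le_shells[where x = 0, OF _ Cm _ _ _ C(2)[OF w]])
       (auto intro!: divide_left_mono power_mono mult_pos_pos zero_less_power simp: add_pos_nonneg)
  also have "\<dots> \<le> (\<Sum>j. ennreal (C * m * (1 / (real (Suc j))\<^sup>2)))"
  proof (intro suminf_le ennreal_leI)
    fix j
    have "?c j * (real j + 1) powr p = (real j + 1) powr (p - real k)"
      by (simp add: powr_diff powr_realpow add.commute)
    also have "\<dots> \<le> (real j + 1) powr - 2" using k by (intro powr_mono) auto
    also have "\<dots> = 1 / (real (Suc j))\<^sup>2" by (simp add: powr_minus powr_numeral divide_inverse add.commute)
    finally have "C * m * (?c j * (real j + 1) powr p) \<le> C * m * (1 / (real (Suc j))\<^sup>2)"
      using Cm by (rule mult_left_mono)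
    then show "?c j * (C * m * ((real j + 1) * 1) powr p) \<le> C * m * (1 / (real (Suc j))\<^sup>2)"
      by (simp only: mult_1_right mult.left_commute)
  qed auto
  also have "\<dots> = ennreal (\<Sum>j. C * m * (1 / (real (Suc j))\<^sup>2))"
  proof (intro suminf_ennreal2 summable_mult)
    have "summable (\<lambda>j. 1 / (real j)\<^sup>2)"
      using inverse_power_summable[of 2, where 'a=real] by (simp add: field_simps)
    then show "summable (\<lambda>j. 1 / (real (Suc j))\<^sup>2)" by (subst summable_Suc_iff)
  qed (use C(1) morrey_boundD(2)[OF w] in auto)
  also have "\<dots> < \<infinity>" by simp
  finally have "(\<integral>\<^sup>+y. ennreal (\<bar>w y\<bar> / (1 + norm y) ^ k) \<partial>lebesgue) < \<infinity>" .
  then have "integrable lebesgue (\<lambda>x. \<bar>w x\<bar> / (1 + norm x) ^ k)"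
    by (intro integrableI_nonneg) auto
  with that show thesis by blast
qed

text \<open>Membership in \<open>morrey\<close> includes being tempered. The weighted integral
  provides it: |f w| is at most a Schwartz norm of f times an integrable function that does not
  depend on f.\<close>

lemma morrey_bound_tempered:
  fixes X :: "('n::finite) fspace"
  assumes H: "class_H X" and w: "morrey_bound X e w m"
  shows "w \<in> tempered_functions"
proof -
  note [measurable] = morrey_boundD(1)[OF w]
  obtain k :: nat where int: "integrable lebesgue (\<lambda>x. \<bar>w x\<bar> / (1 + norm x) ^ k)"
    using morrey_bound_weighted_L1[OF H w] by blast
  have L1: "w \<in> L1loc"
    unfolding L1loc_def
  proof (intro CollectI conjI allI impI)
    fix S :: "(real ^ 'n) set" assume S: "compact S"
    then obtain B where B: "B > 0" "\<And>x. x \<in> S \<Longrightarrow> norm x \<le> B"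
      using compact_imp_bounded bounded_pos by metis
    have Sm: "S \<in> sets lebesgue" using S by (simp add: borel_compact)
    show "set_integrable lebesgue S w"
      unfolding set_integrable_def
    proof (rule Bochner_Integration.integrable_bound)
      show "integrable lebesgue (\<lambda>x. (1 + B) ^ k * (\<bar>w x\<bar> / (1 + norm x) ^ k))"
        using int by (rule integrable_mult_right)
      show "(\<lambda>x. indicator S x *\<^sub>R w x) \<in> borel_measurable lebesgue"
        using Sm by (intro borel_measurable_scaleR borel_measurable_indicator) auto
      show "AE x in lebesgue. norm (indicator S x *\<^sub>R w x) \<le> norm ((1 + B) ^ k * (\<bar>w x\<bar> / (1 + norm x) ^ k))"
      proof (rule AE_I2)
        fix x
        show "norm (indicator S x *\<^sub>R w x) \<le> norm ((1 + B) ^ k * (\<bar>w x\<bar> / (1 + norm x) ^ k))"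
        proof (cases "x \<in> S")
          case True
          have pos: "(1 + norm x) ^ k > 0" by (intro zero_less_power) (simp add: add_pos_nonneg)
          have "(1 + norm x) ^ k \<le> (1 + B) ^ k" using B(2)[OF True] by (intro power_mono) auto
          then have "\<bar>w x\<bar> * (1 + norm x) ^ k \<le> (1 + B) ^ k * \<bar>w x\<bar>"
            by (simp add: mult.commute mult_left_mono)
          then have "\<bar>w x\<bar> \<le> (1 + B) ^ k * \<bar>w x\<bar> / (1 + norm x) ^ k"
            using pos by (simp add: pos_le_divide_eq)
          also have "\<dots> \<le> norm ((1 + B) ^ k * (\<bar>w x\<bar> / (1 + norm x) ^ k))"
            unfolding real_norm_def times_divide_eq_right by (rule abs_ge_self)
          finally show ?thesis using True by simp
        qed simp
      qed
    qed
  qed simp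
  define B where "B = (\<integral>x. \<bar>w x\<bar> / (1 + norm x) ^ k \<partial>lebesgue)"
  have le: "\<bar>f x * w x\<bar> \<le> schwartz_norm k f * (\<bar>w x\<bar> / (1 + norm x) ^ k)" if f: "f \<in> schwartz" for f x
  proof -
    have pos: "(1 + norm x) ^ k > 0" by (intro zero_less_power) (simp add: add_pos_nonneg)
    have "\<bar>f x * w x\<bar> * (1 + norm x) ^ k = ((1 + norm x) ^ k * \<bar>f x\<bar>) * \<bar>w x\<bar>"
      by (simp add: abs_mult)
    also have "\<dots> \<le> schwartz_norm k f * \<bar>w x\<bar>" by (intro mult_right_mono schwartz_pointwise_bound[OF f]) auto
    finally show ?thesis using pos by (simp add: pos_le_divide_eq)
  qed
  have fint: "integrable lebesgue (\<lambda>x. f x * w x)" if f: "f \<in> schwartz" for f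
  proof (rule Bochner_Integration.integrable_bound)
    have [measurable]: "f \<in> borel_measurable lebesgue" by (rule schwartz_measurable[OF f])
    show "(\<lambda>x. f x * w x) \<in> borel_measurable lebesgue" by measurable
    show "integrable lebesgue (\<lambda>x. schwartz_norm k f * (\<bar>w x\<bar> / (1 + norm x) ^ k))"
      using int by (rule integrable_mult_right)
    show "AE x in lebesgue. norm (f x * w x) \<le> norm (schwartz_norm k f * (\<bar>w x\<bar> / (1 + norm x) ^ k))"
      using order_trans[OF le[OF f] abs_ge_self] by simp
  qed
  have "tempered_distribution (pairing w)"
    unfolding tempered_distribution_def
  proof (intro conjI ballI allI exI)
    fix f g :: "real ^ 'n \<Rightarrow> real" and a b :: real assume f: "f \<in> schwartz" and g: "g \<in> schwartz"
    show "pairing w (\<lambda>x. a * f x + b * g x) = a * pairing w f + b * pairing w g"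
      using fint[OF f] fint[OF g] by (simp add: pairing_def algebra_simps)
  next
    fix f :: "real ^ 'n \<Rightarrow> real" assume f: "f \<in> schwartz"
    have "\<bar>pairing w f\<bar> \<le> (\<integral>x. \<bar>f x * w x\<bar> \<partial>lebesgue)"
      unfolding pairing_def by (rule integral_abs_bound)
    also have "\<dots> \<le> (\<integral>x. schwartz_norm k f * (\<bar>w x\<bar> / (1 + norm x) ^ k) \<partial>lebesgue)"
      by (intro integral_mono integrable_abs fint[OF f] integrable_mult_right int le[OF f])
    also have "\<dots> = schwartz_norm k f * B" unfolding B_def by (rule integral_mult_right_zero)
    finally show "\<bar>pairing w f\<bar> \<le> B * schwartz_norm k f" by (simp add: mult.commute)
  qed
  with L1 show ?thesis unfolding tempered_functions_def by blast
qed

text \<open>This direction keeps the constant m; the converse below loses the constant of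
  \<open>fdual_koethe_bound\<close>.\<close>

lemma morrey_bound_imp_morrey:
  fixes X :: "('n::finite) fspace"
  assumes H: "class_H X" and w: "morrey_bound X (real CARD('n) / l + sigma (fdual X)) w m"
  shows "w \<in> elems (morrey (fdual X) l)" "nrm (morrey (fdual X) l) w \<le> m"
proof -
  let ?e = "real CARD('n) / l + sigma (fdual X)"
  let ?V = "{\<rho> powr ?e * nrm (fdual X) (cut x \<rho> w) | x \<rho>. \<rho> > 0}"
  note k = koethe_bound_fdual[OF class_H_banach[OF H] morrey_boundD(3)[OF w]]
  have le: "y \<le> m" if "y \<in> ?V" for y
  proof -
    from that obtain x \<rho> where y: "y = \<rho> powr ?e * nrm (fdual X) (cut x \<rho> w)" "\<rho> > 0" by auto
    have "y \<le> \<rho> powr ?e * (m * \<rho> powr - ?e)" unfolding y(1) by (intro mult_left_mono k(2) y(2)) auto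
    also have "\<dots> = m * (\<rho> powr ?e * \<rho> powr - ?e)" by (simp only: mult_ac)
    also have "\<dots> = m" using y(2) by (simp flip: powr_add)
    finally show ?thesis .
  qed
  then have "bdd_above ?V" by (rule bdd_aboveI)
  then show "w \<in> elems (morrey (fdual X) l)"
    using k(1) morrey_bound_tempered[OF H w] by (simp add: morrey_def)
  have "Sup ?V \<le> m"
    using le zero_less_one by (intro cSup_least) blast+
  then show "nrm (morrey (fdual X) l) w \<le> m" by (simp add: morrey_def)
qed

lemma morrey_imp_morrey_bound:
  fixes X :: "('n::finite) fspace"
  assumes H: "class_H X"
  obtains C where "C > 0" "\<And>w. w \<in> elems (morrey (fdual X) l) \<Longrightarrow> 0 \<le> nrm (morrey (fdual X) l) w \<and>
    morrey_bound X (real CARD('n) / l + sigma (fdual X)) w (C * nrm (morrey (fdual X) l) w)"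
proof -
  let ?e = "real CARD('n) / l + sigma (fdual X)"
  obtain C where C: "C > 0" "\<And>g. g \<in> elems (fdual X) \<Longrightarrow> koethe_bound X g (C * nrm (fdual X) g)"
    using fdual_koethe_bound[OF H] by blast
  have "0 \<le> nrm (morrey (fdual X) l) w \<and> morrey_bound X ?e w (C * nrm (morrey (fdual X) l) w)"
    if w: "w \<in> elems (morrey (fdual X) l)" for w
  proof -
    let ?V = "{\<rho> powr ?e * nrm (fdual X) (cut x \<rho> w) | x \<rho>. \<rho> > 0}"
    have bdd: "bdd_above ?V" and el: "\<And>x \<rho>. \<rho> > 0 \<Longrightarrow> cut x \<rho> w \<in> elems (fdual X)"
      and wm: "w \<in> borel_measurable lebesgue"
      using w by (auto simp: morrey_def tempered_functions_def L1loc_def)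
    have nrm: "nrm (morrey (fdual X) l) w = Sup ?V" by (simp add: morrey_def)
    have up: "\<rho> powr ?e * nrm (fdual X) (cut x \<rho> w) \<le> Sup ?V" if "\<rho> > 0" for x \<rho>
      using that by (intro cSup_upper bdd) auto
    have "0 \<le> 1 powr ?e * nrm (fdual X) (cut 0 1 w)"
      using fdual_norm_nonneg[OF class_H_banach[OF H] el[of 1 0]] by simp
    also have "\<dots> \<le> Sup ?V" by (rule up) simp
    finally have nn: "0 \<le> Sup ?V" .
    have "koethe_bound X (cut a r w) (C * Sup ?V * r powr - ?e)" if r: "r > 0" for a r
    proof (rule koethe_bound_mono[OF class_H_banach[OF H] C(2)[OF el[OF r]] cut_measurable[OF wm]])
      have "nrm (fdual X) (cut a r w) = r powr - ?e * (r powr ?e * nrm (fdual X) (cut a r w))"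
        using r by (simp add: mult.assoc[symmetric] flip: powr_add)
      also have "\<dots> \<le> r powr - ?e * Sup ?V" by (intro mult_left_mono up r) auto
      finally show "C * nrm (fdual X) (cut a r w) \<le> C * Sup ?V * r powr - ?e"
        using C(1) by (simp add: mult_ac)
    qed auto
    then show ?thesis using nn wm C(1) by (auto simp: morrey_bound_def nrm)
  qed
  with C(1) that show thesis by blast
qed

lemma morrey_diff:
  fixes X :: "('n::finite) fspace"
  assumes H: "class_H X" and f: "f \<in> elems (morrey (fdual X) l)" and g: "g \<in> elems (morrey (fdual X) l)"
  shows "(\<lambda>x. f x - g x) \<in> elems (morrey (fdual X) l)"
proof -
  note X = class_H_banach[OF H]
  obtain C where C: "\<And>w. w \<in> elems (morrey (fdual X) l) \<Longrightarrow> 0 \<le> nrm (morrey (fdual X) l) w \<and>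
    morrey_bound X (real CARD('n) / l + sigma (fdual X)) w (C * nrm (morrey (fdual X) l) w)"
    using morrey_imp_morrey_bound[OF H] by metis
  have "morrey_bound X (real CARD('n) / l + sigma (fdual X)) (\<lambda>x. f x + (-1) * g x)
     (C * nrm (morrey (fdual X) l) f + \<bar>-1\<bar> * (C * nrm (morrey (fdual X) l) g))"
    using C[OF f] C[OF g] by (intro morrey_bound_add[OF X] morrey_bound_cmult[OF X]) auto
  from morrey_bound_imp_morrey(1)[OF H this] show ?thesis by simp
qed

section \<open>Blocks as test functions\<close>

text \<open>One decomposition of h is fixed and A is the sum of its absolute coefficients, so the
  same A serves every weight G. Pointwise, |h| is at most the sum of |\<alpha> k| |b k|, which
  reduces weighted integrals of h to single blocks.\<close>

lemma block_space_nn_integral: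
  assumes h: "h \<in> elems (block_space X l)"
  obtains A where "A \<ge> 0" "\<And>G B. G \<in> borel_measurable lebesgue \<Longrightarrow>
    (\<And>b. is_block X l b \<Longrightarrow> (\<integral>\<^sup>+x. ennreal \<bar>b x\<bar> * G x \<partial>lebesgue) \<le> B) \<Longrightarrow>
    (\<integral>\<^sup>+x. ennreal \<bar>h x\<bar> * G x \<partial>lebesgue) \<le> ennreal A * B"
proof -
  obtain \<alpha> b where al: "summable (\<lambda>k. \<bar>\<alpha> k\<bar>)" and b: "\<And>k::nat. is_block X l (b k)"
    and sums: "AE x in lebesgue. (\<lambda>k. \<alpha> k * b k x) sums h x"
    using h unfolding block_space_def block_decomposition_def by auto
  have bm: "b k \<in> borel_measurable lebesgue" for k using b[of k] by (simp add: is_block_def)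
  show thesis
  proof (rule that[of "\<Sum>k. \<bar>\<alpha> k\<bar>"])
    show "0 \<le> (\<Sum>k. \<bar>\<alpha> k\<bar>)" by (rule suminf_nonneg[OF al]) simp
    fix G B assume G: "G \<in> borel_measurable lebesgue"
      and bd: "\<And>b. is_block X l b \<Longrightarrow> (\<integral>\<^sup>+x. ennreal \<bar>b x\<bar> * G x \<partial>lebesgue) \<le> B"
    have m: "(\<lambda>x. ennreal \<bar>b k x\<bar> * G x) \<in> borel_measurable lebesgue" for k
      using bm[of k] G by measurable
    have "(\<integral>\<^sup>+x. ennreal \<bar>h x\<bar> * G x \<partial>lebesgue)
       \<le> (\<integral>\<^sup>+x. (\<Sum>k. ennreal \<bar>\<alpha> k\<bar> * (ennreal \<bar>b k x\<bar> * G x)) \<partial>lebesgue)"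
    proof (rule nn_integral_mono_AE)
      show "AE x in lebesgue. ennreal \<bar>h x\<bar> * G x \<le> (\<Sum>k. ennreal \<bar>\<alpha> k\<bar> * (ennreal \<bar>b k x\<bar> * G x))"
        using sums
      proof (rule AE_mp, intro AE_I2 impI)
        fix x assume s: "(\<lambda>k. \<alpha> k * b k x) sums h x"
        have "(\<lambda>n. ennreal \<bar>\<Sum>k<n. \<alpha> k * b k x\<bar>) \<longlonglongrightarrow> ennreal \<bar>h x\<bar>"
          using s unfolding sums_def by (intro tendsto_ennrealI tendsto_rabs)
        then have "ennreal \<bar>h x\<bar> \<le> (\<Sum>k. ennreal \<bar>\<alpha> k * b k x\<bar>)"
        proof (rule LIMSEQ_le_const2, intro exI allI impI)
          fix n :: nat
          have "ennreal \<bar>\<Sum>k<n. \<alpha> k * b k x\<bar> \<le> ennreal (\<Sum>k<n. \<bar>\<alpha> k * b k x\<bar>)"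
            by (intro ennreal_leI sum_abs)
          also have "\<dots> = (\<Sum>k<n. ennreal \<bar>\<alpha> k * b k x\<bar>)" by (rule sum_ennreal[symmetric]) simp
          also have "\<dots> \<le> (\<Sum>k. ennreal \<bar>\<alpha> k * b k x\<bar>)" by (rule sum_le_suminf) auto
          finally show "ennreal \<bar>\<Sum>k<n. \<alpha> k * b k x\<bar> \<le> (\<Sum>k. ennreal \<bar>\<alpha> k * b k x\<bar>)" .
        qed
        then have "ennreal \<bar>h x\<bar> * G x \<le> (\<Sum>k. ennreal \<bar>\<alpha> k * b k x\<bar>) * G x" by (rule mult_right_mono) simp
        also have "\<dots> = (\<Sum>k. ennreal \<bar>\<alpha> k * b k x\<bar> * G x)" by simp
        also have "\<dots> = (\<Sum>k. ennreal \<bar>\<alpha> k\<bar> * (ennreal \<bar>b k x\<bar> * G x))"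
          by (simp add: abs_mult ennreal_mult mult.assoc)
        finally show "ennreal \<bar>h x\<bar> * G x \<le> (\<Sum>k. ennreal \<bar>\<alpha> k\<bar> * (ennreal \<bar>b k x\<bar> * G x))" .
      qed
    qed
    also have "\<dots> = (\<Sum>k. \<integral>\<^sup>+x. ennreal \<bar>\<alpha> k\<bar> * (ennreal \<bar>b k x\<bar> * G x) \<partial>lebesgue)"
      using m by (intro nn_integral_suminf) auto
    also have "\<dots> = (\<Sum>k. ennreal \<bar>\<alpha> k\<bar> * (\<integral>\<^sup>+x. ennreal \<bar>b k x\<bar> * G x \<partial>lebesgue))"
      using m by (intro suminf_cong nn_integral_cmult) auto
    also have "\<dots> \<le> (\<Sum>k. ennreal \<bar>\<alpha> k\<bar> * B)"
      by (intro suminf_le mult_left_mono bd b) auto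
    also have "\<dots> = (\<Sum>k. ennreal \<bar>\<alpha> k\<bar>) * B" by simp
    also have "\<dots> = ennreal (\<Sum>k. \<bar>\<alpha> k\<bar>) * B" using al by (subst suminf_ennreal2) auto
    finally show "(\<integral>\<^sup>+x. ennreal \<bar>h x\<bar> * G x \<partial>lebesgue) \<le> ennreal (\<Sum>k. \<bar>\<alpha> k\<bar>) * B" .
  qed
qed

text \<open>The power r^q in the bound is the one that normalises blocks, so the radius drops
  out.\<close>

lemma block_nn_integral:
  fixes X :: "('n::finite) fspace"
  assumes b: "is_block X l b" and c: "0 \<le> c" and q: "q = real CARD('n) / l + sigma X"
    and bd: "\<And>f a r. f \<in> elems X \<Longrightarrow> r > 0 \<Longrightarrow>
      ball_pairing a r f G \<le> ennreal (c * r powr q * nrm X f)"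
  shows "(\<integral>\<^sup>+x. ennreal \<bar>b x\<bar> * G x \<partial>lebesgue) \<le> ennreal c"
proof -
  obtain a r where r: "r > 0" and ae: "AE x in lebesgue. x \<notin> ball a r \<longrightarrow> b x = 0"
    and el: "cut a r b \<in> elems X" and le: "r powr q * nrm X (cut a r b) \<le> 1"
    using b unfolding is_block_def q by blast
  have "(\<integral>\<^sup>+x. ennreal \<bar>b x\<bar> * G x \<partial>lebesgue)
      = (\<integral>\<^sup>+x. ennreal \<bar>cut a r b x\<bar> * indicator (ball a r) x * G x \<partial>lebesgue)"
    using ae by (intro nn_integral_cong_AE) (auto simp: cut_def indicator_def elim!: eventually_mono)
  also have "\<dots> \<le> ennreal (c * r powr q * nrm X (cut a r b))" by (rule bd[OF el r])
  also have "c * r powr q * nrm X (cut a r b) \<le> c * 1"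
    using mult_left_mono[OF le c] by (simp add: mult.assoc)
  finally show ?thesis by (simp add: ennreal_leI)
qed

lemma class_H_cut:
  fixes X :: "('n::finite) fspace"
  assumes H: "class_H X" and f: "f \<in> elems X"
  shows "cut a r f \<in> elems X"
proof -
  obtain C where "\<And>f g. f \<in> elems X \<Longrightarrow> g \<in> borel_measurable lebesgue \<Longrightarrow> (\<And>x. \<bar>g x\<bar> \<le> 1) \<Longrightarrow>
       (\<lambda>x. f x * g x) \<in> elems X \<and> nrm X (\<lambda>x. f x * g x) \<le> C * nrm X f"
    using class_H_mult_bounded[OF H] by blast
  moreover have "(indicator (ball a r) :: real ^ 'n \<Rightarrow> real) \<in> borel_measurable lebesgue"
    by (intro borel_measurable_indicator) auto
  moreover have "\<bar>indicator (ball a r) x\<bar> \<le> (1 :: real)" for x :: "real ^ 'n"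
    by (simp add: indicator_def)
  ultimately have "(\<lambda>x. f x * indicator (ball a r) x) \<in> elems X" using f by blast
  then show ?thesis by (simp only: cut_def mult.commute)
qed

text \<open>A cut-off element of X is a multiple of a single block.\<close>

lemma cut_in_block_space:
  fixes X :: "('n::finite) fspace"
  assumes H: "class_H X" and f: "f \<in> elems X" and r: "r > 0"
  shows "cut a r f \<in> elems (block_space X l)"
proof -
  note X = class_H_banach[OF H]
  let ?g = "cut a r f"
  have g: "?g \<in> elems X" by (rule class_H_cut[OF H f])
  have temp: "?g \<in> tempered_functions" using H g unfolding class_H_def class_G_def by blast
  define n where "n = r powr (real CARD('n) / l + sigma X) * nrm X ?g"
  have n: "n \<ge> 0" using banach_fspaceD(8)[OF X g] by (simp add: n_def)
  \<comment> \<open>n can be 0; dividing by n + 1 instead still makes b a block.\<close>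
  define b where "b = (\<lambda>x. 1 / (n + 1) * ?g x)"
  have b: "b \<in> elems X" "nrm X b = 1 / (n + 1) * nrm X ?g"
    using banach_fspaceD(6,7)[OF X g, of "1 / (n + 1)"] n by (auto simp: b_def)
  have cb: "cut a r b = b" by (auto simp: b_def cut_def indicator_def)
  have "r powr (real CARD('n) / l + sigma X) * nrm X b = n / (n + 1)"
    unfolding b(2) n_def by simp
  then have "r powr (real CARD('n) / l + sigma X) * nrm X b \<le> 1" using n by simp
  then have blk: "is_block X l b"
    unfolding is_block_def using b(1) r cb banach_fspaceD(1)[OF X b(1)]
    by (intro conjI exI[of _ a] exI[of _ r]) (auto simp: b_def cut_def)
  \<comment> \<open>Only the first coefficient is nonzero. The same b fills the other places, as a
    decomposition asks for a block at every index.\<close>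
  have "block_decomposition X l ?g (\<lambda>k. if k = 0 then n + 1 else 0)"
    unfolding block_decomposition_def
  proof (intro conjI exI[of _ "\<lambda>_. b"] allI AE_I2)
    show "summable (\<lambda>k::nat. \<bar>if k = 0 then n + 1 else 0\<bar>)"
      by (rule summable_finite[of "{0}"]) auto
    fix x
    have "(\<lambda>k::nat. if k = 0 then (n + 1) * b x else 0) sums ((n + 1) * b x)"
      using sums_If_finite_set[of "{0::nat}" "\<lambda>_. (n + 1) * b x"] by simp
    moreover have "(n + 1) * b x = ?g x" using n by (simp add: b_def)
    moreover have "(\<lambda>k::nat. if k = 0 then (n + 1) * b x else 0) = (\<lambda>k. (if k = 0 then n + 1 else 0) * b x)"
      by auto
    ultimately show "(\<lambda>k::nat. (if k = 0 then n + 1 else 0) * b x) sums ?g x" by simp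
  qed (fact blk)
  with temp show ?thesis by (auto simp: block_space_def)
qed

text \<open>The Morrey norm sees v only through pairings of \<open>cut a r v\<close> with f in X,
  and each of them is the pairing of v with \<open>cut a r f\<close>, an element of the block
  space.\<close>

lemma morrey_norm_cong:
  assumes H: "class_H X"
    and eq: "\<And>h. h \<in> elems (block_space X l') \<Longrightarrow> pairing v h = pairing w h"
  shows "nrm (morrey (fdual X) l) v = nrm (morrey (fdual X) l) w"
proof -
  have "nrm (fdual X) (cut a r v) = nrm (fdual X) (cut a r w)" if r: "r > 0" for a r
  proof -
    have "pairing (cut a r v) f = pairing (cut a r w) f" if f: "f \<in> elems X" for f
      using eq[OF cut_in_block_space[OF H f r, of a]] by (simp add: pairing_def cut_def mult_ac)
    then have "{\<bar>pairing (cut a r v) f\<bar> | f. f \<in> elems X \<and> nrm X f \<le> 1}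
      = {\<bar>pairing (cut a r w) f\<bar> | f. f \<in> elems X \<and> nrm X f \<le> 1}"
      by (intro Collect_cong) metis
    then show ?thesis by (simp add: fdual_norm dual_def)
  qed
  then have "{\<rho> powr p * nrm (fdual X) (cut x \<rho> v) | x \<rho>. \<rho> > 0}
     = {\<rho> powr p * nrm (fdual X) (cut x \<rho> w) | x \<rho>. \<rho> > 0}" for p
    by (intro Collect_cong) (metis (no_types, lifting))
  then show ?thesis by (simp add: morrey_def)
qed

text \<open>\<open>cut\<close> is multiplicative since an indicator is its own square, so the
  product inequality applies on each ball. Each factor contributes r^-e, hence the exponent 2
  e.\<close>

lemma morrey_bound_mult:
  fixes X X0 :: "('n::finite) fspace"
  assumes H: "class_H X" and H0: "class_H X0"
    and prod: "\<And>f g. f \<in> elems (fdual X) \<Longrightarrow> g \<in> elems (fdual X) \<Longrightarrow> (\<lambda>x. f x * g x) \<in> elems (fdual X0) \<and>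
           nrm (fdual X0) (\<lambda>x. f x * g x) \<le> C * nrm (fdual X) f * nrm (fdual X) g"
  obtains K where "K > 0" "\<And>e f g c d. morrey_bound X e f c \<Longrightarrow> morrey_bound X e g d \<Longrightarrow>
    morrey_bound X0 (2 * e) (\<lambda>x. f x * g x) (K * (c * d))"
proof -
  note X = class_H_banach[OF H] and X0 = class_H_banach[OF H0]
  obtain D where D: "D > 0" "\<And>g. g \<in> elems (fdual X0) \<Longrightarrow> koethe_bound X0 g (D * nrm (fdual X0) g)"
    using fdual_koethe_bound[OF H0] by blast
  let ?K = "D * (\<bar>C\<bar> + 1)"
  have "morrey_bound X0 (2 * e) (\<lambda>x. f x * g x) (?K * (c * d))"
    if f: "morrey_bound X e f c" and g: "morrey_bound X e g d" for e f g c d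
    unfolding morrey_bound_def
  proof (intro conjI allI impI)
    have [measurable]: "f \<in> borel_measurable lebesgue" "g \<in> borel_measurable lebesgue"
      using f g by (auto dest: morrey_boundD)
    show fgm: "(\<lambda>x. f x * g x) \<in> borel_measurable lebesgue" by measurable
    have cd: "0 \<le> c" "0 \<le> d" using f g by (auto dest: morrey_boundD)
    then show "0 \<le> ?K * (c * d)" using D(1) by simp
    fix a and r :: real assume r: "r > 0"
    note F = koethe_bound_fdual[OF X morrey_boundD(3)[OF f r, of a]]
    note G = koethe_bound_fdual[OF X morrey_boundD(3)[OF g r, of a]]
    note P = prod[OF F(1) G(1)]
    have eq: "(\<lambda>x. cut a r f x * cut a r g x) = cut a r (\<lambda>x. f x * g x)"
      by (auto simp: cut_def indicator_def)
    have nn: "0 \<le> nrm (fdual X) (cut a r f)" "0 \<le> nrm (fdual X) (cut a r g)"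
      using fdual_norm_nonneg[OF X F(1)] fdual_norm_nonneg[OF X G(1)] by auto
    have "nrm (fdual X0) (cut a r (\<lambda>x. f x * g x)) \<le> C * nrm (fdual X) (cut a r f) * nrm (fdual X) (cut a r g)"
      using P unfolding eq by simp
    also have "\<dots> \<le> (\<bar>C\<bar> + 1) * (c * r powr - e) * (d * r powr - e)"
      using F(2) G(2) nn cd by (intro mult_mono) auto
    also have "\<dots> = (\<bar>C\<bar> + 1) * (c * d) * (r powr - e * r powr - e)" by (simp add: mult_ac)
    also have "r powr - e * r powr - e = r powr - (2 * e)" by (simp flip: powr_add)
    finally have "D * nrm (fdual X0) (cut a r (\<lambda>x. f x * g x)) \<le> ?K * (c * d) * r powr - (2 * e)"
      using D(1) by (simp add: mult.assoc)
    moreover have "koethe_bound X0 (cut a r (\<lambda>x. f x * g x)) (D * nrm (fdual X0) (cut a r (\<lambda>x. f x * g x)))"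
      using P unfolding eq by (intro D(2)) auto
    ultimately show "koethe_bound X0 (cut a r (\<lambda>x. f x * g x)) (?K * (c * d) * r powr - (2 * e))"
      using koethe_bound_mono[OF X0] cut_measurable[OF fgm] by fastforce
  qed
  then show thesis using D(1) that[of ?K] by (simp add: add_nonneg_pos)
qed

section \<open>The weak integral\<close>

text \<open>Preimages of null sets under such maps are null. It carries statements about almost
  every s over to \<tau> = t - s.\<close>

lemma AE_lebesgue_affine:
  fixes t :: "'a::euclidean_space"
  assumes ae: "AE x in lebesgue. P x" and c: "c \<noteq> 0"
  shows "AE x in lebesgue. P (t + c *\<^sub>R x)"
proof -
  obtain N where N: "N \<in> null_sets lebesgue" "\<And>x. \<not> P x \<Longrightarrow> x \<in> N"
    using ae unfolding eventually_ae_filter by auto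
  have ind: "(indicator N :: 'a \<Rightarrow> ennreal) \<in> borel_measurable lebesgue" using N(1) by auto
  have "ennreal (\<bar>c\<bar> ^ DIM('a)) * (\<integral>\<^sup>+x. indicator N (t + c *\<^sub>R x) \<partial>lebesgue) = 0"
    using nn_integral_affine_lebesgue[OF ind c, of t] N(1) by (simp add: null_sets_def)
  then have "(\<integral>\<^sup>+x. (indicator N (t + c *\<^sub>R x) :: ennreal) \<partial>lebesgue) = 0" using c by simp
  then have "AE x in lebesgue. (indicator N (t + c *\<^sub>R x) :: ennreal) = 0"
    using measurable_compose[OF measurable_affine_lebesgue[OF c] ind] by (subst (asm) nn_integral_0_iff_AE) auto
  then show ?thesis using N(2) by (auto simp: indicator_def elim!: eventually_mono)
qed

text \<open>The first part, at a single time, lets U(t) g be paired with blocks for every t > 0, but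
  its factor 1 / t is not integrable. The second part is the time integral, for data that change
  with time under one common bound m.\<close>

definition heat_pairing_bound :: "('n::finite) fspace \<Rightarrow> 'n fspace \<Rightarrow> real \<Rightarrow> real \<Rightarrow> bool" where
  "heat_pairing_bound X X0 e C \<longleftrightarrow> C > 0 \<and>
    (\<forall>g m t a r. \<forall>f\<in>elems X. morrey_bound X0 e g m \<longrightarrow> m > 0 \<longrightarrow> t > 0 \<longrightarrow> r > 0 \<longrightarrow>
      ball_pairing a r f (\<lambda>x. ennreal \<bar>heat t g x\<bar>)
        \<le> ennreal (C * m / t * r powr - (e / 2) * nrm X f)) \<and>
    (\<forall>G m a r. \<forall>f\<in>elems X. (\<forall>t>0. morrey_bound X0 e (G t) m) \<longrightarrow> m > 0 \<longrightarrow> r > 0 \<longrightarrow>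
      (\<integral>\<^sup>+t\<in>{0<..}. ball_pairing a r f (\<lambda>x. ennreal \<bar>heat t (G t) x\<bar>) \<partial>lborel)
        \<le> ennreal (C * m * r powr - (e / 2) * nrm X f))"

text \<open>X embeds into the interpolation space, so the K-method integral applies with \<mu> =
  r^-e, and \<mu>^(1/2) = r^(-e/2).\<close>

lemma heat_time_integral:
  fixes X X0 X1 X2 :: "('n::finite) fspace" and \<theta> \<theta>1 \<theta>2 :: real
  assumes X: "banach_fspace X" and X1: "banach_fspace X1" and X2: "banach_fspace X2"
    and th: "0 < \<theta>" "\<theta> < 1" "\<theta>1 < \<theta>2" and half: "\<theta> * \<theta>2 + (1 - \<theta>) * \<theta>1 = 1 / 2"
    and emb: "embeds X (interp X1 X2 \<theta> 1)"
    and b1: "heat_koethe_interp X0 X1 e \<theta>1 C1" and b2: "heat_koethe_interp X0 X2 e \<theta>2 C2"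
  shows "\<exists>C. heat_pairing_bound X X0 e C"
proof -
  have C1: "C1 > 0" and C2: "C2 > 0" using b1 b2 by (auto simp: heat_koethe_interp_def)
  obtain D0 where D0: "elems X \<subseteq> elems (interp X1 X2 \<theta> 1)"
      "\<And>f. f \<in> elems X \<Longrightarrow> nrm (interp X1 X2 \<theta> 1) f \<le> D0 * nrm X f"
    using emb unfolding embeds_def by blast
  define D where "D = \<bar>D0\<bar> + 1"
  have D: "D > 0" by (simp add: D_def)
  have DN: "nrm (interp X1 X2 \<theta> 1) f \<le> D * nrm X f" if f: "f \<in> elems X" for f
    by (rule order_trans[OF D0(2)[OF f] mult_right_mono]) (use banach_fspaceD(8)[OF X f] in \<open>auto simp: D_def\<close>)
  define c where "c = C1 * (C2 / C1) powr \<theta>"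
  define k where "k = c / (2 * (\<theta>2 - \<theta>1))"
  have c: "c > 0" using C1 C2 by (simp add: c_def)
  have k: "k > 0" using c th by (simp add: k_def)
  have mu: "(r powr - e) powr (1 / 2) = r powr - (e / 2)" for r :: real
    by (simp add: powr_powr)
  have eq: "ball_pairing a r f (\<lambda>x. ennreal \<bar>g x\<bar>)
     = abs_pairing f (cut a r g)" for f g :: "real ^ 'n \<Rightarrow> real" and a r
    by (intro nn_integral_cong) (auto simp: cut_def indicator_def abs_mult ennreal_mult)
  have main: "(t > 0 \<longrightarrow> ball_pairing a r f (\<lambda>x. ennreal \<bar>heat t (G t) x\<bar>)
        \<le> ennreal ((c + k) * D * m / t * r powr - (e / 2) * nrm X f)) \<and>
      (\<integral>\<^sup>+t\<in>{0<..}. ball_pairing a r f (\<lambda>x. ennreal \<bar>heat t (G t) x\<bar>) \<partial>lborel)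
        \<le> ennreal ((c + k) * D * m * r powr - (e / 2) * nrm X f)"
    if G: "\<And>t. t > 0 \<Longrightarrow> morrey_bound X0 e (G t) m" and m: "m > 0" and r: "r > 0" and f: "f \<in> elems X"
    for G m a r f t
  proof -
    let ?N = "nrm (interp X1 X2 \<theta> 1) f"
    have fi: "f \<in> elems (interp X1 X2 \<theta> 1)" using D0(1) f by blast
    have mr: "r powr - e > 0" using r by simp
    have W1: "koethe_bound X1 (cut a r (heat \<tau> (G \<tau>))) (C1 * (m * \<tau> powr (- 2 * (1 - \<theta>1)) * (r powr - e) powr \<theta>1))"
      and W2: "koethe_bound X2 (cut a r (heat \<tau> (G \<tau>))) (C2 * (m * \<tau> powr (- 2 * (1 - \<theta>2)) * (r powr - e) powr \<theta>2))"
      if "\<tau> > 0" for \<tau>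
      using b1 b2 G[OF that] m r that by (auto simp: heat_koethe_interp_def)
    note I = interp_time_integral[OF X1 X2 th half fi C1 C2 m mr,
        where W = "\<lambda>t. cut a r (heat t (G t))", OF W1 W2, folded c_def, folded k_def, unfolded mu]
    have N: "0 \<le> ?N" by (rule I(1))
    \<comment> \<open>One constant has to serve both parts: x will be c at a fixed time and k for
      the time integral.\<close>
    have le: "x * (m * r powr - (e / 2) * ?N) \<le> (c + k) * D * m * r powr - (e / 2) * nrm X f"
      if x: "0 \<le> x" "x \<le> c + k" for x
    proof -
      have "x * (m * r powr - (e / 2) * ?N) \<le> (c + k) * (m * r powr - (e / 2) * (D * nrm X f))"
        using x m N DN[OF f] c k by (intro mult_mono) auto
      then show ?thesis by (simp add: mult_ac)
    qed
    show ?thesis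
    proof (intro conjI impI)
      assume t: "t > 0"
      have "c * (m * r powr - (e / 2) * ?N) / t \<le> ((c + k) * D * m * r powr - (e / 2) * nrm X f) / t"
        using le[of c] c k t by (intro divide_right_mono) auto
      also have "\<dots> = (c + k) * D * m / t * r powr - (e / 2) * nrm X f" by simp
      finally have le': "c * (m * r powr - (e / 2) * ?N) / t \<le> (c + k) * D * m / t * r powr - (e / 2) * nrm X f" .
      show "ball_pairing a r f (\<lambda>x. ennreal \<bar>heat t (G t) x\<bar>)
        \<le> ennreal ((c + k) * D * m / t * r powr - (e / 2) * nrm X f)"
        unfolding eq by (rule order_trans[OF I(2)[OF _ _ t] ennreal_leI[OF le']])
    next
      show "(\<integral>\<^sup>+t\<in>{0<..}. ball_pairing a r f (\<lambda>x. ennreal \<bar>heat t (G t) x\<bar>) \<partial>lborel)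
        \<le> ennreal ((c + k) * D * m * r powr - (e / 2) * nrm X f)"
        unfolding eq using k c by (intro order_trans[OF I(3) ennreal_leI[OF le]]) auto
    qed
  qed
  show ?thesis
    unfolding heat_pairing_bound_def
    apply (intro exI[of _ "(c + k) * D"] conjI allI ballI impI)
    subgoal using c k D by simp
    subgoal for g m t a r f using main[of "\<lambda>_. g" m r f t a] by blast
    subgoal for G m a r f using main[of G m r f 1 a] by blast
    done
qed

text \<open>The candidate w is the integral in s, at each x, of a jointly measurable version H of
  the integrand. Bounding the integral of absolute values opens Fubini against the whole block
  space. \<open>Fb\<close> is required at every s because the weak integral wants each pairing to be
  integrable, while the uniform bound \<open>Fm\<close> is available only almost everywhere.\<close>

lemma weak_heat_integral_exists:
  fixes X X0 :: "('n::finite) fspace" and H :: "real \<times> (real ^ 'n) \<Rightarrow> real"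
  assumes HX: "class_H X" and X0: "banach_fspace X0" and hb: "heat_pairing_bound X X0 e C"
    and n: "real CARD('n) > 2"
    and e: "e / 2 = 2 + sigma (fdual X)" and e': "- (e / 2) = real CARD('n) - 2 + sigma X"
    and Hm: "H \<in> borel_measurable (lebesgue \<Otimes>\<^sub>M lebesgue)"
    and Heq: "AE s in lebesgue. 0 < s \<and> s < t \<longrightarrow> (\<forall>x. H (s, x) = heat (t - s) (F s) x)"
    and Fb: "\<And>s. 0 < s \<Longrightarrow> s < t \<Longrightarrow> \<exists>m>0. morrey_bound X0 e (F s) m"
    and m: "m > 0" and Fm: "AE s in lebesgue. 0 < s \<and> s < t \<longrightarrow> morrey_bound X0 e (F s) m"
  obtains w where "morrey_bound X (e / 2) w (C * m)" "is_weak_heat_integral X F t w"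
proof -
  note X = class_H_banach[OF HX]
  have C: "C > 0" using hb by (simp add: heat_pairing_bound_def)
  let ?L = "lebesgue :: real measure" and ?V = "lebesgue :: (real ^ 'n) measure"
  interpret S: sigma_finite_measure ?L by (rule sigma_finite_lebesgue)
  interpret V: sigma_finite_measure ?V by (rule sigma_finite_lebesgue)
  interpret P: pair_sigma_finite ?L ?V ..
  define K where "K = (\<lambda>s x. indicator {0<..<t} s * H (s, x))"
  have Km: "(\<lambda>p. K (fst p) (snd p)) \<in> borel_measurable (?L \<Otimes>\<^sub>M ?V)"
  proof -
    have "(indicator {0<..<t} :: real \<Rightarrow> real) \<in> borel_measurable ?L"
      by (intro borel_measurable_indicator) auto
    from measurable_compose[OF measurable_fst this] Hm show ?thesis
      unfolding K_def by (auto intro!: borel_measurable_times)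
  qed
  have Km': "(\<lambda>p. K (snd p) (fst p)) \<in> borel_measurable (?V \<Otimes>\<^sub>M ?L)"
    using measurable_compose[OF measurable_pair_swap' Km] by (simp add: case_prod_beta)
  \<comment> \<open>G dominates |w| even where the integral defining w diverges and w is 0 by
    default, so all estimates can be made for G.\<close>
  define G where "G = (\<lambda>x. \<integral>\<^sup>+s. ennreal \<bar>K s x\<bar> \<partial>?L)"
  define w where "w = (\<lambda>x. \<integral>s. K s x \<partial>?L)"
  have Gm: "G \<in> borel_measurable ?V"
    unfolding G_def by (rule S.borel_measurable_nn_integral) (use Km' in \<open>simp add: case_prod_beta\<close>)
  have wm: "w \<in> borel_measurable ?V"
    unfolding w_def by (rule S.borel_measurable_lebesgue_integral) (use Km' in \<open>simp add: case_prod_beta\<close>)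
  have Ks: "K s \<in> borel_measurable ?V" for s
    using measurable_compose[OF measurable_Pair1' Km, of s] by simp
  have Kx: "(\<lambda>s. K s x) \<in> borel_measurable ?L" for x
    using measurable_compose[OF measurable_Pair2' Km, of x] by simp
  have wG: "ennreal \<bar>w x\<bar> \<le> G x" for x
  proof (cases "integrable ?L (\<lambda>s. K s x)")
    case True
    then show ?thesis using integral_norm_bound_ennreal[OF True] by (simp add: w_def G_def)
  next
    case False
    then show ?thesis by (simp add: w_def not_integrable_integral_eq)
  qed
  have GX: "ball_pairing a r f G
      \<le> ennreal (C * m * r powr - (e / 2) * nrm X f)" if f: "f \<in> elems X" and r: "r > 0" for f a r
  proof -
    have [measurable]: "f \<in> borel_measurable ?V" by (rule banach_fspaceD(1)[OF X f])
    define g where "g = (\<lambda>x. ennreal \<bar>f x\<bar> * indicator (ball a r) x)"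
    have gm: "g \<in> borel_measurable ?V"
      unfolding g_def by (intro borel_measurable_times_ennreal borel_measurable_indicator) auto
    have "(\<lambda>p. g (snd p) * ennreal \<bar>K (fst p) (snd p)\<bar>) \<in> borel_measurable (?L \<Otimes>\<^sub>M ?V)"
      using Km by (intro borel_measurable_times_ennreal measurable_compose[OF measurable_snd gm]) measurable
    then have gK: "(\<lambda>(s, x). g x * ennreal \<bar>K s x\<bar>) \<in> borel_measurable (?L \<Otimes>\<^sub>M ?V)"
      by (simp add: case_prod_beta)
    define \<phi> where "\<phi> = (\<lambda>s. \<integral>\<^sup>+x. g x * ennreal \<bar>K s x\<bar> \<partial>?V)"
    have \<phi>m: "\<phi> \<in> borel_measurable ?L"
      unfolding \<phi>_def by (rule V.borel_measurable_nn_integral) (rule gK)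
    \<comment> \<open>\<open>heat_pairing_bound\<close> wants the bound m at every time, so data
      violating it are replaced by 0. The argument is reversed because \<tau> = t - s is the time of
      the heat flow.\<close>
    define Q where "Q = (\<lambda>\<tau>. if morrey_bound X0 e (F (t - \<tau>)) m then F (t - \<tau>) else (\<lambda>x. 0))"
    have Q: "morrey_bound X0 e (Q \<tau>) m" for \<tau>
      using morrey_bound_mono[OF X0 morrey_bound_zero[OF X0], of "\<lambda>x. 0" m] m by (simp add: Q_def)
    have "(\<integral>\<^sup>+x. g x * G x \<partial>lebesgue) = (\<integral>\<^sup>+x. (\<integral>\<^sup>+s. g x * ennreal \<bar>K s x\<bar> \<partial>?L) \<partial>?V)"
      unfolding G_def using Kx by (intro nn_integral_cong nn_integral_cmult[symmetric]) auto
    also have "\<dots> = (\<integral>\<^sup>+s. \<phi> s \<partial>?L)"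
      unfolding \<phi>_def by (rule P.Fubini'[OF gK])
    also have "\<dots> = (\<integral>\<^sup>+\<tau>. \<phi> (t + (-1) *\<^sub>R \<tau>) \<partial>?L)"
      using nn_integral_affine_lebesgue[OF \<phi>m, of "-1" t] by simp
    \<comment> \<open>Enlarging the range from 0 < \<tau> < t to \<tau> > 0 makes the bound
      independent of t.\<close>
    also have "\<dots> \<le> (\<integral>\<^sup>+\<tau>\<in>{0<..}. (\<integral>\<^sup>+x. g x * ennreal \<bar>heat \<tau> (Q \<tau>) x\<bar> \<partial>lebesgue) \<partial>?L)"
    proof (rule nn_integral_mono_AE)
      have neg1: "(- 1 :: real) \<noteq> 0" by simp
      show "AE \<tau> in ?L. \<phi> (t + (-1) *\<^sub>R \<tau>)
          \<le> (\<integral>\<^sup>+x. g x * ennreal \<bar>heat \<tau> (Q \<tau>) x\<bar> \<partial>lebesgue) * indicator {0<..} \<tau>"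
        using AE_lebesgue_affine[OF Heq neg1, of t] AE_lebesgue_affine[OF Fm neg1, of t]
      proof eventually_elim
        case (elim \<tau>)
        show ?case
        proof (cases "0 < \<tau> \<and> \<tau> < t")
          case True
          then have "K (t - \<tau>) x = heat \<tau> (Q \<tau>) x" for x
            using elim by (simp add: K_def Q_def)
          then show ?thesis using True by (simp add: \<phi>_def)
        next
          case False
          then have "K (t - \<tau>) x = 0" for x by (auto simp: K_def indicator_def)
          then show ?thesis by (simp add: \<phi>_def)
        qed
      qed
    qed
    also have "\<dots> \<le> ennreal (C * m * r powr - (e / 2) * nrm X f)"
      unfolding nn_integral_completion g_def using hb Q m r f
      by (simp add: nn_integral_completion heat_pairing_bound_def)
    finally show ?thesis by (simp add: g_def)
  qed
  have wb: "morrey_bound X (e / 2) w (C * m)"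
    unfolding morrey_bound_def koethe_bound_def
  proof (intro conjI allI impI ballI wm cut_measurable)
    show "0 \<le> C * m" using C m by simp
    fix a and r :: real assume r: "r > 0"
    show "0 \<le> C * m * r powr - (e / 2)" using C m by simp
    fix f assume f: "f \<in> elems X"
    have "abs_pairing f (cut a r w)
       \<le> ball_pairing a r f G"
      by (intro nn_integral_mono)
         (auto simp: cut_def indicator_def abs_mult ennreal_mult intro!: mult_left_mono wG)
    also have "\<dots> \<le> ennreal (C * m * r powr - (e / 2) * nrm X f)" by (rule GX[OF f r])
    finally show "abs_pairing f (cut a r w) \<le> \<dots>" .
  qed
  let ?l = "real CARD('n) / (real CARD('n) - 2)"
  \<comment> \<open>The exponents are dual: -(e / 2) is the power that normalises blocks with
    exponent n / (n - 2).\<close>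
  have q: "- (e / 2) = real CARD('n) / ?l + sigma X" using n e' by simp
  have "is_weak_heat_integral X F t w"
    unfolding is_weak_heat_integral_def
  proof (intro conjI ballI)
    have "e / 2 = real CARD('n) / (real CARD('n) / 2) + sigma (fdual X)" using e by simp
    with wb show "w \<in> elems (morrey (fdual X) (real CARD('n) / 2))"
      using morrey_bound_imp_morrey(1)[OF HX, of "real CARD('n) / 2" w "C * m"] by simp
    fix h assume h: "h \<in> elems (block_space X ?l)"
    obtain A where A: "A \<ge> 0" "\<And>G B. G \<in> borel_measurable lebesgue \<Longrightarrow>
      (\<And>b. is_block X ?l b \<Longrightarrow> (\<integral>\<^sup>+x. ennreal \<bar>b x\<bar> * G x \<partial>lebesgue) \<le> B) \<Longrightarrow>
      (\<integral>\<^sup>+x. ennreal \<bar>h x\<bar> * G x \<partial>lebesgue) \<le> ennreal A * B"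
      using block_space_nn_integral[OF h] by blast
    have hm: "h \<in> borel_measurable ?V"
      using h by (auto simp: block_space_def tempered_functions_def L1loc_def)
    show "integrable lebesgue (\<lambda>x. h x * heat (t - s) (F s) x)" if s: "s \<in> {0<..<t}" for s
    proof (rule integrableI_bounded)
      obtain k where k: "k > 0" "morrey_bound X0 e (F s) k" using Fb[of s] s by auto
      have um: "heat (t - s) (F s) \<in> borel_measurable ?V"
        by (rule heat_measurable_space[OF morrey_boundD(1)[OF k(2)]])
      then show "(\<lambda>x. h x * heat (t - s) (F s) x) \<in> borel_measurable ?V" using hm by measurable
      have c0: "0 \<le> C * k / (t - s)" using C k s by simp
      have "(\<integral>\<^sup>+x. ennreal \<bar>h x\<bar> * ennreal \<bar>heat (t - s) (F s) x\<bar> \<partial>lebesgue) \<le> ennreal A * ennreal (C * k / (t - s))"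
        using um s hb k by (intro A(2) block_nn_integral[OF _ c0 q]) (auto simp: heat_pairing_bound_def)
      also have "\<dots> < \<infinity>" by (simp add: ennreal_mult_less_top)
      finally show "(\<integral>\<^sup>+x. ennreal (norm (h x * heat (t - s) (F s) x)) \<partial>lebesgue) < \<infinity>"
        by (simp add: abs_mult ennreal_mult)
    qed
    have hK: "(\<lambda>p. h (snd p) * K (fst p) (snd p)) \<in> borel_measurable (?L \<Otimes>\<^sub>M ?V)"
      using Km measurable_compose[OF measurable_snd hm] by measurable
    have int: "integrable (?L \<Otimes>\<^sub>M ?V) (\<lambda>(s, x). h x * K s x)"
    proof (rule integrableI_bounded)
      show "(\<lambda>(s, x). h x * K s x) \<in> borel_measurable (?L \<Otimes>\<^sub>M ?V)" using hK by (simp add: case_prod_beta)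
      then have nm: "(\<lambda>p. ennreal (norm (case p of (s, x) \<Rightarrow> h x * K s x))) \<in> borel_measurable (?L \<Otimes>\<^sub>M ?V)"
        by measurable
      have c0: "0 \<le> C * m" using C m by simp
      have "(\<integral>\<^sup>+p. ennreal (norm (case p of (s, x) \<Rightarrow> h x * K s x)) \<partial>(?L \<Otimes>\<^sub>M ?V))
         = (\<integral>\<^sup>+x. (\<integral>\<^sup>+s. ennreal (norm (h x * K s x)) \<partial>?L) \<partial>?V)"
        using P.nn_integral_snd[OF nm] by simp
      also have "\<dots> = (\<integral>\<^sup>+x. ennreal \<bar>h x\<bar> * G x \<partial>?V)"
        unfolding G_def using Kx by (auto simp: abs_mult ennreal_mult intro!: nn_integral_cong nn_integral_cmult)
      also have "\<dots> \<le> ennreal A * ennreal (C * m)"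
        by (intro A(2) Gm block_nn_integral[OF _ c0 q] GX)
      also have "\<dots> < \<infinity>" by (simp add: ennreal_mult_less_top)
      finally show "(\<integral>\<^sup>+p. ennreal (norm (case p of (s, x) \<Rightarrow> h x * K s x)) \<partial>(?L \<Otimes>\<^sub>M ?V)) < \<infinity>" .
    qed
    define k where "k = (\<lambda>s. \<integral>x. h x * K s x \<partial>?V)"
    have kint: "integrable ?L k" unfolding k_def by (rule P.integrable_fst[OF int])
    have keq: "AE s in ?L. k s = indicator {0<..<t} s *\<^sub>R pairing (heat (t - s) (F s)) h"
      using Heq
    proof (rule AE_mp, intro AE_I2 impI)
      fix s assume "0 < s \<and> s < t \<longrightarrow> (\<forall>x. H (s, x) = heat (t - s) (F s) x)"
      then show "k s = indicator {0<..<t} s *\<^sub>R pairing (heat (t - s) (F s)) h"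
        by (cases "0 < s \<and> s < t") (auto simp: k_def K_def pairing_def)
    qed
    \<comment> \<open>The pairing agrees with the measurable k for almost every s; as Lebesgue
      measure is complete, it is measurable too.\<close>
    have pm: "(\<lambda>s. indicator {0<..<t} s *\<^sub>R pairing (heat (t - s) (F s)) h) \<in> borel_measurable ?L"
      by (rule borel_measurable_AE[OF borel_measurable_integrable[OF kint] keq])
    show "set_integrable lebesgue {0<..<t} (\<lambda>s. pairing (heat (t - s) (F s)) h)"
      unfolding set_integrable_def by (rule integrable_cong_AE_imp[OF kint pm keq])
    have "pairing w h = (\<integral>x. (\<integral>s. h x * K s x \<partial>?L) \<partial>?V)"
      by (simp add: pairing_def w_def)
    also have "\<dots> = (\<integral>s. k s \<partial>?L)"
      unfolding k_def by (rule P.Fubini_integral[OF int])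
    also have "\<dots> = (LINT s:{0<..<t}|lebesgue. pairing (heat (t - s) (F s)) h)"
      unfolding set_lebesgue_integral_def by (rule integral_cong_AE[OF borel_measurable_integrable[OF kint] pm keq])
    finally show "pairing w h = (LINT s:{0<..<t}|lebesgue. pairing (heat (t - s) (F s)) h)" .
  qed
  with wb that show thesis by blast
qed

text \<open>Weak integrals have equal pairings with the block space, so the choice made in
  \<open>B1\<close> does not influence its norm.\<close>

lemma is_weak_heat_integral_norm_unique:
  fixes X :: "('n::finite) fspace"
  assumes "class_H X" "is_weak_heat_integral X F t v" "is_weak_heat_integral X F t w"
  shows "nrm (morrey (fdual X) l) v = nrm (morrey (fdual X) l) w"
  using assms unfolding is_weak_heat_integral_def
  by (intro morrey_norm_cong[where l' = "real CARD('n) / (real CARD('n) - 2)"]) auto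

section \<open>The bilinear integrand\<close>

text \<open>Expand the form into products of components. Each is covered by the product estimate,
  and the norm of a component is at most that of the vector field.\<close>

lemma bilinear_morrey_bound:
  fixes X X0 :: "('n::finite) fspace" and A :: "real ^ 'n ^ 'n"
  assumes H: "class_H X" and H0: "class_H X0" and e: "e = 2 * (real CARD('n) / l + sigma (fdual X))"
    and prod: "\<forall>f\<in>elems (fdual X). \<forall>g\<in>elems (fdual X). (\<lambda>x. f x * g x) \<in> elems (fdual X0) \<and>
           nrm (fdual X0) (\<lambda>x. f x * g x) \<le> C * nrm (fdual X) f * nrm (fdual X) g"
  obtains K where "K > 0" "\<And>f g. f \<in> elems (vec_space (morrey (fdual X) l)) \<Longrightarrow>
    g \<in> elems (vec_space (morrey (fdual X) l)) \<Longrightarrow>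
    morrey_bound X0 e (\<lambda>x. (A *v f x) \<bullet> g x)
      (K * (nrm (vec_space (morrey (fdual X) l)) f * nrm (vec_space (morrey (fdual X) l)) g))"
proof -
  note X0 = class_H_banach[OF H0]
  let ?E = "morrey (fdual X) l"
  obtain D where D: "D > 0" "\<And>w. w \<in> elems ?E \<Longrightarrow> 0 \<le> nrm ?E w \<and>
    morrey_bound X (real CARD('n) / l + sigma (fdual X)) w (D * nrm ?E w)"
    using morrey_imp_morrey_bound[OF H] by metis
  obtain k where k: "k > 0" "\<And>e f g c d. morrey_bound X e f c \<Longrightarrow> morrey_bound X e g d \<Longrightarrow>
    morrey_bound X0 (2 * e) (\<lambda>x. f x * g x) (k * (c * d))"
    using morrey_bound_mult[OF H H0 prod[rule_format]] by blast
  define a where "a = (\<Sum>i\<in>UNIV. \<Sum>j\<in>UNIV. \<bar>A $ i $ j\<bar>)"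
  have a: "a \<ge> 0" unfolding a_def by (intro sum_nonneg) auto
  \<comment> \<open>a + 1 instead of a keeps the constant positive for the zero matrix.\<close>
  let ?K = "(a + 1) * (k * (D * D))"
  have "morrey_bound X0 e (\<lambda>x. (A *v f x) \<bullet> g x) (?K * (nrm (vec_space ?E) f * nrm (vec_space ?E) g))"
    if f: "f \<in> elems (vec_space ?E)" and g: "g \<in> elems (vec_space ?E)" for f g
  proof -
    let ?f = "\<lambda>j x. f x $ j" and ?g = "\<lambda>i x. g x $ i"
    have fj: "?f j \<in> elems ?E" and gi: "?g i \<in> elems ?E" for i j
      using f g by (auto simp: vec_space_def)
    have nf: "0 \<le> nrm ?E (?f j)" "nrm ?E (?f j) \<le> nrm (vec_space ?E) f" for j
      using D(2)[OF fj] by (auto simp: vec_space_def intro!: member_le_sum)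
    have ng: "0 \<le> nrm ?E (?g j)" "nrm ?E (?g j) \<le> nrm (vec_space ?E) g" for j
      using D(2)[OF gi] by (auto simp: vec_space_def intro!: member_le_sum)
    let ?m = "nrm (vec_space ?E) f * nrm (vec_space ?E) g"
    have m: "0 \<le> ?m" using order_trans[OF nf] order_trans[OF ng] by (intro mult_nonneg_nonneg) blast+
    have one: "morrey_bound X0 e (\<lambda>x. A $ i $ j * (?f j x * ?g i x)) (\<bar>A $ i $ j\<bar> * (k * (D * D) * ?m))" for i j
    proof (rule morrey_bound_cmult[OF X0])
      have b: "morrey_bound X0 e (\<lambda>x. ?f j x * ?g i x) (k * ((D * nrm ?E (?f j)) * (D * nrm ?E (?g i))))"
        unfolding e using D(2)[OF fj] D(2)[OF gi] by (intro k(2)) auto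
      have "nrm ?E (?f j) * nrm ?E (?g i) \<le> ?m"
        using nf ng order_trans[OF nf] by (intro mult_mono) blast+
      then have "k * (D * D) * (nrm ?E (?f j) * nrm ?E (?g i)) \<le> k * (D * D) * ?m"
        using k(1) D(1) by (intro mult_left_mono) auto
      then have "k * ((D * nrm ?E (?f j)) * (D * nrm ?E (?g i))) \<le> k * (D * D) * ?m"
        by (simp add: mult_ac)
      then show "morrey_bound X0 e (\<lambda>x. ?f j x * ?g i x) (k * (D * D) * ?m)"
        by (intro morrey_bound_mono[OF X0 b morrey_boundD(1)[OF b]]) auto
    qed
    have "morrey_bound X0 e (\<lambda>x. \<Sum>i\<in>UNIV. \<Sum>j\<in>UNIV. A $ i $ j * (?f j x * ?g i x))
        (\<Sum>i\<in>UNIV. \<Sum>j\<in>UNIV. \<bar>A $ i $ j\<bar> * (k * (D * D) * ?m))"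
      by (intro morrey_bound_sum[OF X0] one) auto
    moreover have "(\<Sum>i\<in>UNIV. \<Sum>j\<in>UNIV. A $ i $ j * (?f j x * ?g i x)) = (A *v f x) \<bullet> g x" for x
      by (simp add: inner_vec_def matrix_vector_mult_def sum_distrib_left sum_distrib_right mult_ac)
    moreover have "(\<Sum>i\<in>UNIV. \<Sum>j\<in>UNIV. \<bar>A $ i $ j\<bar> * (k * (D * D) * ?m)) = a * (k * (D * D) * ?m)"
      by (simp add: a_def sum_distrib_right)
    ultimately have b: "morrey_bound X0 e (\<lambda>x. (A *v f x) \<bullet> g x) (a * (k * (D * D) * ?m))" by simp
    have "a * (k * (D * D) * ?m) \<le> (a + 1) * (k * (D * D) * ?m)"
      using k(1) D(1) m by (intro mult_right_mono) auto
    then show ?thesis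
      by (intro morrey_bound_mono[OF X0 b morrey_boundD(1)[OF b]]) (auto simp: mult.assoc)
  qed
  moreover have "?K > 0" using a k(1) D(1) by simp
  ultimately show thesis using that by blast
qed

lemma vec_morrey_diff:
  assumes "class_H X" "f \<in> elems (vec_space (morrey (fdual X) l))" "g \<in> elems (vec_space (morrey (fdual X) l))"
  shows "(\<lambda>x. f x - g x) \<in> elems (vec_space (morrey (fdual X) l))"
  using assms morrey_diff[OF assms(1)] by (simp add: vec_space_def)

lemma vec_morrey_norm_nonneg:
  assumes H: "class_H X" and f: "f \<in> elems (vec_space (morrey (fdual X) l))"
  shows "0 \<le> nrm (vec_space (morrey (fdual X) l)) f"
proof -
  have "\<And>w. w \<in> elems (morrey (fdual X) l) \<Longrightarrow> 0 \<le> nrm (morrey (fdual X) l) w"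
    using morrey_imp_morrey_bound[OF H] by metis
  then show ?thesis using f by (auto simp: vec_space_def intro!: sum_nonneg)
qed

text \<open>For s > 0 the pair (a s, b s) takes finitely many values, each on a measurable set of
  times, and for a fixed pair the integrand comes from one fixed function. H is the corresponding
  finite sum.\<close>

lemma simple_heat_measurable:
  fixes a b :: "real \<Rightarrow> real ^ 'n::finite \<Rightarrow> real ^ 'n"
  assumes a: "simple_in_time E a" and b: "simple_in_time E b"
    and B: "\<And>f g. f \<in> elems E \<Longrightarrow> g \<in> elems E \<Longrightarrow> (\<lambda>x. (A *v f x) \<bullet> g x) \<in> borel_measurable lebesgue"
  obtains H where "H \<in> borel_measurable ((lebesgue :: real measure) \<Otimes>\<^sub>M lebesgue)"
    "\<And>s x. s > 0 \<Longrightarrow> H (s, x) = heat (t - s) (B1_integrand A a b s) x"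
proof -
  let ?P = "(a ` {0<..}) \<times> (b ` {0<..})"
  let ?S = "\<lambda>p. {s. s > 0 \<and> a s = fst p} \<inter> {s. s > 0 \<and> b s = snd p}"
  let ?G = "\<lambda>p x. (A *v (fst p) x) \<bullet> (snd p) x"
  define H where "H = (\<lambda>q. \<Sum>p\<in>?P. indicator (?S p) (fst q) * heat (t - fst q) (?G p) (snd q))"
  have fin: "finite ?P" using a b by (auto simp: simple_in_time_def)
  show thesis
  proof (rule that[of H])
    show "H \<in> borel_measurable ((lebesgue :: real measure) \<Otimes>\<^sub>M lebesgue)"
      unfolding H_def
    proof (intro borel_measurable_sum borel_measurable_times)
      fix p assume p: "p \<in> ?P"
      have "?S p \<in> sets lebesgue" using a b by (intro sets.Int) (auto simp: simple_in_time_def)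
      then have "(indicator (?S p) :: real \<Rightarrow> real) \<in> borel_measurable lebesgue" by auto
      from measurable_compose[OF measurable_fst this]
      show "(\<lambda>q. indicator (?S p) (fst q) :: real) \<in> borel_measurable ((lebesgue :: real measure) \<Otimes>\<^sub>M (lebesgue :: (real ^ 'n) measure))" .
      have "fst p \<in> elems E" "snd p \<in> elems E" using p a b by (auto simp: simple_in_time_def)
      then show "(\<lambda>q. heat (t - fst q) (?G p) (snd q)) \<in> borel_measurable ((lebesgue :: real measure) \<Otimes>\<^sub>M lebesgue)"
        by (intro heat_measurable B)
    qed
    fix s :: real and x assume s: "s > 0"
    have "H (s, x) = (\<Sum>p\<in>?P. if p = (a s, b s) then heat (t - s) (?G p) x else 0)"
      unfolding H_def using s by (intro sum.cong) (auto simp: indicator_def prod_eq_iff)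
    also have "\<dots> = heat (t - s) (B1_integrand A a b s) x"
      using fin s by (subst sum.delta) (auto simp: B1_integrand_def)
    finally show "H (s, x) = heat (t - s) (B1_integrand A a b s) x" .
  qed
qed

text \<open>Strong measurability provides simple approximations of u and v in the Morrey norm. At
  the positive heat time t - s the sup bound turns this into convergence at every x, so H can be a
  pointwise limit of jointly measurable functions.\<close>

lemma heat_B1_integrand_measurable:
  fixes X X0 :: "('n::finite) fspace" and A :: "real ^ 'n ^ 'n" and t l :: real
  defines "M \<equiv> vec_space (morrey (fdual X) l)"
  assumes H: "class_H X" and H0: "class_H X0" and K: "K > 0"
    and B: "\<And>f g. f \<in> elems M \<Longrightarrow> g \<in> elems M \<Longrightarrow>
      morrey_bound X0 e (\<lambda>x. (A *v f x) \<bullet> g x) (K * (nrm M f * nrm M g))"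
    and u: "u \<in> elems (Linf_time M)" and v: "v \<in> elems (Linf_time M)"
  obtains H where "H \<in> borel_measurable ((lebesgue :: real measure) \<Otimes>\<^sub>M lebesgue)"
    "AE s in lebesgue. 0 < s \<and> s < t \<longrightarrow> (\<forall>x. H (s, x) = heat (t - s) (B1_integrand A u v s) x)"
proof -
  note X0 = class_H_banach[OF H0]
  obtain a where a: "\<And>k::nat. simple_in_time M (a k)"
    "AE s in lebesgue_on {0<..}. (\<lambda>k. nrm M (\<lambda>x. a k s x - u s x)) \<longlonglongrightarrow> (0::real)"
    using u by (auto simp: Linf_time_def)
  obtain b where b: "\<And>k::nat. simple_in_time M (b k)"
    "AE s in lebesgue_on {0<..}. (\<lambda>k. nrm M (\<lambda>x. b k s x - v s x)) \<longlonglongrightarrow> (0::real)"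
    using v by (auto simp: Linf_time_def)
  obtain D where D: "D > 0" "\<And>g m t x. morrey_bound X0 e g m \<Longrightarrow> t > 0 \<Longrightarrow>
    heat_abs t g x \<le> ennreal (D * m * t powr (- (e + sigma X0 + real CARD('n)) / 2))"
    using heat_abs_sup_bound[OF H0] by blast
  have "\<exists>J. J \<in> borel_measurable ((lebesgue :: real measure) \<Otimes>\<^sub>M lebesgue) \<and>
      (\<forall>s>0. \<forall>x. J (s, x) = heat (t - s) (B1_integrand A (a k) (b k) s) x)" for k
    using simple_heat_measurable[OF a(1) b(1) morrey_boundD(1)[OF B], of t] by metis
  then obtain J where Jm: "\<And>k. J k \<in> borel_measurable ((lebesgue :: real measure) \<Otimes>\<^sub>M lebesgue)"
    and J: "\<And>k s x. s > 0 \<Longrightarrow> J k (s, x) = heat (t - s) (B1_integrand A (a k) (b k) s) x"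
    by metis
  show thesis
  proof (rule that)
    show "(\<lambda>q. lim (\<lambda>k. J k q)) \<in> borel_measurable ((lebesgue :: real measure) \<Otimes>\<^sub>M lebesgue)"
      by (rule borel_measurable_lim_metric[OF Jm])
    have a2: "AE s in lebesgue. s \<in> {0<..} \<longrightarrow> (\<lambda>k. nrm M (\<lambda>x. a k s x - u s x)) \<longlonglongrightarrow> (0::real)"
      using a(2) by (subst (asm) AE_restrict_space_iff) auto
    have b2: "AE s in lebesgue. s \<in> {0<..} \<longrightarrow> (\<lambda>k. nrm M (\<lambda>x. b k s x - v s x)) \<longlonglongrightarrow> (0::real)"
      using b(2) by (subst (asm) AE_restrict_space_iff) auto
    show "AE s in lebesgue. 0 < s \<and> s < t \<longrightarrow>
        (\<forall>x. lim (\<lambda>k. J k (s, x)) = heat (t - s) (B1_integrand A u v s) x)"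
      using a2 b2
    proof eventually_elim
      case (elim s)
      show ?case
      proof (intro impI allI limI)
        fix x assume s: "0 < s \<and> s < t"
        let ?c = "(t - s) powr (- (e + sigma X0 + real CARD('n)) / 2)"
        let ?F = "B1_integrand A u v s" and ?Fk = "\<lambda>k. B1_integrand A (a k) (b k) s"
        let ?du = "\<lambda>k x. a k s x - u s x" and ?dv = "\<lambda>k x. b k s x - v s x"
        have us: "u s \<in> elems M" and vs: "v s \<in> elems M" using u v s by (auto simp: Linf_time_def)
        have as: "a k s \<in> elems M" and bs: "b k s \<in> elems M" for k
          using a(1)[of k] b(1)[of k] s by (auto simp: simple_in_time_def)
        have dus: "?du k \<in> elems M" and dvs: "?dv k \<in> elems M" for k
          unfolding M_def using vec_morrey_diff[OF H] as bs us vs unfolding M_def by blast+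
        \<comment> \<open>From B(a, b) - B(u, v) = B(a - u, b - v) + B(a - u, v) + B(u, b - v):
          every term has a factor tending to 0, and the other factor is fixed or tends to 0 as
          well.\<close>
        define d where "d = (\<lambda>k. K * (nrm M (?du k) * nrm M (?dv k)) + K * (nrm M (?du k) * nrm M (v s))
            + K * (nrm M (u s) * nrm M (?dv k)))"
        have d0: "d \<longlonglongrightarrow> K * (0 * 0) + K * (0 * nrm M (v s)) + K * (nrm M (u s) * 0)"
          unfolding d_def using elim s by (intro tendsto_intros) auto
        have diff: "morrey_bound X0 e (\<lambda>y. ?Fk k y - ?F y) (d k)" for k
        proof -
          have "?Fk k y - ?F y = (A *v ?du k y) \<bullet> ?dv k y + (A *v ?du k y) \<bullet> v s y + (A *v u s y) \<bullet> ?dv k y" for y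
            by (simp add: B1_integrand_def matrix_vector_mult_diff_distrib inner_diff_left inner_diff_right)
          then show ?thesis
            unfolding d_def using dus dvs us vs by (simp only:) (intro morrey_bound_add[OF X0] B)
        qed
        have F: "morrey_bound X0 e ?F (K * (nrm M (u s) * nrm M (v s)))"
          unfolding B1_integrand_def by (rule B[OF us vs])
        have Fk: "morrey_bound X0 e (?Fk k) (K * (nrm M (a k s) * nrm M (b k s)))" for k
          unfolding B1_integrand_def by (rule B[OF as bs])
        have ts: "t - s > 0" using s by simp
        have fin: "heat_abs (t - s) ?F x < \<infinity>" "heat_abs (t - s) (?Fk k) x < \<infinity>" for k
          using le_less_trans[OF D(2)[OF F ts] ennreal_less_top] le_less_trans[OF D(2)[OF Fk ts] ennreal_less_top] by auto
        have le: "\<bar>J k (s, x) - heat (t - s) ?F x\<bar> \<le> D * d k * ?c" for k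
        proof -
          have "J k (s, x) - heat (t - s) ?F x = heat (t - s) (\<lambda>y. ?Fk k y - ?F y) x"
            using s fin by (simp add: J heat_diff morrey_boundD(1)[OF F] morrey_boundD(1)[OF Fk])
          moreover have "ennreal \<bar>heat (t - s) (\<lambda>y. ?Fk k y - ?F y) x\<bar> \<le> ennreal (D * d k * ?c)"
            by (rule order_trans[OF heat_le_heat_abs D(2)[OF diff ts]])
          ultimately show ?thesis using D(1) morrey_boundD(2)[OF diff] by simp
        qed
        have "(\<lambda>k. D * d k * ?c) \<longlonglongrightarrow> D * (K * (0 * 0) + K * (0 * nrm M (v s)) + K * (nrm M (u s) * 0)) * ?c"
          by (intro tendsto_intros d0)
        then have "(\<lambda>k. D * d k * ?c) \<longlonglongrightarrow> 0" by simp
        then have "(\<lambda>k. J k (s, x) - heat (t - s) ?F x) \<longlonglongrightarrow> 0"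
          by (rule Lim_null_comparison[rotated]) (intro always_eventually allI, unfold real_norm_def, rule le)
        then show "(\<lambda>k. J k (s, x)) \<longlonglongrightarrow> heat (t - s) ?F x" by (simp add: LIM_zero_iff)
      qed
    qed
  qed
qed

text \<open>For the sign: were the essential supremum negative, nonnegativity of the norms would
  make the half-line a null set.\<close>

lemma Linf_time_AE_bound:
  assumes u: "u \<in> elems (Linf_time E)" and nn: "\<And>f. f \<in> elems E \<Longrightarrow> 0 \<le> nrm E f"
  shows "AE s in lebesgue. 0 < s \<longrightarrow> nrm E (u s) \<le> nrm (Linf_time E) u"
    and "0 \<le> nrm (Linf_time E) u"
proof -
  let ?e = "esssup (lebesgue_on {0<..}) (\<lambda>t. ereal (nrm E (u t)))"
  have "?e < \<infinity>" and el: "\<And>t. t > 0 \<Longrightarrow> u t \<in> elems E" using u by (auto simp: Linf_time_def)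
  have "AE s in lebesgue_on {0<..}. ereal (nrm E (u s)) \<le> ?e" by (rule esssup_AE)
  then have "AE s in lebesgue_on {0<..}. nrm E (u s) \<le> nrm (Linf_time E) u"
    using \<open>?e < \<infinity>\<close> by (cases ?e) (auto simp: Linf_time_def)
  then have ae: "AE s in lebesgue. s \<in> {0<..} \<longrightarrow> nrm E (u s) \<le> nrm (Linf_time E) u"
    by (subst (asm) AE_restrict_space_iff) auto
  then show "AE s in lebesgue. 0 < s \<longrightarrow> nrm E (u s) \<le> nrm (Linf_time E) u" by simp
  show "0 \<le> nrm (Linf_time E) u"
  proof (rule ccontr)
    assume neg: "\<not> ?thesis"
    have "AE s in (lebesgue :: real measure). s \<notin> {0<..}"
      using ae
    proof eventually_elim
      case (elim s)
      then show ?case using nn[OF el[of s]] neg by auto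
    qed
    then have "negligible {0 :: real<..}" by (simp add: AE_iff_null_sets negligible_iff_null_sets)
    then show False using open_not_negligible[of "{0 :: real<..}"] greaterThan_non_empty by auto
  qed
qed

section \<open>The bilinear estimate\<close>

text \<open>If l were 1, its conjugate would be \<infinity> and the right side of \<open>eq\<close>
  -\<infinity>, while the left side is finite because l0 > 1. So both conjugates are finite and s
  can be cancelled.\<close>

lemma conj_exp_ratio:
  fixes l l0 s :: real
  assumes l: "1 \<le> l" "l < l0" and s: "s < 0"
    and eq: "conj_exp (ereal l0) * ereal (2 * s) = conj_exp (ereal l) * ereal s"
  shows "conj_exp (ereal l0) / conj_exp (ereal l) = ereal (1 / 2)"
proof -
  have c: "conj_exp (ereal p) = ereal (p / (p - 1))" if "p > 1" for p
    using that by (simp add: conj_exp_def one_ereal_def)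
  have l0: "conj_exp (ereal l0) = ereal (l0 / (l0 - 1))" using l by (intro c) simp
  have "l \<noteq> 1"
  proof
    assume "l = 1"
    then have "conj_exp (ereal l) * ereal s = - \<infinity>"
      using s by (simp add: conj_exp_def one_ereal_def)
    with eq show False by (simp add: l0)
  qed
  then have l1: "conj_exp (ereal l) = ereal (l / (l - 1))" and pos: "l / (l - 1) > 0"
    using l c[of l] by auto
  have "l0 / (l0 - 1) * (2 * s) = l / (l - 1) * s" using eq by (simp add: l0 l1)
  then have "(l0 / (l0 - 1) * 2) * s = l / (l - 1) * s" by (simp only: mult.assoc)
  then have "l0 / (l0 - 1) * 2 = l / (l - 1)" using s by (simp only: mult_cancel_right) simp
  moreover have "a * 2 = b \<Longrightarrow> b > 0 \<Longrightarrow> a / b = 1 / 2" for a b :: real by auto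
  ultimately have r: "(l0 / (l0 - 1)) / (l / (l - 1)) = 1 / 2" using pos by blast
  show ?thesis
    unfolding l0 l1 ereal_divide if_not_P[OF less_imp_neq[OF pos, symmetric]] r ..
qed

theorem theorem8p1:
  fixes X X0 X1 X2 :: "('n::finite) fspace"
    and A :: "'n \<Rightarrow> real ^ 'n ^ 'n"
    and l l0 \<theta> \<theta>1 \<theta>2 :: real
    and d1 d2 :: ereal
  assumes "1 \<le> l" "l < l0"
    and "class_H X0" "class_H X"
    and "sigma X < sigma X0"
    and "dual_is_function_space X0" "class_H (fdual X0)"
    and "dual_is_function_space X" "class_H (fdual X)"
    and "conj_exp (ereal l0) * ereal (sigma (fdual X0)) = conj_exp (ereal l) * ereal (sigma (fdual X))"
    \<comment> \<open>standing assumptions on the exponents of the block and Morrey spaces\<close>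
    and "real CARD('n) / l + sigma X \<ge> 0" "real CARD('n) / l0 + sigma X0 \<ge> 0"
    and "real CARD('n) / (real CARD('n) / (real CARD('n) - 2)) + sigma X \<ge> 0"
    and "real CARD('n) / (real CARD('n) / 2) + sigma (fdual X) \<le> 0"
    \<comment> \<open>assumption (i)\<close>
    and "class_H X1" "class_H X2"
    and "\<theta>1 = sigma_dual X1 / sigma (fdual X0)"
    and "\<theta>2 = sigma_dual X2 / sigma (fdual X0)"
    and "ereal \<theta>1 < conj_exp (ereal l0) / conj_exp (ereal l)"
    and "conj_exp (ereal l0) / conj_exp (ereal l) < ereal \<theta>2"
    and "ereal \<theta>2 < min (conj_exp (ereal l0) / conj_exp (ereal l) + 2 * conj_exp (ereal l0) / ereal (real CARD('n))) 1"
    \<comment> \<open>assumption (ii)\<close>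
    and "0 < \<theta>" "\<theta> < 1"
    and "conj_exp (ereal l0) / conj_exp (ereal l) = ereal (\<theta> * \<theta>2 + (1 - \<theta>) * \<theta>1)"
    and "embeds X (interp X1 X2 \<theta> 1)"
    and "1 \<le> d1" "embeds (interp Linf (fdual X0) \<theta>1 d1) (fdual X1)"
    and "1 \<le> d2" "embeds (interp Linf (fdual X0) \<theta>2 d2) (fdual X2)"
    \<comment> \<open>the product inequality\<close>
    and "\<exists>C. \<forall>f\<in>elems (fdual X). \<forall>g\<in>elems (fdual X). (\<lambda>x. f x * g x) \<in> elems (fdual X0) \<and>
           nrm (fdual X0) (\<lambda>x. f x * g x) \<le> C * nrm (fdual X) f * nrm (fdual X) g"
    and "CARD('n) > 4"
  shows "\<exists>K>0. \<forall>u v.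
    let M = vec_space (morrey (fdual X) (real CARD('n) / 2)) in
    u \<in> elems (Linf_time M) \<and> v \<in> elems (Linf_time M) \<longrightarrow>
      (\<forall>t>0. \<forall>i. is_weak_heat_integral X (B1_integrand (A i) u v) t (\<lambda>x. B1 X A u v t x $ i)) \<and>
      (SUP t\<in>{0<..}. ereal (nrm M (B1 X A u v t)))
        \<le> ereal (K * nrm (Linf_time M) u * nrm (Linf_time M) v)"
proof -
  note H0 = \<open>class_H X0\<close> and H = \<open>class_H X\<close> and H1 = \<open>class_H X1\<close> and H2 = \<open>class_H X2\<close>
  note th = \<open>0 < \<theta>\<close> \<open>\<theta> < 1\<close>
  have n: "real CARD('n) > 4" using \<open>CARD('n) > 4\<close> by linarith
  obtain C0 where prod: "\<forall>f\<in>elems (fdual X). \<forall>g\<in>elems (fdual X).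
      (\<lambda>x. f x * g x) \<in> elems (fdual X0) \<and>
      nrm (fdual X0) (\<lambda>x. f x * g x) \<le> C0 * nrm (fdual X) f * nrm (fdual X) g"
    using assms(30) by blast
  define s where "s = sigma (fdual X)"
  have s: "s = - real CARD('n) - sigma X"
    unfolding s_def by (rule sigma_fdual[OF H \<open>class_H (fdual X)\<close>])
  have s0: "sigma (fdual X0) = 2 * s"
    unfolding s_def using prod
    by (intro sigma_fdual_of_product[OF \<open>class_H (fdual X)\<close> \<open>class_H (fdual X0)\<close>]) blast
  \<comment> \<open>The Morrey space over X' with exponent n/2 requires 2 + s \<le> 0. In particular
    s is negative and can be divided by.\<close>
  have s_neg: "s \<le> - 2" using assms(14) n by (simp add: s_def)
  have ratio: "conj_exp (ereal l0) / conj_exp (ereal l) = ereal (1 / 2)"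
    using assms(1,2,10) s_neg unfolding s0 s_def[symmetric] by (intro conj_exp_ratio[where s = s]) auto
  have half: "\<theta> * \<theta>2 + (1 - \<theta>) * \<theta>1 = 1 / 2" using assms(24) unfolding ratio by simp
  have th1: "\<theta>1 < 1 / 2" using assms(19) unfolding ratio by simp
  have th2: "1 / 2 < \<theta>2" "\<theta>2 < 1" using assms(20,21) unfolding ratio by (auto simp: one_ereal_def)
  have th1_eq: "\<theta>1 = (- real CARD('n) - sigma X1) / (2 * s)"
    using assms(17) unfolding s0 sigma_dual_eq[OF H1] .
  \<comment> \<open>Numerator and denominator are both nonpositive. The value 0 is treated apart
    below, since the interpolation argument needs \<theta>1 > 0.\<close>
  have th1_nonneg: "0 \<le> \<theta>1"
    unfolding th1_eq using class_H_sigma_ge[OF H1] s_neg by (intro divide_nonpos_neg) auto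
  \<comment> \<open>Twice the exponent of X'. As 2 s is the scaling exponent of X0', this is 4 plus
    that exponent, the power for the Morrey space over X0' with index n/4.\<close>
  define e where "e = 2 * (real CARD('n) / (real CARD('n) / 2) + sigma (fdual X))"
  have eh: "e / 2 = real CARD('n) / (real CARD('n) / 2) + sigma (fdual X)" by (simp add: e_def)
  have e2: "e / 2 = 2 + s" using n by (simp add: e_def s_def)
  have e0: "e + sigma X0 + real CARD('n) = 4"
    \<comment> \<open>The exponent of X0' is also -n - \<sigma> of X0, so only 4 remains; half of it
      is the decay rate in \<tau>.\<close>
    using e2 s0 sigma_fdual[OF H0 \<open>class_H (fdual X0)\<close>] by simp
  have "\<exists>c. koethe_interp X0 X1 \<theta>1 c"
  proof (cases "\<theta>1 = 0")
    case True
    \<comment> \<open>Here \<open>d1 < \<infinity>\<close> makes the interpolation space trivial, but \<open>X1\<close> scales like \<open>L\<^sup>1\<close>.\<close>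
    then have "sigma X1 = - real CARD('n)" using th1_eq s_neg by simp
    then obtain c where c: "c > 0" "\<And>g \<alpha>. g \<in> borel_measurable lebesgue \<Longrightarrow> 0 \<le> \<alpha> \<Longrightarrow> (\<And>x. \<bar>g x\<bar> \<le> \<alpha>) \<Longrightarrow>
        koethe_bound X1 g (c * \<alpha>)"
      using koethe_bound_of_bounded[OF H1] by blast
    then show ?thesis using True by (auto simp: koethe_interp_def dest: koethe_boundD(1) intro!: exI[of _ c])
  next
    case False
    then have "0 < \<theta>1" "\<theta>1 < 1" using th1_nonneg th1 by auto
    from interp_Linf_koethe_bound[OF H0 H1 this assms(26,27)] show ?thesis .
  qed
  then obtain C1 where C1: "heat_koethe_interp X0 X1 e \<theta>1 C1"
    using heat_interp_bound[OF H0 _ e0] by blast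
  have "0 < \<theta>2" "\<theta>1 < \<theta>2" using th1 th2 by auto
  obtain C2 where C2: "heat_koethe_interp X0 X2 e \<theta>2 C2"
    using interp_Linf_koethe_bound[OF H0 H2 \<open>0 < \<theta>2\<close> th2(2) assms(28,29)] heat_interp_bound[OF H0 _ e0] by blast
  obtain C where C: "heat_pairing_bound X X0 e C" and C_pos: "C > 0"
    using heat_time_integral[OF class_H_banach[OF H] class_H_banach[OF H1] class_H_banach[OF H2] th
        \<open>\<theta>1 < \<theta>2\<close> half assms(25) C1 C2] unfolding heat_pairing_bound_def by blast
  let ?E = "morrey (fdual X) (real CARD('n) / 2)"
  let ?M = "vec_space ?E"
  have "\<forall>i. \<exists>K. K > 0 \<and> (\<forall>f g. f \<in> elems ?M \<longrightarrow> g \<in> elems ?M \<longrightarrow>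
      morrey_bound X0 e (\<lambda>x. (A i *v f x) \<bullet> g x) (K * (nrm ?M f * nrm ?M g)))"
  proof
    fix i
    show "\<exists>K. K > 0 \<and> (\<forall>f g. f \<in> elems ?M \<longrightarrow> g \<in> elems ?M \<longrightarrow>
      morrey_bound X0 e (\<lambda>x. (A i *v f x) \<bullet> g x) (K * (nrm ?M f * nrm ?M g)))"
      by (rule bilinear_morrey_bound[OF H H0 e_def prod, of "A i"]) blast
  qed
  from choice[OF this] obtain K where K: "\<And>i. K i > 0" "\<And>i f g. f \<in> elems ?M \<Longrightarrow> g \<in> elems ?M \<Longrightarrow>
      morrey_bound X0 e (\<lambda>x. (A i *v f x) \<bullet> g x) (K i * (nrm ?M f * nrm ?M g))"
    by blast
  have bound: "is_weak_heat_integral X (B1_integrand (A i) u v) t (\<lambda>x. B1 X A u v t x $ i) \<and>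
      nrm ?E (\<lambda>x. B1 X A u v t x $ i) \<le> C * K i * nrm (Linf_time ?M) u * nrm (Linf_time ?M) v"
    if u: "u \<in> elems (Linf_time ?M)" and v: "v \<in> elems (Linf_time ?M)" for u v t i
  proof -
    let ?Nu = "nrm (Linf_time ?M) u" and ?Nv = "nrm (Linf_time ?M) v" and ?F = "B1_integrand (A i) u v"
    have Nu: "AE r in lebesgue. 0 < r \<longrightarrow> nrm ?M (u r) \<le> ?Nu" "0 \<le> ?Nu"
      using Linf_time_AE_bound[OF u] vec_morrey_norm_nonneg[OF H] by blast+
    have Nv: "AE r in lebesgue. 0 < r \<longrightarrow> nrm ?M (v r) \<le> ?Nv" "0 \<le> ?Nv"
      using Linf_time_AE_bound[OF v] vec_morrey_norm_nonneg[OF H] by blast+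
    have us: "u r \<in> elems ?M" and vs: "v r \<in> elems ?M" if "r > 0" for r
      using u v that by (auto simp: Linf_time_def)
    obtain J where J: "J \<in> borel_measurable ((lebesgue :: real measure) \<Otimes>\<^sub>M lebesgue)"
      "AE s in lebesgue. 0 < s \<and> s < t \<longrightarrow> (\<forall>x. J (s, x) = heat (t - s) (?F s) x)"
      using heat_B1_integrand_measurable[OF H H0 K(1) K(2) u v] by blast
    have F: "morrey_bound X0 e (?F r) (K i * (nrm ?M (u r) * nrm ?M (v r)))" if "r > 0" for r
      unfolding B1_integrand_def by (rule K(2)[OF us[OF that] vs[OF that]])
    have nn: "0 \<le> nrm ?M (u r)" "0 \<le> nrm ?M (v r)" if "r > 0" for r
      using vec_morrey_norm_nonneg[OF H] us[OF that] vs[OF that] by blast+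
    have F1: "\<exists>m>0. morrey_bound X0 e (?F r) m" if r: "0 < r" for r
      using morrey_bound_mono[OF class_H_banach[OF H0] F[OF r] morrey_boundD(1)[OF F[OF r]],
          of "K i * (nrm ?M (u r) * nrm ?M (v r)) + 1"] nn[OF r] K(1)[of i]
      by (intro exI[of _ "K i * (nrm ?M (u r) * nrm ?M (v r)) + 1"]) (simp add: add_nonneg_pos)
    \<comment> \<open>The existence lemma asks for a positive bound, but K i times the two norms can
      be 0; \<epsilon> repairs this.\<close>
    have ex: "\<exists>w. morrey_bound X (e / 2) w (C * (K i * (?Nu * ?Nv) + \<epsilon>)) \<and> is_weak_heat_integral X ?F t w"
      if eps: "\<epsilon> > 0" for \<epsilon>
    proof -
      have m: "K i * (?Nu * ?Nv) + \<epsilon> > 0" using Nu(2) Nv(2) K(1)[of i] eps by (simp add: add_nonneg_pos)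
      have Fm: "AE r in lebesgue. 0 < r \<and> r < t \<longrightarrow> morrey_bound X0 e (?F r) (K i * (?Nu * ?Nv) + \<epsilon>)"
        using Nu(1) Nv(1)
      proof eventually_elim
        case (elim r)
        show ?case
        proof
          assume "0 < r \<and> r < t"
          then have r: "r > 0" by simp
          have "nrm ?M (u r) * nrm ?M (v r) \<le> ?Nu * ?Nv"
            using elim r nn[OF r] Nu(2) by (intro mult_mono) auto
          then have "K i * (nrm ?M (u r) * nrm ?M (v r)) \<le> K i * (?Nu * ?Nv)"
            using K(1)[of i] by (intro mult_left_mono) auto
          then have "K i * (nrm ?M (u r) * nrm ?M (v r)) \<le> K i * (?Nu * ?Nv) + \<epsilon>"
            using eps by linarith
          then show "morrey_bound X0 e (?F r) (K i * (?Nu * ?Nv) + \<epsilon>)"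
            by (intro morrey_bound_mono[OF class_H_banach[OF H0] F[OF r] morrey_boundD(1)[OF F[OF r]]]) auto
        qed
      qed
      have n2: "real CARD('n) > 2" and e3: "e / 2 = 2 + sigma (fdual X)"
        and e4: "- (e / 2) = real CARD('n) - 2 + sigma X"
        using n e2 s by (auto simp only: s_def)
      from weak_heat_integral_exists[OF H class_H_banach[OF H0] C n2 e3 e4 J F1 m Fm]
      show ?thesis by blast
    qed
    have eq: "(\<lambda>x. B1 X A u v t x $ i) = (SOME w. is_weak_heat_integral X ?F t w)"
      by (simp add: B1_def)
    have "\<exists>w. is_weak_heat_integral X ?F t w" using ex[OF zero_less_one] by blast
    then have weak: "is_weak_heat_integral X ?F t (\<lambda>x. B1 X A u v t x $ i)"
      unfolding eq by (rule someI_ex)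
    \<comment> \<open>Different \<epsilon> may give different weak integrals w, but each has the
      norm of the chosen one, so \<epsilon> can tend to 0. Using \<epsilon> / C absorbs the factor
      C.\<close>
    have "nrm ?E (\<lambda>x. B1 X A u v t x $ i) \<le> C * (K i * (?Nu * ?Nv))"
    proof (rule field_le_epsilon)
      fix \<epsilon> :: real assume "\<epsilon> > 0"
      then have "\<epsilon> / C > 0" using C_pos by simp
      from ex[OF this] obtain w where w: "morrey_bound X (e / 2) w (C * (K i * (?Nu * ?Nv) + \<epsilon> / C))"
        "is_weak_heat_integral X ?F t w" by blast
      have "nrm ?E (\<lambda>x. B1 X A u v t x $ i) = nrm ?E w"
        by (rule is_weak_heat_integral_norm_unique[OF H weak w(2)])
      also have "\<dots> \<le> C * (K i * (?Nu * ?Nv) + \<epsilon> / C)"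
        using w(1) unfolding eh by (rule morrey_bound_imp_morrey(2)[OF H])
      also have "\<dots> = C * (K i * (?Nu * ?Nv)) + \<epsilon>" using C_pos by (simp add: distrib_left)
      finally show "nrm ?E (\<lambda>x. B1 X A u v t x $ i) \<le> C * (K i * (?Nu * ?Nv)) + \<epsilon>" .
    qed
    with weak show ?thesis by (simp add: mult.assoc)
  qed
  have pos: "(\<Sum>i\<in>UNIV. C * K i) > 0" using C_pos K(1) by (intro sum_pos) auto
  show ?thesis
    unfolding Let_def
  proof (intro exI[of _ "\<Sum>i\<in>UNIV. C * K i"] conjI pos allI impI)
    fix u v t i assume "u \<in> elems (Linf_time ?M) \<and> v \<in> elems (Linf_time ?M)"
    then show "is_weak_heat_integral X (B1_integrand (A i) u v) t (\<lambda>x. B1 X A u v t x $ i)"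
      using bound by blast
  next
    fix u v assume uv: "u \<in> elems (Linf_time ?M) \<and> v \<in> elems (Linf_time ?M)"
    show "(SUP t\<in>{0<..}. ereal (nrm ?M (B1 X A u v t)))
        \<le> ereal ((\<Sum>i\<in>UNIV. C * K i) * nrm (Linf_time ?M) u * nrm (Linf_time ?M) v)"
    proof (rule SUP_least)
      fix t :: real
      have "nrm ?M (B1 X A u v t) \<le> (\<Sum>i\<in>UNIV. C * K i * nrm (Linf_time ?M) u * nrm (Linf_time ?M) v)"
        using bound uv by (auto simp: vec_space_def intro!: sum_mono)
      then show "ereal (nrm ?M (B1 X A u v t))
          \<le> ereal ((\<Sum>i\<in>UNIV. C * K i) * nrm (Linf_time ?M) u * nrm (Linf_time ?M) v)"
        by (simp add: sum_distrib_right)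
    qed
  qed
qed

end
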